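(* Let $R$ be a Krull-type domain and $I$ a (nonzero fractional) $t$-ideal of $R$. Set $T:=(I:I)$ and let $\Gamma(I)$ be the set of finite (nonempty) intersections of $t$-idempotent $t$-maximal ideals of $T$. Then $\overline{I}$ is an idempotent of $\mathcal{S}_t(R)$ if and only if there exists a unique $J\in\{T\}\cup\Gamma(I)$ such that $\overline{I}=\overline{J}$. Moreover, in this case, denoting by $G_{\overline{J}}$ the constituent group of $\mathcal{S}_t(R)$ associated with the idempotent $\overline{J}$: (1) if $J=T$, then $G_{\overline{J}}\cong \mathrm{Cl}(T)$; (2) if $J=\bigcap_{1\le i\le r}Q_i\in\Gamma(I)$, where $Q_1,\dots,Q_r$ are distinct $t$-idempotent $t$-maximal ideals of $T$, then the sequence of natural group homomorphisms $$0\longrightarrow \mathrm{Cl}(T)\stackrel{\phi}{\longrightarrow} G_{\overline{J}}\stackrel{\psi}{\longrightarrow}\prod_{1\le i\le r}G_{\overline{Q_iT_{Q_i}}}\longrightarrow 0$$ is exact, where $G_{\overline{Q_iT_{Q_i}}}$ denotes the constituent group of the Clifford semigroup $\mathcal{S}(T_{Q_i})$ associated with $\overline{Q_iT_{Q_i}}$, the map $\phi$ sends the class $[L]$ of a $t$-invertible $t$-ideal $L$ of $T$ to $\overline{(LJ)_t}$, and the map $\psi$ sends $\overline{L}$ to $(\overline{LT_{Q_i}})_{1\le i\le r}$.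
   Context: All rings are integral domains. Let $R$ be a domain with quotient field $K$. For nonzero fractional ideals $A,B$ of $R$, $(A:B)=\{x\in K\mid xB\subseteq A\}$ and $A^{-1}=(R:A)$. For a nonzero fractional ideal $A$, $A_v=(A^{-1})^{-1}$ and $A_t=\bigcup B_v$ with $B$ ranging over the nonzero finitely generated fractional subideals of $A$. $A$ is a ($R$-)$t$-ideal if $A_t=A$; $t$-ideals are nonzero and may be fractional. A $t$-prime ideal is a prime $t$-ideal; a $t$-maximal ideal is an ideal maximal among the proper integral $t$-ideals. A $t$-ideal $A$ is $t$-idempotent if $(A^2)_t=A$. The set $F_t(R)$ of fractional $t$-ideals is a commutative semigroup under $(A,B)\mapsto (AB)_t$ with unit $R$; its invertible elements are the $t$-invertible $t$-ideals, forming a group $Inv_t(R)$. Let $P(R)$ be the group of nonzero principal fractional ideals and $F(R)$ the multiplicative semigroup of all nonzero fractional ideals. Put $\mathrm{Cl}(R)=Inv_t(R)/P(R)$ (class group), $\mathcal{S}_t(R)=F_t(R)/P(R)$ ($t$-class semigroup), $\mathcal{S}(R)=F(R)/P(R)$ (class semigroup). $\overline{A}$ denotes the class of $A$ in the semigroup under consideration; thus $\overline{A}=\overline{B}$ iff $A=xB$ for some $0\ne x\in K$. In (2), $(LJ)_t$ is the $t$-closure with respect to $R$. A PVMD is a domain $R$ such that $R_M$ is a valuation domain for every $t$-maximal ideal $M$. A Krull-type domain is a PVMD of finite $t$-character, i.e. each proper (integral) $t$-ideal is contained in only finitely many $t$-maximal ideals. A commutative semigroup $S$ is Clifford if for every $x\in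 S$ there is $a\in S$ with $x^2a=x$. Such an $S$ is the disjoint union of its constituent groups $G_e$, $e$ ranging over the idempotents of $S$, where $G_e=\{ae\mid abe=e \text{ for some } b\in S\}$ is the largest subgroup of $S$ with identity $e$. It is known that $\mathcal{S}_t(R)$ is Clifford when $R$ is a Krull-type domain, and that $\mathcal{S}(V)$ is Clifford for every valuation domain $V$ (here each $T_{Q_i}$ is a valuation domain). $T=(I:I)$ is an overring of $R$ that is a fractional ideal of $R$; "$t$-idempotent $t$-maximal ideals of $T$" refers to the $t$-operation of the domain $T$. *)

theory Defs
  imports "HOL-Algebra.Product_Groups"
begin

(* Domains are represented as subrings R of a field type 'k that have 'k as quotient field.
   Overrings and fractional ideals of R are then subsets of 'k as well. *)

definition domain_in :: "'k::field set \<Rightarrow> bool" where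
  "domain_in R \<longleftrightarrow> 1 \<in> R \<and> (\<forall>x\<in>R. \<forall>y\<in>R. x - y \<in> R \<and> x * y \<in> R)
     \<and> (\<forall>z. \<exists>a\<in>R. \<exists>b\<in>R. b \<noteq> 0 \<and> z = a / b)"

definition submodule_of :: "'k::field set \<Rightarrow> 'k set \<Rightarrow> bool" where
  "submodule_of R A \<longleftrightarrow> 0 \<in> A \<and> (\<forall>x\<in>A. \<forall>y\<in>A. x + y \<in> A) \<and> (\<forall>r\<in>R. \<forall>x\<in>A. r * x \<in> A)"

definition submodule_gen :: "'k::field set \<Rightarrow> 'k set \<Rightarrow> 'k set" where
  "submodule_gen R S = \<Inter>{A. submodule_of R A \<and> S \<subseteq> A}"

definition fractional_ideal :: "'k::field set \<Rightarrow> 'k set \<Rightarrow> bool" where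
  "fractional_ideal R A \<longleftrightarrow> submodule_of R A \<and> A \<noteq> {0} \<and> (\<exists>d\<in>R. d \<noteq> 0 \<and> (\<forall>a\<in>A. d * a \<in> R))"

definition fin_gen :: "'k::field set \<Rightarrow> 'k set \<Rightarrow> bool" where
  "fin_gen R A \<longleftrightarrow> (\<exists>S. finite S \<and> A = submodule_gen R S)"

(* The product of two additive subgroups of 'k. It does not mention R: it is the R-module
   product for every R over which one of the factors is a module, and L V is also the
   extension of an ideal L to an overring V. *)
definition module_prod :: "'k::field set \<Rightarrow> 'k set \<Rightarrow> 'k set" where
  "module_prod A B = {(\<Sum>i<n. a i * b i) | (n::nat) a b. \<forall>i<n. a i \<in> A \<and> b i \<in> B}"

definition colon :: "'k::field set \<Rightarrow> 'k set \<Rightarrow> 'k set" where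
  "colon A B = {x. \<forall>b\<in>B. x * b \<in> A}"

definition v_closure :: "'k::field set \<Rightarrow> 'k set \<Rightarrow> 'k set" where
  "v_closure R A = colon R (colon R A)"

definition t_closure :: "'k::field set \<Rightarrow> 'k set \<Rightarrow> 'k set" where
  "t_closure R A = \<Union>{v_closure R B | B. fractional_ideal R B \<and> fin_gen R B \<and> B \<subseteq> A}"

definition t_ideal :: "'k::field set \<Rightarrow> 'k set \<Rightarrow> bool" where
  "t_ideal R A \<longleftrightarrow> fractional_ideal R A \<and> t_closure R A = A"

definition t_idempotent :: "'k::field set \<Rightarrow> 'k set \<Rightarrow> bool" where
  "t_idempotent R A \<longleftrightarrow> t_ideal R A \<and> t_closure R (module_prod A A) = A"

definition t_maximal :: "'k::field set \<Rightarrow> 'k set \<Rightarrow> bool" where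
  "t_maximal R M \<longleftrightarrow> t_ideal R M \<and> M \<subset> R \<and> (\<forall>N. t_ideal R N \<and> N \<subset> R \<and> M \<subseteq> N \<longrightarrow> N = M)"

definition localize :: "'k::field set \<Rightarrow> 'k set \<Rightarrow> 'k set" where
  "localize R P = {a / s | a s. a \<in> R \<and> s \<in> R - P}"

definition valuation_domain :: "'k::field set \<Rightarrow> bool" where
  "valuation_domain V \<longleftrightarrow> domain_in V \<and> (\<forall>x. x \<in> V \<or> inverse x \<in> V)"

definition pvmd :: "'k::field set \<Rightarrow> bool" where
  "pvmd R \<longleftrightarrow> domain_in R \<and> (\<forall>M. t_maximal R M \<longrightarrow> valuation_domain (localize R M))"

definition finite_t_character :: "'k::field set \<Rightarrow> bool" where
  "finite_t_character R \<longleftrightarrow> (\<forall>A. t_ideal R A \<and> A \<subset> R \<longrightarrow> finite {M. t_maximal R M \<and> A \<subseteq> M})"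

definition krull_type :: "'k::field set \<Rightarrow> bool" where
  "krull_type R \<longleftrightarrow> pvmd R \<and> finite_t_character R"

definition F_t :: "'k::field set \<Rightarrow> 'k set monoid" where
  "F_t R = \<lparr>carrier = {A. t_ideal R A}, mult = (\<lambda>A B. t_closure R (module_prod A B)), one = R\<rparr>"

definition F_frac :: "'k::field set \<Rightarrow> 'k set monoid" where
  "F_frac R = \<lparr>carrier = {A. fractional_ideal R A}, mult = module_prod, one = R\<rparr>"

definition Inv_t :: "'k::field set \<Rightarrow> 'k set monoid" where
  "Inv_t R = units_of (F_t R)"

definition Prin :: "'k::field set \<Rightarrow> 'k set set" where
  "Prin R = {(\<lambda>r. x * r) ` R | x. x \<noteq> 0}"

(* The quotients by Prin R use the library's construction Mod, which makes sense for monoids.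
   The class of A is the coset Prin R #> A, i.e. the set of all x A with x nonzero. *)

definition t_class_semigroup :: "'k::field set \<Rightarrow> 'k set set monoid" where
  "t_class_semigroup R = F_t R Mod Prin R"

definition class_semigroup :: "'k::field set \<Rightarrow> 'k set set monoid" where
  "class_semigroup R = F_frac R Mod Prin R"

definition class_group :: "'k::field set \<Rightarrow> 'k set set monoid" where
  "class_group R = Inv_t R Mod Prin R"

definition t_cls :: "'k::field set \<Rightarrow> 'k set \<Rightarrow> 'k set set" where
  "t_cls R A = Prin R #>\<^bsub>F_t R\<^esub> A"

definition frac_cls :: "'k::field set \<Rightarrow> 'k set \<Rightarrow> 'k set set" where
  "frac_cls R A = Prin R #>\<^bsub>F_frac R\<^esub> A"

definition inv_cls :: "'k::field set \<Rightarrow> 'k set \<Rightarrow> 'k set set" where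
  "inv_cls R A = Prin R #>\<^bsub>Inv_t R\<^esub> A"

definition idempotent_in :: "('a, 'b) monoid_scheme \<Rightarrow> 'a \<Rightarrow> bool" where
  "idempotent_in S e \<longleftrightarrow> e \<in> carrier S \<and> e \<otimes>\<^bsub>S\<^esub> e = e"

definition constituent_group :: "('a, 'b) monoid_scheme \<Rightarrow> 'a \<Rightarrow> 'a monoid" where
  "constituent_group S e =
     \<lparr>carrier = {a \<otimes>\<^bsub>S\<^esub> e | a. a \<in> carrier S \<and> (\<exists>b\<in>carrier S. a \<otimes>\<^bsub>S\<^esub> b \<otimes>\<^bsub>S\<^esub> e = e)},
      mult = mult S, one = e\<rparr>"

definition Gamma_of :: "'k::field set \<Rightarrow> 'k set set" where
  "Gamma_of I = {\<Inter>\<Q> | \<Q>. finite \<Q> \<and> \<Q> \<noteq> {} \<and>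
     (\<forall>Q\<in>\<Q>. t_maximal (colon I I) Q \<and> t_idempotent (colon I I) Q)}"

(* Exactness of 0 -> G -> H -> K -> 0. The library's short_exact_sequence is not applicable,
   since it forces all groups to have the same element type. *)
definition short_exact ::
  "('a, 'm) monoid_scheme \<Rightarrow> ('b, 'n) monoid_scheme \<Rightarrow> ('c, 'p) monoid_scheme
     \<Rightarrow> ('a \<Rightarrow> 'b) \<Rightarrow> ('b \<Rightarrow> 'c) \<Rightarrow> bool" where
  "short_exact G H K f g \<longleftrightarrow> group G \<and> group H \<and> group K \<and>
     f \<in> mon G H \<and> g \<in> epi H K \<and> f ` carrier G = kernel H K g"

end

theory Submission
  imports Defs
begin

text \<open>In a Krull-type domain the \<open>t\<close>-closure is detected by the valuation rings \<open>R\<^sub>M\<close>: \<open>x \<in> A\<^sub>t\<close> iff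
  \<open>x \<in> A R\<^sub>M\<close> for all \<open>t\<close>-maximal \<open>M\<close>. If \<open>T = (I : I)\<close>, the \<open>t\<close>-closures over \<open>R\<close> and \<open>T\<close> agree on
  \<open>T\<close>-modules and \<open>T\<close> is again of Krull type, so everything can be decided over \<open>T\<close>.

  Let \<open>J\<close> be \<open>t\<close>-idempotent with \<open>(J : J) = T\<close>. By finite character each \<open>J T\<^sub>N\<close> has multiplier ring \<open>T\<^sub>N\<close>,
  and an idempotent module of a valuation ring with that property is the ring or its maximal ideal.
  Hence \<open>J\<close> is \<open>T\<close> or the intersection of the finitely many \<open>t\<close>-maximal ideals containing it.

  For the exact sequence, finite character provides finite subsets of \<open>Q\<^sub>i\<close> contained in no other
  \<open>t\<close>-maximal ideal. With them local data at the \<open>Q\<^sub>i\<close> are glued to an ideal, with inverse \<open>(J : L)\<close>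
  in the constituent group; and if \<open>A\<close> with inverse \<open>B\<close> is locally a multiple of the \<open>Q\<^sub>i\<close>, then \<open>(A : J)\<close>
  is \<open>t\<close>-invertible with inverse \<open>(B : J)\<close> and restores \<open>A\<close> after multiplication by \<open>J\<close>.\<close>

section \<open>The t-closure\<close>

text \<open>Forming \<open>(J : J)\<close> need not commute with localization when J is not finitely
  generated, so the passage from \<open>(J : J) = T\<close> to the localizations J T_N is the
  delicate point. It works because a given s lies in only finitely many t-maximal ideals and each of
  them contributes a single denominator (\<open>local_multiplier\<close>). After that the
  classification is a comparison inside a valuation ring.

  Uniqueness of J needs no structure theory: if J = x J' and both are t-idempotent, then x x J' = x
  J', and x cancels.

  A class is the set of all nonzero multiples x A, a description in which the ring does not occur.
  Classes over R, over T and over a localization of T can therefore be compared as sets. The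
  isomorphism in (1) is the identity map, and the maps in (2) are images of the maps on ideals, so
  that no representative has to be chosen.

  Working with classes leaves a free scalar at every Q. This freedom is spent on moving each local
  module between a finite separating set and the maximal ideal of the valuation ring, which makes
  gluing possible.\<close>

abbreviation nz_submodule :: "'k::field set \<Rightarrow> 'k set \<Rightarrow> bool" where
  "nz_submodule R A \<equiv> submodule_of R A \<and> A \<noteq> {0}"

definition prime_in :: "'k::field set \<Rightarrow> 'k set \<Rightarrow> bool" where
  "prime_in R P \<longleftrightarrow> submodule_of R P \<and> P \<subseteq> R \<and> 1 \<notin> P
     \<and> (\<forall>a\<in>R. \<forall>b\<in>R. a * b \<in> P \<longrightarrow> a \<in> P \<or> b \<in> P)"

text \<open>The localization A R_P in terms of denominators, so that membership is one existential
  statement. \<open>module_prod_localize\<close> identifies it with the product that occurs in the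
  theorem.\<close>

definition local_part :: "'k::field set \<Rightarrow> 'k set \<Rightarrow> 'k set \<Rightarrow> 'k set" where
  "local_part R P A = {x. \<exists>u\<in>R - P. u * x \<in> A}"

lemma submodule_ofD:
  assumes "submodule_of R A"
  shows "0 \<in> A" "\<And>x y. x \<in> A \<Longrightarrow> y \<in> A \<Longrightarrow> x + y \<in> A" "\<And>r x. r \<in> R \<Longrightarrow> x \<in> A \<Longrightarrow> r * x \<in> A"
  using assms by (auto simp: submodule_of_def)

lemma submodule_of_Int:
  "submodule_of R A \<Longrightarrow> submodule_of R B \<Longrightarrow> submodule_of R (A \<inter> B)"
  by (auto simp: submodule_of_def)

lemma submodule_of_subring: "submodule_of T A \<Longrightarrow> R \<subseteq> T \<Longrightarrow> submodule_of R A"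
  by (auto simp: submodule_of_def)

lemma submodule_of_scale:
  assumes "submodule_of R A"
  shows "submodule_of R ((*) c ` A)"
  unfolding submodule_of_def
proof (intro conjI ballI)
  show "0 \<in> (*) c ` A"
    using submodule_ofD(1)[OF assms] by (intro image_eqI[of _ _ 0]) auto
next
  fix x y assume "x \<in> (*) c ` A" "y \<in> (*) c ` A"
  then obtain a b where "a \<in> A" "b \<in> A" "x = c * a" "y = c * b" by blast
  then show "x + y \<in> (*) c ` A"
    using submodule_ofD(2)[OF assms] by (intro image_eqI[of _ _ "a + b"]) (auto simp: algebra_simps)
next
  fix r x assume "r \<in> R" "x \<in> (*) c ` A"
  then obtain a where "a \<in> A" "x = c * a" by blast
  then show "r * x \<in> (*) c ` A"
    using submodule_ofD(3)[OF assms \<open>r \<in> R\<close> \<open>a \<in> A\<close>]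
    by (intro image_eqI[of _ _ "r * a"]) (simp_all add: mult.left_commute)
qed

lemma scale_nonzero:
  fixes c :: "'k::field"
  assumes "nz_submodule R A" "c \<noteq> 0"
  shows "(*) c ` A \<noteq> {0}"
proof -
  obtain a where "a \<in> A" "a \<noteq> 0"
    using assms submodule_ofD(1)[of R A] by blast
  then have "c * a \<in> (*) c ` A" "c * a \<noteq> 0" using assms by auto
  then show ?thesis by blast
qed

lemma submodule_of_preimage:
  assumes "submodule_of R A"
  shows "submodule_of R {z. z * c \<in> A}"
  using assms by (auto simp: submodule_of_def algebra_simps)

section \<open>Generated submodules and the divisorial closure of a set\<close>

lemma submodule_gen_subset: "S \<subseteq> submodule_gen R S"
  by (auto simp: submodule_gen_def)

lemma submodule_gen_least: "submodule_of R A \<Longrightarrow> S \<subseteq> A \<Longrightarrow> submodule_gen R S \<subseteq> A"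
  by (auto simp: submodule_gen_def)

lemma submodule_of_gen: "submodule_of R (submodule_gen R S)"
  by (auto simp: submodule_gen_def submodule_of_def)

text \<open>S may be any set, so finite generating sets can stand in for the ideals they generate.
  Membership proofs only have to test the multipliers y that carry S into R.\<close>

lemma v_closure_iff: "x \<in> v_closure R S \<longleftrightarrow> (\<forall>y. (\<forall>s\<in>S. y * s \<in> R) \<longrightarrow> y * x \<in> R)"
  by (auto simp: v_closure_def colon_def mult.commute)

lemma v_closure_mono: "S \<subseteq> S' \<Longrightarrow> v_closure R S \<subseteq> v_closure R S'"
  by (fastforce simp: v_closure_iff)

lemma v_closure_extensive: "S \<subseteq> v_closure R S"
  by (auto simp: v_closure_iff)

lemma v_closure_idem: "v_closure R (v_closure R S) = v_closure R S"
  by (auto simp: v_closure_iff)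

lemma v_closure_scale: "x \<in> v_closure R S \<Longrightarrow> c * x \<in> v_closure R ((*) c ` S)"
  unfolding v_closure_iff by (metis (no_types, lifting) imageI mult.assoc)

locale domain_subring =
  fixes R :: "'k::field set"
  assumes domain: "domain_in R"
begin

lemma one_mem: "1 \<in> R" and diff_mem: "x \<in> R \<Longrightarrow> y \<in> R \<Longrightarrow> x - y \<in> R"
  and mult_mem: "x \<in> R \<Longrightarrow> y \<in> R \<Longrightarrow> x * y \<in> R"
  using domain by (auto simp: domain_in_def)

lemma zero_mem: "0 \<in> R"
  using diff_mem[OF one_mem one_mem] by simp

lemma uminus_mem: "x \<in> R \<Longrightarrow> - x \<in> R"
  using diff_mem[OF zero_mem] by fastforce

lemma add_mem: "x \<in> R \<Longrightarrow> y \<in> R \<Longrightarrow> x + y \<in> R"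
  using diff_mem[of x "- y"] uminus_mem by fastforce

lemma submodule_self: "submodule_of R R"
  by (simp add: submodule_of_def zero_mem add_mem mult_mem)

lemma prod_mem: "(\<And>i. i \<in> F \<Longrightarrow> f i \<in> R) \<Longrightarrow> prod f F \<in> R"
  by (induction F rule: infinite_finite_induct) (auto simp: one_mem mult_mem)

lemma submodule_diff:
  assumes "submodule_of R A" "x \<in> A" "y \<in> A"
  shows "x - y \<in> A"
proof -
  have "(- 1) * y \<in> A"
    using assms uminus_mem[OF one_mem] by (auto simp: submodule_of_def)
  then have "x + (- 1) * y \<in> A"
    using submodule_ofD(2)[OF assms(1,2)] by blast
  then show ?thesis by simp
qed

lemma denominator: "\<exists>d\<in>R. d \<noteq> 0 \<and> d * x \<in> R"
proof -
  have "\<exists>a\<in>R. \<exists>b\<in>R. b \<noteq> 0 \<and> x = a / b" using domain unfolding domain_in_def by blast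
  then obtain a b where "a \<in> R" "b \<in> R" "b \<noteq> 0" "x = a / b" by blast
  then show ?thesis by (intro bexI[of _ b]) auto
qed

lemma common_denominator: "finite S \<Longrightarrow> \<exists>d\<in>R. d \<noteq> 0 \<and> (\<forall>x\<in>S. d * x \<in> R)"
proof (induction S rule: finite_induct)
  case empty
  show ?case using one_mem by (intro bexI[of _ 1]) auto
next
  case (insert x S)
  then obtain d where d: "d \<in> R" "d \<noteq> 0" "\<forall>x\<in>S. d * x \<in> R" by blast
  obtain e where e: "e \<in> R" "e \<noteq> 0" "e * x \<in> R" using denominator by blast
  have "d * e * x \<in> R" using mult_mem[OF d(1) e(3)] by (simp add: mult.assoc)
  moreover have "d * e * y \<in> R" if "y \<in> S" for y
    using mult_mem[OF e(1), of "d * y"] d(3) that by (simp add: ac_simps)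
  ultimately show ?case
    using d e mult_mem by (intro bexI[of _ "d * e"]) auto
qed

lemma v_closure_submodule: "submodule_of R (v_closure R S)"
  unfolding submodule_of_def v_closure_iff
proof (intro conjI ballI allI impI)
  fix r x y assume "r \<in> R" "x \<in> v_closure R S" "\<forall>s\<in>S. y * s \<in> R"
  then have "y * x \<in> R" by (simp add: v_closure_iff)
  then show "y * (r * x) \<in> R"
    using mult_mem[OF \<open>r \<in> R\<close>, of "y * x"] by (simp add: ac_simps)
qed (auto simp: zero_mem add_mem distrib_left v_closure_iff)

lemma v_closure_gen: "v_closure R (submodule_gen R S) = v_closure R S"
proof
  have "submodule_gen R S \<subseteq> v_closure R S"
    by (rule submodule_gen_least[OF v_closure_submodule v_closure_extensive])
  then show "v_closure R (submodule_gen R S) \<subseteq> v_closure R S"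
    using v_closure_mono v_closure_idem by metis
qed (rule v_closure_mono[OF submodule_gen_subset])

lemma fractional_gen:
  assumes "finite S" "\<not> S \<subseteq> {0}"
  shows "fractional_ideal R (submodule_gen R S)"
proof -
  obtain d where d: "d \<in> R" "d \<noteq> 0" "\<forall>x\<in>S. d * x \<in> R"
    using common_denominator[OF assms(1)] by blast
  have "submodule_gen R S \<subseteq> {z. z * d \<in> R}"
    using d by (intro submodule_gen_least submodule_of_preimage submodule_self) (auto simp: mult.commute)
  then show ?thesis
    using d assms(2) submodule_of_gen submodule_gen_subset[of S R]
    unfolding fractional_ideal_def by (fastforce simp: mult.commute)
qed

text \<open>Finite sets can replace finitely generated ideals because, by
  \<open>v_closure_gen\<close>, an ideal and a generating set have the same divisorial
  closure.\<close>

lemma t_closure_iff: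
  assumes "nz_submodule R A"
  shows "x \<in> t_closure R A \<longleftrightarrow> (\<exists>S. finite S \<and> S \<subseteq> A \<and> x \<in> v_closure R S)"
proof
  assume "x \<in> t_closure R A"
  then obtain B S where "x \<in> v_closure R B" "B \<subseteq> A" "finite S" "B = submodule_gen R S"
    by (auto simp: t_closure_def fin_gen_def)
  then show "\<exists>S. finite S \<and> S \<subseteq> A \<and> x \<in> v_closure R S"
    using v_closure_gen submodule_gen_subset[of S R] by (intro exI[of _ S]) auto
next
  assume "\<exists>S. finite S \<and> S \<subseteq> A \<and> x \<in> v_closure R S"
  then obtain S where S: "finite S" "S \<subseteq> A" "x \<in> v_closure R S" by blast
  \<comment> \<open>Adding a nonzero element of A keeps the generated ideal nonzero even when S is
    empty or consists of 0.\<close>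
  obtain a where a: "a \<in> A" "a \<noteq> 0" using assms by (auto simp: submodule_of_def)
  let ?B = "submodule_gen R (insert a S)"
  have "fractional_ideal R ?B" using S a by (intro fractional_gen) auto
  moreover have "fin_gen R ?B" using S by (auto simp: fin_gen_def)
  moreover have "?B \<subseteq> A" using S a assms by (intro submodule_gen_least) auto
  moreover have "x \<in> v_closure R ?B"
    using S(3) v_closure_mono[of S "insert a S" R] by (auto simp: v_closure_gen)
  ultimately show "x \<in> t_closure R A" unfolding t_closure_def by blast
qed

lemma t_closure_extensive:
  assumes "nz_submodule R A"
  shows "A \<subseteq> t_closure R A"
proof
  fix x assume "x \<in> A"
  then show "x \<in> t_closure R A"
    unfolding t_closure_iff[OF assms] using v_closure_extensive by (intro exI[of _ "{x}"]) auto
qed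

lemma nz_submodule_t_closure:
  assumes A: "nz_submodule R A"
  shows "nz_submodule R (t_closure R A)"
proof (intro conjI)
  show "submodule_of R (t_closure R A)"
    unfolding submodule_of_def
  proof (intro conjI ballI)
    show "0 \<in> t_closure R A" using t_closure_extensive[OF A] A by (auto simp: submodule_of_def)
  next
    fix x y assume "x \<in> t_closure R A" "y \<in> t_closure R A"
    then obtain S S' where S: "finite S" "S \<subseteq> A" "x \<in> v_closure R S"
      "finite S'" "S' \<subseteq> A" "y \<in> v_closure R S'"
      by (auto simp: t_closure_iff[OF A])
    then have "x \<in> v_closure R (S \<union> S')" "y \<in> v_closure R (S \<union> S')"
      using v_closure_mono[of S "S \<union> S'" R] v_closure_mono[of S' "S \<union> S'" R] by auto
    then show "x + y \<in> t_closure R A"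
      using S submodule_ofD(2)[OF v_closure_submodule]
      unfolding t_closure_iff[OF A] by (intro exI[of _ "S \<union> S'"]) auto
  next
    fix r x assume "r \<in> R" "x \<in> t_closure R A"
    then show "r * x \<in> t_closure R A"
      using submodule_ofD(3)[OF v_closure_submodule] unfolding t_closure_iff[OF A] by blast
  qed
  show "t_closure R A \<noteq> {0}"
    using t_closure_extensive[OF A] A by (auto simp: submodule_of_def)
qed

text \<open>The union of finitely many witnesses is again a witness, since the divisorial closure is
  monotone. This finitary character makes the t-closure idempotent.\<close>

lemma finite_subset_t_closure:
  assumes A: "nz_submodule R A" and "finite F" "F \<subseteq> t_closure R A"
  shows "\<exists>S. finite S \<and> S \<subseteq> A \<and> F \<subseteq> v_closure R S"
  using assms(2,3)
proof (induction F rule: finite_induct)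
  case (insert x F)
  then obtain S S' where "finite S" "S \<subseteq> A" "F \<subseteq> v_closure R S"
    "finite S'" "S' \<subseteq> A" "x \<in> v_closure R S'"
    by (auto simp: t_closure_iff[OF A])
  then show ?case
    using v_closure_mono[of S "S \<union> S'" R] v_closure_mono[of S' "S \<union> S'" R]
    by (intro exI[of _ "S \<union> S'"]) auto
qed auto

lemma t_closure_idem:
  assumes A: "nz_submodule R A"
  shows "t_closure R (t_closure R A) = t_closure R A"
proof
  show "t_closure R (t_closure R A) \<subseteq> t_closure R A"
  proof
    fix x assume "x \<in> t_closure R (t_closure R A)"
    then obtain F where F: "finite F" "F \<subseteq> t_closure R A" "x \<in> v_closure R F"
      using t_closure_iff[OF nz_submodule_t_closure[OF A]] by auto
    then obtain S where "finite S" "S \<subseteq> A" "F \<subseteq> v_closure R S"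
      using finite_subset_t_closure[OF A F(1,2)] by blast
    then show "x \<in> t_closure R A"
      using F(3) v_closure_mono[of F "v_closure R S" R] unfolding t_closure_iff[OF A]
      by (auto simp: v_closure_idem)
  qed
qed (rule t_closure_extensive[OF nz_submodule_t_closure[OF A]])

lemma t_closure_mono: "A \<subseteq> B \<Longrightarrow> t_closure R A \<subseteq> t_closure R B"
  unfolding t_closure_def by blast

lemma fractional_t_closure:
  assumes "fractional_ideal R A"
  shows "fractional_ideal R (t_closure R A)"
proof -
  obtain d where d: "d \<in> R" "d \<noteq> 0" "\<forall>a\<in>A. d * a \<in> R"
    using assms by (auto simp: fractional_ideal_def)
  have A: "nz_submodule R A" using assms by (auto simp: fractional_ideal_def)
  have "d * x \<in> R" if "x \<in> t_closure R A" for x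
    using that d(3) unfolding t_closure_iff[OF A] v_closure_iff by blast
  then show ?thesis
    using d nz_submodule_t_closure[OF A] unfolding fractional_ideal_def by blast
qed

lemma t_ideal_t_closure: "fractional_ideal R A \<Longrightarrow> t_ideal R (t_closure R A)"
  using fractional_t_closure t_closure_idem unfolding t_ideal_def fractional_ideal_def by blast

lemma t_ideal_nz: "t_ideal R A \<Longrightarrow> nz_submodule R A"
  by (simp add: t_ideal_def fractional_ideal_def)

lemma t_idealI:
  assumes "fractional_ideal R A"
    and "\<And>S x. finite S \<Longrightarrow> S \<subseteq> A \<Longrightarrow> x \<in> v_closure R S \<Longrightarrow> x \<in> A"
  shows "t_ideal R A"
proof -
  have A: "nz_submodule R A" using assms(1) by (auto simp: fractional_ideal_def)
  show ?thesis
    using assms t_closure_extensive[OF A] unfolding t_ideal_def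
    by (auto simp: t_closure_iff[OF A])
qed

lemma t_idealD: "t_ideal R A \<Longrightarrow> finite S \<Longrightarrow> S \<subseteq> A \<Longrightarrow> x \<in> v_closure R S \<Longrightarrow> x \<in> A"
  using t_closure_iff[OF t_ideal_nz] unfolding t_ideal_def by blast

lemma t_closure_least: "t_ideal R A \<Longrightarrow> B \<subseteq> A \<Longrightarrow> t_closure R B \<subseteq> A"
  using t_closure_mono unfolding t_ideal_def by blast

lemma fractional_ideal_nz: "fractional_ideal R A \<Longrightarrow> nz_submodule R A"
  by (simp add: fractional_ideal_def)

lemma fractional_subset:
  assumes "fractional_ideal R B" "nz_submodule R A" "A \<subseteq> B"
  shows "fractional_ideal R A"
  using assms unfolding fractional_ideal_def by blast

lemma fractional_scale:
  assumes "fractional_ideal R A" "c \<noteq> 0"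
  shows "fractional_ideal R ((*) c ` A)"
proof -
  obtain d where d: "d \<in> R" "d \<noteq> 0" "\<forall>a\<in>A. d * a \<in> R"
    using assms by (auto simp: fractional_ideal_def)
  obtain e where e: "e \<in> R" "e \<noteq> 0" "e * c \<in> R" using denominator by blast
  have "d * e * (c * a) \<in> R" if "a \<in> A" for a
    using mult_mem[OF e(3), of "d * a"] d(3) that by (simp add: ac_simps)
  then have "\<exists>d\<in>R. d \<noteq> 0 \<and> (\<forall>a\<in>(*) c ` A. d * a \<in> R)"
    using d e mult_mem by (intro bexI[of _ "d * e"]) auto
  moreover have "(*) c ` A \<noteq> {0}"
  using assms by (intro scale_nonzero) (auto simp: fractional_ideal_def)
  ultimately show ?thesis
    using assms submodule_of_scale unfolding fractional_ideal_def by blast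
qed

lemma scale_cancel: "(c::'k) \<noteq> 0 \<Longrightarrow> (*) (inverse c) ` (*) c ` A = A"
  by (simp add: image_image mult.assoc[symmetric])

text \<open>Only one inclusion is proved by moving witnesses. The other is the same inclusion for
  \<open>inverse c\<close>, multiplied by c.\<close>

lemma t_closure_scale:
  assumes A: "nz_submodule R A" and c: "c \<noteq> 0"
  shows "t_closure R ((*) c ` A) = (*) c ` t_closure R A"
proof -
  have sub: "(*) e ` t_closure R B \<subseteq> t_closure R ((*) e ` B)"
    if B: "nz_submodule R B" and e: "e \<noteq> 0" for B e
  proof -
    have eB: "nz_submodule R ((*) e ` B)"
      using B e submodule_of_scale scale_nonzero by blast
    show ?thesis
    proof safe
      fix x assume "x \<in> t_closure R B"
      then obtain S where "finite S" "S \<subseteq> B" "x \<in> v_closure R S"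
        unfolding t_closure_iff[OF B] by blast
      then show "e * x \<in> t_closure R ((*) e ` B)"
        unfolding t_closure_iff[OF eB] using v_closure_scale
        by (intro exI[of _ "(*) e ` S"]) auto
    qed
  qed
  have cA: "nz_submodule R ((*) c ` A)"
    using A c submodule_of_scale scale_nonzero by blast
  have "(*) (inverse c) ` t_closure R ((*) c ` A) \<subseteq> t_closure R A"
    using sub[OF cA, of "inverse c"] c by (simp add: scale_cancel)
  then have "(*) c ` (*) (inverse c) ` t_closure R ((*) c ` A) \<subseteq> (*) c ` t_closure R A"
    by (rule image_mono)
  then have "t_closure R ((*) c ` A) \<subseteq> (*) c ` t_closure R A"
    using scale_cancel[of "inverse c"] c by simp
  then show ?thesis using sub[OF A c] by blast
qed

lemma t_ideal_scale: "t_ideal R A \<Longrightarrow> c \<noteq> 0 \<Longrightarrow> t_ideal R ((*) c ` A)"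
  unfolding t_ideal_def using fractional_scale t_closure_scale fractional_ideal_nz by simp

lemma fractional_self: "fractional_ideal R R"
  using submodule_self one_mem unfolding fractional_ideal_def
  by (auto intro!: bexI[of _ 1])

lemma t_ideal_self: "t_ideal R R"
  by (rule t_idealI[OF fractional_self]) (force simp: v_closure_iff dest: spec[of _ 1])

lemma t_ideal_Int:
  assumes "t_ideal R A" "t_ideal R B" "A \<inter> B \<noteq> {0}"
  shows "t_ideal R (A \<inter> B)"
proof (rule t_idealI)
  show "fractional_ideal R (A \<inter> B)"
    using assms submodule_of_Int fractional_subset[of A "A \<inter> B"]
    unfolding t_ideal_def fractional_ideal_def by blast
qed (use assms t_idealD in blast)

lemma colon_submodule: "submodule_of R A \<Longrightarrow> submodule_of R (colon A B)"
  by (auto simp: submodule_of_def colon_def distrib_right mult.assoc)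

lemma colon_nonzero:
  assumes "nz_submodule R A" "fractional_ideal R B"
  shows "colon A B \<noteq> {0}"
proof -
  obtain a where a: "a \<in> A" "a \<noteq> 0" using assms by (auto simp: submodule_of_def)
  obtain d where d: "d \<in> R" "d \<noteq> 0" "\<forall>b\<in>B. d * b \<in> R"
    using assms by (auto simp: fractional_ideal_def)
  have "a * d * b \<in> A" if "b \<in> B" for b
    using submodule_ofD(3)[of R A "d * b" a] assms a d that by (auto simp: ac_simps)
  then have "a * d \<in> colon A B" by (simp add: colon_def)
  then show ?thesis using a d by auto
qed

text \<open>For one nonzero b in B the colon lies in the multiple of A by \<open>inverse b\<close>,
  which already has a denominator.\<close>

lemma fractional_colon:
  assumes "fractional_ideal R A" "fractional_ideal R B"
  shows "fractional_ideal R (colon A B)"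
proof -
  obtain b where b: "b \<in> B" "b \<noteq> 0" using assms by (auto simp: fractional_ideal_def submodule_of_def)
  have "colon A B \<subseteq> (*) (inverse b) ` A"
  proof
    fix x assume "x \<in> colon A B"
    then show "x \<in> (*) (inverse b) ` A"
      using b by (intro image_eqI[of _ _ "x * b"]) (auto simp: colon_def)
  qed
  moreover have "nz_submodule R (colon A B)"
    using assms colon_nonzero colon_submodule fractional_ideal_nz by blast
  ultimately show ?thesis
    using fractional_subset[OF fractional_scale[OF assms(1), of "inverse b"]] b by simp
qed

text \<open>Membership is tested one b at a time: multiplication by b carries the divisorial closure
  of S into that of b S, and b S is a finite subset of the t-ideal A.\<close>

lemma t_ideal_colon:
  assumes "t_ideal R A" "fractional_ideal R B"
  shows "t_ideal R (colon A B)"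
proof (rule t_idealI)
  show "fractional_ideal R (colon A B)"
    using assms fractional_colon by (simp add: t_ideal_def)
  fix S x assume S: "finite S" "S \<subseteq> colon A B" "x \<in> v_closure R S"
  have "x * b \<in> A" if b: "b \<in> B" for b
  proof -
    have "b * x \<in> v_closure R ((*) b ` S)" using S v_closure_scale by blast
    moreover have "(*) b ` S \<subseteq> A" using S b by (auto simp: colon_def mult.commute)
    ultimately have "b * x \<in> A" using t_idealD[OF assms(1), of "(*) b ` S" "b * x"] S(1)
      by blast
    then show ?thesis by (simp add: mult.commute)
  qed
  then show "x \<in> colon A B" by (simp add: colon_def)
qed

section \<open>t-maximal ideals and the local test for the t-closure\<close>

lemma t_ideal_proper_iff:
  assumes "t_ideal R B"
  shows "B \<subset> R \<longleftrightarrow> B \<subseteq> R \<and> 1 \<notin> B"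
proof -
  have "R \<subseteq> B" if "1 \<in> B"
    using submodule_ofD(3)[of R B _ 1] t_ideal_nz[OF assms] that by (simp add: subset_iff)
  then show ?thesis using one_mem by blast
qed

text \<open>Zorn's lemma applies because being a t-ideal is tested on finite subsets, and a finite
  subset of the union of a chain lies in one member of the chain.\<close>

lemma exists_t_maximal:
  assumes A: "t_ideal R A" "A \<subset> R"
  shows "\<exists>M. t_maximal R M \<and> A \<subseteq> M"
proof -
  let ?P = "{B. t_ideal R B \<and> B \<subset> R \<and> A \<subseteq> B}"
  note proper = t_ideal_proper_iff
  have "\<exists>M\<in>?P. \<forall>X\<in>?P. M \<subseteq> X \<longrightarrow> X = M"
  proof (rule subset_Zorn_nonempty)
    show "?P \<noteq> {}" using A by blast
    fix C assume C: "C \<noteq> {}" "subset.chain ?P C"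
    have mem: "t_ideal R B" "B \<subset> R" "A \<subseteq> B" if "B \<in> C" for B
      using C that unfolding subset.chain_def by auto
    have fin: "\<exists>B\<in>C. S \<subseteq> B" if "finite S" "S \<subseteq> \<Union>C" for S
      using finite_subset_Union_chain[OF that C] by blast
    have sub: "submodule_of R (\<Union>C)"
      unfolding submodule_of_def
    proof (intro conjI ballI)
      obtain B where "B \<in> C" using C(1) by blast
      then show "0 \<in> \<Union>C"
        using submodule_ofD(1)[of R B] t_ideal_nz[OF mem(1)] by blast
    next
      fix x y assume "x \<in> \<Union>C" "y \<in> \<Union>C"
      then obtain B where "B \<in> C" "{x, y} \<subseteq> B" using fin[of "{x, y}"] by blast
      then show "x + y \<in> \<Union>C"
        using submodule_ofD(2)[of R B x y] t_ideal_nz[OF mem(1)] by blast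
    next
      fix r x assume "r \<in> R" "x \<in> \<Union>C"
      then obtain B where "B \<in> C" "x \<in> B" by blast
      then show "r * x \<in> \<Union>C"
        using submodule_ofD(3)[of R B r x] t_ideal_nz[OF mem(1)] \<open>r \<in> R\<close> by blast
    qed
    have "t_ideal R (\<Union>C)"
    proof (rule t_idealI)
      obtain a where "a \<in> A" "a \<noteq> 0"
        using t_ideal_nz[OF A(1)] submodule_ofD(1)[of R A] by blast
      then have "\<Union>C \<noteq> {0}" using C(1) mem(3) by blast
      moreover have "\<Union>C \<subseteq> R" using mem(2) by blast
      ultimately show "fractional_ideal R (\<Union>C)"
        using sub by (intro fractional_subset[OF fractional_self]) auto
    next
      fix S x assume "finite S" "S \<subseteq> \<Union>C" "x \<in> v_closure R S"
      then obtain B where "B \<in> C" "S \<subseteq> B" using fin by blast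
      then show "x \<in> \<Union>C"
        using t_idealD[OF mem(1) \<open>finite S\<close> _ \<open>x \<in> v_closure R S\<close>] by blast
    qed
    moreover have "1 \<notin> B" "B \<subseteq> R" if "B \<in> C" for B
      using mem(2)[OF that] proper[OF mem(1)[OF that]] by blast+
    then have "1 \<notin> \<Union>C" "\<Union>C \<subseteq> R" by blast+
    moreover have "A \<subseteq> \<Union>C" using C(1) mem(3) by blast
    ultimately show "\<Union>C \<in> ?P" using proper by blast
  qed
  then obtain M where M: "M \<in> ?P" "\<forall>X\<in>?P. M \<subseteq> X \<longrightarrow> X = M" by blast
  then have "N = M" if "t_ideal R N \<and> N \<subset> R \<and> M \<subseteq> N" for N
    using that by blast
  then show ?thesis using M(1) unfolding t_maximal_def by blast
qed

lemma prime_t_maximal: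
  assumes M: "t_maximal R M"
  shows "prime_in R M"
  unfolding prime_in_def
proof (intro conjI ballI impI)
  have tM: "t_ideal R M" "M \<subset> R" using M by (auto simp: t_maximal_def)
  then show "submodule_of R M" "M \<subseteq> R" using t_ideal_nz by auto
  show "1 \<notin> M" using tM t_ideal_proper_iff by blast
  fix a b assume ab: "a \<in> R" "b \<in> R" "a * b \<in> M"
  show "a \<in> M \<or> b \<in> M"
  proof (cases "a = 0")
    case True
    then show ?thesis using t_ideal_nz[OF tM(1)] submodule_ofD(1) by blast
  next
    case False
    \<comment> \<open>The elements of R that a multiplies into M. This t-ideal contains M and b; if
      a is not in M it omits 1, so maximality makes it equal to M.\<close>
    let ?N = "R \<inter> (*) (inverse a) ` M"
    have N: "x \<in> ?N \<longleftrightarrow> x \<in> R \<and> a * x \<in> M" for x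
    proof -
      have "x \<in> (*) (inverse a) ` M \<longleftrightarrow> a * x \<in> M"
        using False by (auto simp: image_iff mult.assoc[symmetric] intro!: bexI[of _ "a * x"])
      then show ?thesis by simp
    qed
    have sub: "M \<subseteq> ?N"
      using tM ab t_ideal_nz submodule_ofD(3) unfolding subset_iff N by blast
    then have "t_ideal R ?N"
      using t_ideal_nz[OF tM(1)] submodule_ofD(1)[of R M] False
      by (intro t_ideal_Int t_ideal_self t_ideal_scale tM) auto
    moreover have "b \<in> ?N" using ab N by blast
    moreover have "?N \<subset> R" if "a \<notin> M"
      using N[of 1] that t_ideal_proper_iff[OF \<open>t_ideal R ?N\<close>] by simp
    ultimately show ?thesis
      using M sub unfolding t_maximal_def by metis
  qed
qed

text \<open>The elements of R that multiply x into the t-closure form a t-ideal \<open>?D\<close>.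
  Were it proper, a t-maximal M would contain it; but a denominator of x at M lies in
  \<open>?D\<close> and outside M. This argument is valid in every domain.\<close>

lemma mem_t_closure_local:
  assumes A: "nz_submodule R A"
    and loc: "\<And>M. t_maximal R M \<Longrightarrow> x \<in> local_part R M A"
  shows "x \<in> t_closure R A"
proof -
  let ?D = "{r \<in> R. r * x \<in> t_closure R A}"
  have tc: "nz_submodule R (t_closure R A)" by (rule nz_submodule_t_closure[OF A])
  obtain d where d: "d \<in> R" "d \<noteq> 0" "d * x \<in> R" using denominator by blast
  obtain a where a: "a \<in> A" "a \<noteq> 0" using A by (auto simp: submodule_of_def)
  obtain e where e: "e \<in> R" "e \<noteq> 0" "e * a \<in> R" using denominator by blast
  \<comment> \<open>A nonzero element of \<open>?D\<close>, built from denominators d of x and e of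
    a.\<close>
  have "(e * a * d) * x = e * (d * x) * a" by (simp add: ac_simps)
  moreover have "e * (d * x) * a \<in> A" using A submodule_ofD(3) mult_mem e d a by blast
  ultimately have "(e * a * d) * x \<in> t_closure R A"
    using t_closure_extensive[OF A] by (metis subsetD)
  then have nz: "e * a * d \<in> ?D" "e * a * d \<noteq> 0"
    using mult_mem[OF e(3) d(1)] e d a by auto
  have "submodule_of R ?D"
    using submodule_of_Int[OF submodule_self submodule_of_preimage, of "t_closure R A" x] tc
    by (simp add: Int_def)
  moreover have "?D \<noteq> {0}" using nz by blast
  ultimately have "fractional_ideal R ?D"
    by (intro fractional_subset[OF fractional_self]) simp_all
  then have D: "t_ideal R ?D"
  proof (rule t_idealI)
    fix S z assume S: "finite S" "S \<subseteq> ?D" "z \<in> v_closure R S"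
    then have "z \<in> R" using t_idealD[OF t_ideal_self S(1) _ S(3)] by blast
    have "x * z \<in> v_closure R ((*) x ` S)" using S v_closure_scale by blast
    moreover have "(*) x ` S \<subseteq> t_closure R A" using S(2) by (auto simp: mult.commute[of x])
    ultimately have "x * z \<in> t_closure R (t_closure R A)"
      using S(1) unfolding t_closure_iff[OF tc] by blast
    then show "z \<in> ?D" using \<open>z \<in> R\<close> by (simp add: t_closure_idem[OF A] mult.commute)
  qed
  have "1 \<in> ?D"
  proof (rule ccontr)
    assume "1 \<notin> ?D"
    then obtain M where M: "t_maximal R M" "?D \<subseteq> M"
      using exists_t_maximal[OF D] t_ideal_proper_iff[OF D] by auto
    then obtain u where "u \<in> R - M" "u * x \<in> A" using loc by (auto simp: local_part_def)
    then show False using t_closure_extensive[OF A] M(2) by blast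
  qed
  then show ?thesis by simp
qed

lemma one_mem_t_closure:
  assumes "nz_submodule R A" "A \<subseteq> R" "\<And>M. t_maximal R M \<Longrightarrow> \<not> A \<subseteq> M"
  shows "1 \<in> t_closure R A"
  using assms by (intro mem_t_closure_local) (auto simp: local_part_def)

end

section \<open>Products and localizations\<close>

lemma module_prodI: "a \<in> A \<Longrightarrow> b \<in> B \<Longrightarrow> a * b \<in> module_prod A B"
  unfolding module_prod_def
  by (rule CollectI, intro exI[of _ "1::nat"] exI[of _ "\<lambda>_. a"] exI[of _ "\<lambda>_. b"]) auto

lemma module_prod_zero: "0 \<in> module_prod A B"
  unfolding module_prod_def
  by (rule CollectI, intro exI[of _ "0::nat"] exI[of _ "\<lambda>_. 0"]) auto

lemma module_prod_least:
  assumes "0 \<in> C" "\<And>x y. x \<in> C \<Longrightarrow> y \<in> C \<Longrightarrow> x + y \<in> C"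
    and "\<And>a b. a \<in> A \<Longrightarrow> b \<in> B \<Longrightarrow> a * b \<in> C"
  shows "module_prod A B \<subseteq> C"
proof
  fix x assume "x \<in> module_prod A B"
  then obtain n :: nat and a b where x: "x = (\<Sum>i<n. a i * b i)" "\<forall>i<n. a i \<in> A \<and> b i \<in> B"
    unfolding module_prod_def by blast
  from x(2) have "(\<Sum>i<n. a i * b i) \<in> C"
    by (induction n) (use assms in auto)
  then show "x \<in> C" using x(1) by simp
qed

lemma module_prod_add_product:
  assumes "x \<in> module_prod A B" "a \<in> A" "b \<in> B"
  shows "x + a * b \<in> module_prod A B"
proof -
  obtain n :: nat and f g where x: "x = (\<Sum>i<n. f i * g i)" "\<forall>i<n. f i \<in> A \<and> g i \<in> B"
    using assms(1) unfolding module_prod_def by blast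
  have "x + a * b = (\<Sum>i<Suc n. (f(n := a)) i * (g(n := b)) i)"
    by (simp add: x(1))
  moreover have "\<forall>i<Suc n. (f(n := a)) i \<in> A \<and> (g(n := b)) i \<in> B"
    using x(2) assms by (auto simp: less_Suc_eq)
  ultimately show ?thesis unfolding module_prod_def by blast
qed

lemma module_prod_add:
  assumes "x \<in> module_prod A B" "y \<in> module_prod A B"
  shows "x + y \<in> module_prod A B"
proof -
  obtain n :: nat and f g where y: "y = (\<Sum>i<n. f i * g i)" "\<forall>i<n. f i \<in> A \<and> g i \<in> B"
    using assms(2) unfolding module_prod_def by blast
  from y(2) have "x + (\<Sum>i<n. f i * g i) \<in> module_prod A B"
  proof (induction n)
    case (Suc n)
    then have "x + (\<Sum>i<n. f i * g i) + f n * g n \<in> module_prod A B"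
      by (intro module_prod_add_product) auto
    then show ?case by (simp add: add.assoc)
  qed (simp add: assms)
  then show ?thesis using y(1) by simp
qed

lemma module_prod_mono: "A \<subseteq> A' \<Longrightarrow> B \<subseteq> B' \<Longrightarrow> module_prod A B \<subseteq> module_prod A' B'"
  by (rule module_prod_least) (auto intro: module_prod_zero module_prod_add module_prodI)

lemma module_prod_commute: "module_prod A B = module_prod B A"
proof -
  have "module_prod A B \<subseteq> module_prod B A" for A B :: "'a::field set"
  proof (rule module_prod_least[OF module_prod_zero module_prod_add])
    fix a b assume "a \<in> A" "b \<in> B"
    then show "a * b \<in> module_prod B A" using module_prodI[of b B a A] by (simp add: mult.commute)
  qed
  then show ?thesis by blast
qed

lemma module_prod_assoc: "module_prod (module_prod A B) C = module_prod A (module_prod B C)"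
proof -
  have *: "module_prod (module_prod A B) C \<subseteq> module_prod A (module_prod B C)"
    for A B C :: "'a::field set"
  proof (rule module_prod_least[OF module_prod_zero module_prod_add])
    fix x c assume "x \<in> module_prod A B" "c \<in> C"
    have "module_prod A B \<subseteq> {z. z * c \<in> module_prod A (module_prod B C)}"
    proof (rule module_prod_least)
      fix a b assume "a \<in> A" "b \<in> B"
      then have "a * (b * c) \<in> module_prod A (module_prod B C)"
        using \<open>c \<in> C\<close> by (intro module_prodI)
      then show "a * b \<in> {z. z * c \<in> module_prod A (module_prod B C)}"
        by (simp add: mult.assoc)
    qed (auto simp: module_prod_zero distrib_right intro: module_prod_add)
    then show "x * c \<in> module_prod A (module_prod B C)" using \<open>x \<in> module_prod A B\<close> by blast
  qed
  have "module_prod A (module_prod B C) = module_prod (module_prod C B) A"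
    by (simp add: module_prod_commute)
  also have "\<dots> \<subseteq> module_prod C (module_prod B A)" by (rule *)
  also have "\<dots> = module_prod (module_prod A B) C" by (simp add: module_prod_commute)
  finally show ?thesis using * by blast
qed

lemma module_prod_left_commute: "module_prod A (module_prod B C) = module_prod B (module_prod A C)"
  by (metis module_prod_assoc module_prod_commute)

lemmas module_prod_ac = module_prod_assoc module_prod_commute module_prod_left_commute

lemma submodule_of_module_prod:
  assumes "submodule_of R A"
  shows "submodule_of R (module_prod A B)"
  unfolding submodule_of_def
proof (intro conjI ballI)
  fix r x assume r: "r \<in> R" and x: "x \<in> module_prod A B"
  have "module_prod A B \<subseteq> {z. r * z \<in> module_prod A B}"
  proof (rule module_prod_least)
    fix a b assume "a \<in> A" "b \<in> B"
    then have "(r * a) * b \<in> module_prod A B"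
      using submodule_ofD(3)[OF assms r] by (intro module_prodI)
    then show "a * b \<in> {z. r * z \<in> module_prod A B}" by (simp add: mult.assoc)
  qed (auto simp: module_prod_zero distrib_left intro: module_prod_add)
  then show "r * x \<in> module_prod A B" using x by blast
qed (auto simp: module_prod_zero intro: module_prod_add)

lemma module_prod_subset:
  assumes "submodule_of R C" "\<And>a b. a \<in> A \<Longrightarrow> b \<in> B \<Longrightarrow> a * b \<in> C"
  shows "module_prod A B \<subseteq> C"
  using assms submodule_ofD(1,2)[OF assms(1)] by (intro module_prod_least)

lemma module_prod_nonzero:
  assumes "nz_submodule R A" "nz_submodule S B"
  shows "module_prod A B \<noteq> {0}"
proof -
  obtain a b where "a \<in> A" "a \<noteq> 0" "b \<in> B" "b \<noteq> 0"
    using assms submodule_ofD(1) by blast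
  then have "a * b \<in> module_prod A B" "a * b \<noteq> 0" by (auto intro: module_prodI)
  then show ?thesis by blast
qed

lemma nz_submodule_module_prod:
  "nz_submodule R A \<Longrightarrow> nz_submodule S B \<Longrightarrow> nz_submodule R (module_prod A B)"
  using module_prod_nonzero submodule_of_module_prod by blast

lemma module_prod_scale: "module_prod ((*) c ` A) B = (*) c ` module_prod A B"
proof
  show "module_prod ((*) c ` A) B \<subseteq> (*) c ` module_prod A B"
  proof (rule module_prod_least)
    show "0 \<in> (*) c ` module_prod A B" using module_prod_zero[of A B] by force
    show "x + y \<in> (*) c ` module_prod A B"
      if xy: "x \<in> (*) c ` module_prod A B" "y \<in> (*) c ` module_prod A B" for x y
    proof -
      obtain x' y' where "x' \<in> module_prod A B" "y' \<in> module_prod A B" "x = c * x'" "y = c * y'"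
        using xy by blast
      then show ?thesis
        using module_prod_add by (intro image_eqI[of _ _ "x' + y'"]) (auto simp: distrib_left)
    qed
    show "a * b \<in> (*) c ` module_prod A B" if "a \<in> (*) c ` A" "b \<in> B" for a b
      using that by (auto simp: mult.assoc intro: module_prodI)
  qed
  have "module_prod A B \<subseteq> {z. c * z \<in> module_prod ((*) c ` A) B}"
  proof (rule module_prod_least)
    fix a b assume "a \<in> A" "b \<in> B"
    then have "(c * a) * b \<in> module_prod ((*) c ` A) B" by (intro module_prodI) auto
    then show "a * b \<in> {z. c * z \<in> module_prod ((*) c ` A) B}" by (simp add: mult.assoc)
  qed (auto simp: module_prod_zero distrib_left intro: module_prod_add)
  then show "(*) c ` module_prod A B \<subseteq> module_prod ((*) c ` A) B" by blast
qed

lemma module_prod_scale_right: "module_prod A ((*) c ` B) = (*) c ` module_prod A B"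
  using module_prod_scale[of c B A] by (simp add: module_prod_commute)

lemma module_prod_unit:
  assumes "submodule_of R A" "1 \<in> R"
  shows "module_prod R A = A"
proof
  show "module_prod R A \<subseteq> A"
    using submodule_ofD(3)[OF assms(1)] by (rule module_prod_subset[OF assms(1)])
  show "A \<subseteq> module_prod R A" using module_prodI[OF assms(2)] by fastforce
qed

lemma module_prod_unit_right: "submodule_of R A \<Longrightarrow> 1 \<in> R \<Longrightarrow> module_prod A R = A"
  using module_prod_unit[of R A] by (simp add: module_prod_commute)

section \<open>Localization at a prime ideal\<close>

lemma prime_inD:
  assumes "prime_in R P"
  shows "submodule_of R P" "P \<subseteq> R" "1 \<notin> P"
    "\<And>a b. a \<in> R \<Longrightarrow> b \<in> R \<Longrightarrow> a * b \<in> P \<Longrightarrow> a \<in> P \<or> b \<in> P"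
  using assms unfolding prime_in_def by blast+

lemma local_part_mono: "A \<subseteq> B \<Longrightarrow> local_part R P A \<subseteq> local_part R P B"
  by (auto simp: local_part_def)

lemma local_partI: "u \<in> R - P \<Longrightarrow> u * x \<in> A \<Longrightarrow> x \<in> local_part R P A"
  by (auto simp: local_part_def)

context domain_subring
begin

lemma compl_mult:
  assumes "prime_in R P" "u \<in> R - P" "w \<in> R - P"
  shows "u * w \<in> R - P"
  using assms prime_inD(4)[OF assms(1)] mult_mem by blast

lemma compl_prod:
  assumes "prime_in R P" "\<And>i. i \<in> F \<Longrightarrow> f i \<in> R - P"
  shows "prod f F \<in> R - P"
  using assms(2)
proof (induction F rule: infinite_finite_induct)
  case (insert i F)
  then have "f i * prod f F \<in> R - P" by (intro compl_mult[OF assms(1)]) auto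
  then show ?case using insert by simp
qed (auto simp: one_mem prime_inD(3)[OF assms(1)])

lemma compl_nonzero: "prime_in R P \<Longrightarrow> u \<in> R - P \<Longrightarrow> u \<noteq> 0"
  using prime_inD(1) submodule_ofD(1) by blast

lemma subset_local_part: "prime_in R P \<Longrightarrow> A \<subseteq> local_part R P A"
  using one_mem prime_inD(3) by (force intro: local_partI[of 1])

lemma local_part_idem:
  assumes P: "prime_in R P"
  shows "local_part R P (local_part R P A) = local_part R P A"
proof
  show "local_part R P (local_part R P A) \<subseteq> local_part R P A"
  proof
    fix x assume "x \<in> local_part R P (local_part R P A)"
    then obtain u w where "u \<in> R - P" "w \<in> R - P" "w * (u * x) \<in> A"
      by (auto simp: local_part_def)
    then show "x \<in> local_part R P A"
      using compl_mult[OF P, of w u] by (intro local_partI[of "w * u"]) (auto simp: mult.assoc)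
  qed
qed (rule subset_local_part[OF P])

lemma localize_eq: "prime_in R P \<Longrightarrow> localize R P = local_part R P R"
proof
  assume P: "prime_in R P"
  show "localize R P \<subseteq> local_part R P R"
  proof
    fix x assume "x \<in> localize R P"
    then obtain a s where "a \<in> R" "s \<in> R - P" "x = a / s" by (auto simp: localize_def)
    then show "x \<in> local_part R P R"
      using compl_nonzero[OF P, of s] by (intro local_partI[of s]) auto
  qed
  show "local_part R P R \<subseteq> localize R P"
  proof
    fix x assume "x \<in> local_part R P R"
    then obtain s where s: "s \<in> R - P" "s * x \<in> R" by (auto simp: local_part_def)
    then have "x = (s * x) / s" using compl_nonzero[OF P] by auto
    then show "x \<in> localize R P" using s unfolding localize_def by blast
  qed
qed

text \<open>The product of the individual denominators works for all elements at once. This is how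
  finite sets are brought back from a localization to the ideal itself.\<close>

lemma finite_local_part:
  assumes P: "prime_in R P" and A: "submodule_of R A" and "finite S" "S \<subseteq> local_part R P A"
  shows "\<exists>u\<in>R - P. \<forall>s\<in>S. u * s \<in> A"
  using assms(3,4)
proof (induction S rule: finite_induct)
  case empty
  show ?case using one_mem prime_inD(3)[OF P] by auto
next
  case (insert x S)
  then obtain u w where u: "u \<in> R - P" "\<forall>s\<in>S. u * s \<in> A" and w: "w \<in> R - P" "w * x \<in> A"
    by (auto simp: local_part_def)
  have "w * (u * s) \<in> A" if "s \<in> S" for s
    using submodule_ofD(3)[OF A] u w that by blast
  moreover have "u * (w * x) \<in> A" using submodule_ofD(3)[OF A] u w by blast
  ultimately show ?case
    using compl_mult[OF P w(1) u(1)] by (intro bexI[of _ "w * u"]) (auto simp: mult.assoc mult.left_commute)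
qed

lemma submodule_local_part:
  assumes P: "prime_in R P" and A: "submodule_of R A"
  shows "submodule_of (localize R P) (local_part R P A)"
  unfolding submodule_of_def
proof (intro conjI ballI)
  show "0 \<in> local_part R P A"
    using subset_local_part[OF P] submodule_ofD(1)[OF A] by blast
next
  fix x y assume "x \<in> local_part R P A" "y \<in> local_part R P A"
  then obtain u where "u \<in> R - P" "u * x \<in> A" "u * y \<in> A"
    using finite_local_part[OF P A, of "{x, y}"] by auto
  then show "x + y \<in> local_part R P A"
    using submodule_ofD(2)[OF A] by (intro local_partI[of u]) (auto simp: distrib_left)
next
  fix r x assume "r \<in> localize R P" "x \<in> local_part R P A"
  then obtain u w where u: "u \<in> R - P" "u * r \<in> R" and w: "w \<in> R - P" "w * x \<in> A"
    by (auto simp: localize_eq[OF P] local_part_def)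
  then have "(u * r) * (w * x) \<in> A" using submodule_ofD(3)[OF A] by blast
  then show "r * x \<in> local_part R P A"
    using compl_mult[OF P u(1) w(1)] by (intro local_partI[of "u * w"]) (auto simp: ac_simps)
qed

lemma module_prod_localize:
  assumes P: "prime_in R P" and A: "submodule_of R A"
  shows "module_prod A (localize R P) = local_part R P A"
proof
  show "module_prod A (localize R P) \<subseteq> local_part R P A"
  proof (rule module_prod_subset[OF submodule_local_part[OF P A]])
    fix a v assume "a \<in> A" "v \<in> localize R P"
    then show "a * v \<in> local_part R P A"
      using submodule_ofD(3)[OF submodule_local_part[OF P A]] subset_local_part[OF P]
      by (metis mult.commute subsetD)
  qed
  show "local_part R P A \<subseteq> module_prod A (localize R P)"
  proof
    fix x assume "x \<in> local_part R P A"
    then obtain u where u: "u \<in> R - P" "u * x \<in> A" by (auto simp: local_part_def)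
    then have "inverse u \<in> localize R P"
      using one_mem by (auto simp: localize_def inverse_eq_divide)
    then have "(u * x) * inverse u \<in> module_prod A (localize R P)"
      using u by (intro module_prodI)
    then show "x \<in> module_prod A (localize R P)"
      using compl_nonzero[OF P u(1)] by (simp add: field_simps)
  qed
qed

lemma localize_superset: "prime_in R P \<Longrightarrow> R \<subseteq> localize R P"
  using localize_eq subset_local_part by simp

lemma domain_localize:
  assumes P: "prime_in R P"
  shows "domain_in (localize R P)"
  unfolding domain_in_def
proof (intro conjI ballI allI)
  have sub: "submodule_of (localize R P) (localize R P)"
    using submodule_local_part[OF P submodule_self] localize_eq[OF P] by simp
  show "1 \<in> localize R P" using localize_superset[OF P] one_mem by blast
  fix x y assume xy: "x \<in> localize R P" "y \<in> localize R P"
  then show "x * y \<in> localize R P" using submodule_ofD(3)[OF sub] by blast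
  have "- 1 \<in> localize R P" using localize_superset[OF P] one_mem uminus_mem by blast
  then have "(- 1) * y \<in> localize R P" using submodule_ofD(3)[OF sub] xy by blast
  then have "x + (- 1) * y \<in> localize R P" using submodule_ofD(2)[OF sub] xy by blast
  then show "x - y \<in> localize R P" by simp
next
  fix z
  obtain d where "d \<in> R" "d \<noteq> 0" "d * z \<in> R" using denominator by blast
  then have "d \<in> localize R P" "d * z \<in> localize R P" "z = d * z / d"
    using localize_superset[OF P] by auto
  then show "\<exists>a\<in>localize R P. \<exists>b\<in>localize R P. b \<noteq> 0 \<and> z = a / b"
    using \<open>d \<noteq> 0\<close> by blast
qed

lemma fractional_local_part:
  assumes P: "prime_in R P" and A: "fractional_ideal R A"
  shows "fractional_ideal (localize R P) (local_part R P A)"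
proof -
  have sub: "submodule_of R A" using A by (simp add: fractional_ideal_def)
  obtain d where d: "d \<in> R" "d \<noteq> 0" "\<forall>a\<in>A. d * a \<in> R"
    using A by (auto simp: fractional_ideal_def)
  have "d * x \<in> localize R P" if x: "x \<in> local_part R P A" for x
  proof -
    obtain u where "u \<in> R - P" "u * x \<in> A" using x by (auto simp: local_part_def)
    then have "u * (d * x) \<in> R" using d(3) by (metis mult.left_commute)
    then show ?thesis
      unfolding localize_eq[OF P] using \<open>u \<in> R - P\<close> by (intro local_partI[of u])
  qed
  moreover have "local_part R P A \<noteq> {0}"
    using A sub submodule_ofD(1)[OF sub] subset_local_part[OF P, of A]
    by (auto simp: fractional_ideal_def)
  ultimately show ?thesis
    using submodule_local_part[OF P sub] d localize_superset[OF P]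
    unfolding fractional_ideal_def by blast
qed

text \<open>Localizing is multiplication by V = \<open>localize R P\<close>. Since V V = V, the
  factor V can be split between A and B.\<close>

lemma local_part_module_prod:
  assumes P: "prime_in R P" and A: "submodule_of R A" and B: "submodule_of R B"
  shows "local_part R P (module_prod A B) = module_prod (local_part R P A) (local_part R P B)"
proof -
  let ?V = "localize R P"
  have V: "domain_subring ?V" using domain_localize[OF P] by (simp add: domain_subring_def)
  have VV: "module_prod ?V ?V = ?V"
    using module_prod_unit domain_subring.submodule_self[OF V] domain_subring.one_mem[OF V] by blast
  have "local_part R P (module_prod A B) = module_prod (module_prod A B) (module_prod ?V ?V)"
    using module_prod_localize[OF P submodule_of_module_prod[OF A]] VV by simp
  also have "\<dots> = module_prod (module_prod A ?V) (module_prod B ?V)"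
    by (simp add: module_prod_ac)
  finally show ?thesis using module_prod_localize[OF P A] module_prod_localize[OF P B] by simp
qed

text \<open>Over a valuation ring a finite set generates a principal module, with a generator in the
  set itself: the induction compares each new element with the generator found so far.\<close>

lemma finite_generator:
  assumes P: "prime_in R P" and V: "valuation_domain (localize R P)"
    and "finite S" "\<not> S \<subseteq> {0}"
  shows "\<exists>b\<in>S. b \<noteq> 0 \<and> (\<forall>s\<in>S. s / b \<in> localize R P)"
  using assms(3,4)
proof (induction S rule: finite_induct)
  case (insert x S)
  have dV: "domain_subring (localize R P)" using domain_localize[OF P] by (simp add: domain_subring_def)
  note V0 = domain_subring.zero_mem[OF dV] and V1 = domain_subring.one_mem[OF dV]
  show ?case
  proof (cases "S \<subseteq> {0}")
    case True
    then have "x \<noteq> 0" using insert by blast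
    then show ?thesis using True V0 V1 by (intro bexI[of _ x]) auto
  next
    case False
    then obtain b where b: "b \<in> S" "b \<noteq> 0" "\<forall>s\<in>S. s / b \<in> localize R P" using insert by blast
    show ?thesis
    proof (cases "x / b \<in> localize R P")
      case True
      then show ?thesis using b by blast
    next
      case no: False
      then have "x \<noteq> 0" using V0 by auto
      have "inverse (x / b) \<in> localize R P"
        using V no unfolding valuation_domain_def by blast
      then have "b / x \<in> localize R P" by simp
      then have "s / b * (b / x) \<in> localize R P" if "s \<in> S" for s
        using b that domain_subring.mult_mem[OF dV] by blast
      then show ?thesis using \<open>x \<noteq> 0\<close> b(2) V1 by (intro bexI[of _ x]) auto
    qed
  qed
qed auto

lemma finite_generator_denominator:
  assumes P: "prime_in R P" and V: "valuation_domain (localize R P)"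
    and S: "finite S" "\<not> S \<subseteq> {0}"
  shows "\<exists>b\<in>S. b \<noteq> 0 \<and> (\<exists>u\<in>R - P. \<forall>s\<in>S. u * s / b \<in> R)"
proof -
  obtain b where b: "b \<in> S" "b \<noteq> 0" "\<forall>s\<in>S. s / b \<in> local_part R P R"
    using finite_generator[OF P V S] localize_eq[OF P] by auto
  then have "\<exists>u\<in>R - P. \<forall>s\<in>(\<lambda>s. s / b) ` S. u * s \<in> R"
    using S by (intro finite_local_part[OF P submodule_self]) auto
  then show ?thesis using b by auto
qed

text \<open>If S is a finite witness for a, then b S is one for a b, since multiplication by b
  carries the divisorial closure of S into that of b S.\<close>

lemma module_prod_t_closure_subset:
  assumes A: "nz_submodule R A" and B: "nz_submodule R B"
  shows "module_prod (t_closure R A) B \<subseteq> t_closure R (module_prod A B)"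
proof -
  have AB: "nz_submodule R (module_prod A B)" using nz_submodule_module_prod A B by blast
  show ?thesis
  proof (rule module_prod_subset)
    show "submodule_of R (t_closure R (module_prod A B))"
      using nz_submodule_t_closure[OF AB] by blast
    fix a b assume "a \<in> t_closure R A" "b \<in> B"
    then obtain S where "finite S" "S \<subseteq> A" "a \<in> v_closure R S"
      unfolding t_closure_iff[OF A] by blast
    moreover have "(*) b ` S \<subseteq> module_prod A B"
      using \<open>S \<subseteq> A\<close> \<open>b \<in> B\<close> module_prodI[of _ A b B] by (auto simp: mult.commute[of b])
    ultimately show "a * b \<in> t_closure R (module_prod A B)"
      unfolding t_closure_iff[OF AB] mult.commute[of a] using v_closure_scale
      by (intro exI[of _ "(*) b ` S"]) blast
  qed
qed

lemma t_closure_prod_left: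
  assumes A: "nz_submodule R A" and B: "nz_submodule R B"
  shows "t_closure R (module_prod (t_closure R A) B) = t_closure R (module_prod A B)"
proof
  show "t_closure R (module_prod (t_closure R A) B) \<subseteq> t_closure R (module_prod A B)"
    using t_closure_mono[OF module_prod_t_closure_subset[OF A B]] t_closure_idem
      nz_submodule_module_prod A B by metis
  show "t_closure R (module_prod A B) \<subseteq> t_closure R (module_prod (t_closure R A) B)"
    using t_closure_extensive[OF A] by (intro t_closure_mono module_prod_mono) auto
qed

lemma t_closure_prod_right:
  "nz_submodule R A \<Longrightarrow> nz_submodule R B \<Longrightarrow>
    t_closure R (module_prod A (t_closure R B)) = t_closure R (module_prod A B)"
  using t_closure_prod_left[of B A] by (simp add: module_prod_commute)

lemma fractional_module_prod:
  assumes "fractional_ideal R A" "fractional_ideal R B"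
  shows "fractional_ideal R (module_prod A B)"
proof -
  obtain d e where d: "d \<in> R" "d \<noteq> 0" "\<forall>a\<in>A. d * a \<in> R" and e: "e \<in> R" "e \<noteq> 0" "\<forall>b\<in>B. e * b \<in> R"
    using assms by (auto simp: fractional_ideal_def)
  have "module_prod A B \<subseteq> {z. z * (d * e) \<in> R}"
  proof (rule module_prod_subset[OF submodule_of_preimage[OF submodule_self]])
    fix a b assume "a \<in> A" "b \<in> B"
    then have "(d * a) * (e * b) \<in> R" using d e mult_mem by blast
    then show "a * b \<in> {z. z * (d * e) \<in> R}" by (simp add: ac_simps)
  qed
  moreover have "nz_submodule R (module_prod A B)"
    using assms nz_submodule_module_prod fractional_ideal_nz by blast
  ultimately show ?thesis
    using d e mult_mem[OF d(1) e(1)] unfolding fractional_ideal_def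
    by (auto simp: mult.commute[of _ "d * e"] intro!: bexI[of _ "d * e"])
qed

end

section \<open>Krull-type domains and their overrings\<close>

context domain_subring
begin

lemma t_maximalD:
  assumes "t_maximal R M"
  shows "t_ideal R M" "submodule_of R M" "M \<subseteq> R" "1 \<notin> M" "prime_in R M"
    "t_ideal R N \<Longrightarrow> N \<subset> R \<Longrightarrow> M \<subseteq> N \<Longrightarrow> N = M"
  using assms prime_t_maximal[OF assms] prime_inD[OF prime_t_maximal[OF assms]]
  unfolding t_maximal_def by blast+

text \<open>Over R_P the set S is generated by one b in S, so some u outside P satisfies (u / b) S
  \<subseteq> R \<subseteq> T. Thus u / b is an admissible test multiplier: (u / b) x lies in T, and
  u x in b T \<subseteq> A. The ring T is kept apart from R so that the lemma serves both for R
  itself and for the comparison of closures in \<open>t_closure_eq\<close>.\<close>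

lemma v_closure_local:
  assumes P: "prime_in R P" and V: "valuation_domain (localize R P)"
    and T: "R \<subseteq> T" "submodule_of T A"
    and S: "finite S" "S \<subseteq> A" "\<not> S \<subseteq> {0}" and x: "x \<in> v_closure T S"
  shows "x \<in> local_part R P A"
proof -
  obtain b u where b: "b \<in> S" "b \<noteq> 0" "u \<in> R - P" "\<forall>s\<in>S. u * s / b \<in> R"
    using finite_generator_denominator[OF P V S(1,3)] by blast
  then have "\<forall>s\<in>S. u / b * s \<in> T" using T(1) by auto
  then have "u / b * x \<in> T" using x unfolding v_closure_iff by blast
  then have "u / b * x * b \<in> A" using submodule_ofD(3)[OF T(2)] b S(2) by blast
  then show ?thesis using b by (intro local_partI[of u]) auto
qed

lemma scale_self_subset:
  assumes "submodule_of R A" "a \<in> A"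
  shows "(*) a ` R \<subseteq> A"
  using submodule_ofD(3)[OF assms(1) _ assms(2)] by (auto simp: mult.commute[of a])

end

locale krull_domain = domain_subring +
  assumes krull_type: "krull_type R"
begin

lemma valuation_localize: "t_maximal R M \<Longrightarrow> valuation_domain (localize R M)"
  using krull_type by (auto simp: krull_type_def pvmd_def)

text \<open>With \<open>mem_t_closure_local\<close> this makes the t-closure the intersection of the
  localizations at the t-maximal ideals.\<close>

lemma t_closure_local:
  assumes A: "nz_submodule R A" and x: "x \<in> t_closure R A" and M: "t_maximal R M"
  shows "x \<in> local_part R M A"
proof -
  obtain S where S: "finite S" "S \<subseteq> A" "x \<in> v_closure R S"
    using x unfolding t_closure_iff[OF A] by blast
  obtain a where a: "a \<in> A" "a \<noteq> 0" using A submodule_ofD(1) by blast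
  \<comment> \<open>A nonzero element is added, since \<open>v_closure_local\<close> divides by a
    generator of the set.\<close>
  have "x \<in> v_closure R (insert a S)" using S(3) v_closure_mono[of S "insert a S" R] by auto
  then show ?thesis
    using A a S
    by (intro v_closure_local[OF prime_t_maximal[OF M] valuation_localize[OF M], of R A "insert a S"])
      auto
qed

lemma t_ideal_mem_local:
  assumes "t_ideal R A" "\<And>M. t_maximal R M \<Longrightarrow> x \<in> local_part R M A"
  shows "x \<in> A"
  using mem_t_closure_local[OF t_ideal_nz[OF assms(1)] assms(2)] assms(1) by (simp add: t_ideal_def)

lemma local_part_t_closure:
  assumes A: "nz_submodule R A" and M: "t_maximal R M"
  shows "local_part R M (t_closure R A) = local_part R M A"
proof
  have "t_closure R A \<subseteq> local_part R M A" using t_closure_local[OF A _ M] by blast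
  then show "local_part R M (t_closure R A) \<subseteq> local_part R M A"
    using local_part_mono[of _ _ R M] local_part_idem[OF prime_t_maximal[OF M]] by metis
qed (rule local_part_mono[OF t_closure_extensive[OF A]])

text \<open>Finite t-character is applied to the t-ideal a R, which lies in the same t-maximal
  ideals as a. If a R = R, no t-maximal ideal contains a.\<close>

lemma finite_t_maximal_containing:
  assumes a: "a \<in> R" "a \<noteq> 0"
  shows "finite {M. t_maximal R M \<and> a \<in> M}"
proof -
  have t: "t_ideal R ((*) a ` R)" using t_ideal_scale[OF t_ideal_self] a by blast
  have sub: "(*) a ` R \<subseteq> M" if "t_maximal R M" "a \<in> M" for M
    using scale_self_subset[OF t_maximalD(2)[OF that(1)] that(2)] .
  have self: "a \<in> (*) a ` R" using one_mem by (intro image_eqI[of _ _ 1]) auto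
  show ?thesis
  proof (cases "(*) a ` R \<subset> R")
    case True
    have "{M. t_maximal R M \<and> a \<in> M} = {M. t_maximal R M \<and> (*) a ` R \<subseteq> M}"
      using sub self by blast
    then show ?thesis using krull_type t True by (simp add: krull_type_def finite_t_character_def)
  next
    case False
    then have "(*) a ` R = R"
      using mult_mem[OF a(1)] by blast
    then have "{M. t_maximal R M \<and> a \<in> M} = {}"
      using sub one_mem t_maximalD(4) by blast
    then show ?thesis by (simp only: finite.emptyI)
  qed
qed

text \<open>A nonzero a in Q lies in only finitely many t-maximal ideals. For each of these other
  than Q, an element of Q outside it is added to a.\<close>

lemma separating_set:
  assumes Q: "t_maximal R Q"
  shows "\<exists>C. finite C \<and> C \<subseteq> Q \<and> \<not> C \<subseteq> {0} \<and> (\<forall>N. t_maximal R N \<longrightarrow> N \<noteq> Q \<longrightarrow> \<not> C \<subseteq> N)"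
proof -
  obtain a where a: "a \<in> Q" "a \<noteq> 0"
    using t_ideal_nz[OF t_maximalD(1)[OF Q]] submodule_ofD(1)[of R Q] by blast
  let ?F = "{N. t_maximal R N \<and> a \<in> N}"
  have "\<exists>c\<in>Q. N \<noteq> Q \<longrightarrow> c \<notin> N" if N: "t_maximal R N" for N
  proof (cases "Q \<subseteq> N")
    case True
    have "N \<subset> R" using N by (simp add: t_maximal_def)
    then have "N = Q" using t_maximalD(6)[OF Q t_maximalD(1)[OF N]] True by blast
    then show ?thesis using a by blast
  qed blast
  then obtain f where f: "\<And>N. t_maximal R N \<Longrightarrow> f N \<in> Q \<and> (N \<noteq> Q \<longrightarrow> f N \<notin> N)"
    by metis
  have "finite ?F" using finite_t_maximal_containing a t_maximalD(3)[OF Q] by blast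
  then have "finite (insert a (f ` ?F))" by simp
  moreover have "insert a (f ` ?F) \<subseteq> Q" using a f by blast
  moreover have "\<not> insert a (f ` ?F) \<subseteq> N" if "t_maximal R N" "N \<noteq> Q" for N
    using f[OF that(1)] that by blast
  ultimately show ?thesis using a by (intro exI[of _ "insert a (f ` ?F)"]) blast
qed

end

text \<open>The two assumptions on T are what the ring \<open>colon I I\<close> of the theorem
  provides, through \<open>domain_colon\<close> and \<open>t_ideal_colon\<close>.\<close>

locale krull_overring = R: krull_domain R for R :: "'k::field set" +
  fixes T :: "'k set"
  assumes domain_T: "domain_in T" and t_ideal_T: "t_ideal R T"
begin

sublocale T: domain_subring T
  by unfold_locales (rule domain_T)

lemma R_subset_T: "R \<subseteq> T"
  using submodule_ofD(3)[of R T _ 1] R.t_ideal_nz[OF t_ideal_T] T.one_mem by fastforce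

lemma submodule_R: "submodule_of T A \<Longrightarrow> submodule_of R A"
  using submodule_of_subring R_subset_T by blast

lemma denominator_T: "\<exists>e\<in>R. e \<noteq> 0 \<and> (\<forall>t\<in>T. e * t \<in> R)"
  using t_ideal_T by (auto simp: t_ideal_def fractional_ideal_def)

lemma fractional_ideal_iff:
  assumes A: "submodule_of T A"
  shows "fractional_ideal T A \<longleftrightarrow> fractional_ideal R A"
proof
  assume "fractional_ideal T A"
  then obtain d where d: "A \<noteq> {0}" "d \<in> T" "d \<noteq> 0" "\<forall>a\<in>A. d * a \<in> T"
    by (auto simp: fractional_ideal_def)
  obtain e where e: "e \<in> R" "e \<noteq> 0" "\<forall>t\<in>T. e * t \<in> R" using denominator_T by blast
  then have "\<forall>a\<in>A. e * d * a \<in> R" "e * d \<in> R" using d by (auto simp: mult.assoc)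
  then show "fractional_ideal R A"
    using d e submodule_R[OF A] unfolding fractional_ideal_def by (auto intro!: bexI[of _ "e * d"])
next
  assume "fractional_ideal R A"
  then show "fractional_ideal T A"
    using A R_subset_T unfolding fractional_ideal_def by blast
qed

text \<open>If y S \<subseteq> T, then y x lies in the divisorial closure over R of the finite set y
  S, and hence in the t-ideal T.\<close>

lemma v_closure_subset: "finite S \<Longrightarrow> v_closure R S \<subseteq> v_closure T S"
proof
  fix x assume S: "finite S" and x: "x \<in> v_closure R S"
  have "y * x \<in> T" if "\<forall>s\<in>S. y * s \<in> T" for y
  proof -
    have "y * x \<in> v_closure R ((*) y ` S)" using x by (rule v_closure_scale)
    then show ?thesis using R.t_idealD[OF t_ideal_T, of "(*) y ` S"] S that by blast
  qed
  then show "x \<in> v_closure T S" by (simp add: v_closure_iff)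
qed

text \<open>The inclusion \<open>\<supseteq>\<close> uses that \<open>T\<close> is a \<open>t\<close>-ideal of \<open>R\<close>; the inclusion \<open>\<subseteq>\<close> uses that finitely
  generated ideals become principal in the valuation rings of \<open>R\<close>.\<close>

lemma t_closure_eq:
  assumes A: "nz_submodule T A"
  shows "t_closure T A = t_closure R A"
proof
  have A': "nz_submodule R A" using A submodule_R by blast
  show "t_closure T A \<subseteq> t_closure R A"
  proof
    fix x assume "x \<in> t_closure T A"
    then obtain S where S: "finite S" "S \<subseteq> A" "x \<in> v_closure T S"
      unfolding T.t_closure_iff[OF A] by blast
    obtain a where a: "a \<in> A" "a \<noteq> 0" using A submodule_ofD(1) by blast
    have x: "x \<in> v_closure T (insert a S)"
      using S(3) v_closure_mono[of S "insert a S" T] by auto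
    show "x \<in> t_closure R A"
    proof (rule R.mem_t_closure_local[OF A'])
      fix M assume "t_maximal R M"
      then show "x \<in> local_part R M A"
        using x a S A R_subset_T R.prime_t_maximal R.valuation_localize
        by (intro R.v_closure_local[of M T A "insert a S" x]) auto
    qed
  qed
  show "t_closure R A \<subseteq> t_closure T A"
  proof
    fix x assume "x \<in> t_closure R A"
    then obtain S where "finite S" "S \<subseteq> A" "x \<in> v_closure R S"
      unfolding R.t_closure_iff[OF A'] by blast
    then show "x \<in> t_closure T A"
      unfolding T.t_closure_iff[OF A] using v_closure_subset[of S] by blast
  qed
qed

lemma t_ideal_iff: "t_ideal T A \<longleftrightarrow> t_ideal R A \<and> submodule_of T A"
proof (cases "nz_submodule T A")
  case True
  then show ?thesis using t_closure_eq fractional_ideal_iff unfolding t_ideal_def by auto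
next
  case False
  then show ?thesis using R.t_ideal_nz T.t_ideal_nz by blast
qed

text \<open>As a proper t-ideal of R the contraction lies in some t-maximal M of R. This links N to
  a valuation ring R_M contained in T_N.\<close>

lemma contraction:
  assumes N: "t_maximal T N"
  shows "t_ideal R (N \<inter> R)" "N \<inter> R \<subset> R"
proof -
  obtain n where n: "n \<in> N" "n \<noteq> 0"
    using T.t_ideal_nz[OF T.t_maximalD(1)[OF N]] submodule_ofD(1)[of T N] by blast
  obtain d where d: "d \<in> R" "d \<noteq> 0" "d * n \<in> R" using R.denominator by blast
  have "d * n \<in> N"
    using submodule_ofD(3)[OF T.t_maximalD(2)[OF N]] d n R_subset_T by blast
  then have "N \<inter> R \<noteq> {0}" using d n by (metis IntI mult_eq_0_iff singletonD)
  moreover have "t_ideal R N" using T.t_maximalD(1)[OF N] t_ideal_iff by blast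
  ultimately show "t_ideal R (N \<inter> R)" using R.t_ideal_Int[OF _ R.t_ideal_self] by blast
  show "N \<inter> R \<subset> R" using R.one_mem T.t_maximalD(4)[OF N] by blast
qed

lemma localize_subset:
  assumes "N \<inter> R \<subseteq> M"
  shows "localize R M \<subseteq> localize T N"
proof
  fix x assume "x \<in> localize R M"
  then obtain a s where "a \<in> R" "s \<in> R - M" "x = a / s" by (auto simp: localize_def)
  then have "a \<in> T" "s \<in> T - N" "x = a / s" using assms R_subset_T by blast+
  then show "x \<in> localize T N" unfolding localize_def by blast
qed

text \<open>T_N contains a valuation ring R_M with the same quotient field, and every such overring
  is a valuation ring.\<close>

lemma valuation_localize_T:
  assumes N: "t_maximal T N"
  shows "valuation_domain (localize T N)"
proof -
  obtain M where M: "t_maximal R M" "N \<inter> R \<subseteq> M"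
    using R.exists_t_maximal[OF contraction[OF N]] by blast
  then show ?thesis
    using R.valuation_localize[OF M(1)] localize_subset[OF M(2)]
      T.domain_localize[OF T.prime_t_maximal[OF N]] unfolding valuation_domain_def by blast
qed

text \<open>Primes of R inside M are linearly ordered because R_M is a valuation ring, so the two
  contractions are comparable. An inclusion of contractions lifts to N and N', and t-maximality
  turns it into equality.\<close>

lemma t_maximal_eq_of_contraction:
  assumes N: "t_maximal T N" "t_maximal T N'" and M: "t_maximal R M" "N \<inter> R \<subseteq> M" "N' \<inter> R \<subseteq> M"
  shows "N = N'"
proof -
  have less: "N = N'" if N: "t_maximal T N" "t_maximal T N'" and sub: "N \<inter> R \<subseteq> N' \<inter> R"
    and M: "N' \<inter> R \<subseteq> M" for N N'
  proof -
    have "x \<in> N'" if x: "x \<in> N" for x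
    proof -
      have T': "submodule_of T N" "submodule_of T N'" using N T.t_maximalD by blast+
      have "x \<in> T" using x N T.t_maximalD by blast
      \<comment> \<open>If x is not in R_M, write its inverse as p / s, so that p x = s lies outside
        M. Then p is not in N', since otherwise s would lie in N' and in R, hence in M. So p clears
        the denominator of x.\<close>
      have "\<exists>s\<in>R - N'. s * x \<in> R"
      proof (cases "x \<in> localize R M")
        case True
        then obtain a s where s: "a \<in> R" "s \<in> R - M" "x = a / s" by (auto simp: localize_def)
        then have "s * x = a"
          using R.compl_nonzero[OF R.prime_t_maximal[OF \<open>t_maximal R M\<close>]] by simp
        then show ?thesis using s M by blast
      next
        case False
        then have "inverse x \<in> localize R M"
          using R.valuation_localize[OF \<open>t_maximal R M\<close>] unfolding valuation_domain_def by blast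
        then obtain p s where s: "p \<in> R" "s \<in> R - M" "inverse x = p / s"
          by (auto simp: localize_def)
        moreover have "x \<noteq> 0"
          using False R.localize_superset[OF R.prime_t_maximal[OF \<open>t_maximal R M\<close>]] R.zero_mem
          by blast
        ultimately have px: "p * x = s" "p \<noteq> 0" by (auto simp: field_simps)
        have "p \<notin> N'"
        proof
          assume "p \<in> N'"
          then have "s \<in> N'" using submodule_ofD(3)[OF T'(2) \<open>x \<in> T\<close>] px(1) by (metis mult.commute)
          then show False using s M by blast
        qed
        then show ?thesis using s px(1) by blast
      qed
      then obtain s where s: "s \<in> R" "s \<notin> N'" "s * x \<in> R" by blast
      then have "s * x \<in> N" using submodule_ofD(3)[OF T'(1)] x R_subset_T by blast
      then have "s * x \<in> N'" using s sub by blast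
      then show "x \<in> N'"
        using prime_inD(4)[OF T.prime_t_maximal[OF N(2)]] s \<open>x \<in> T\<close> R_subset_T by blast
    qed
    then have "N \<subseteq> N'" by blast
    moreover have "N' \<subset> T" using N(2) by (simp add: t_maximal_def)
    ultimately show ?thesis using T.t_maximalD(6)[OF N(1) T.t_maximalD(1)[OF N(2)]] by blast
  qed
  \<comment> \<open>For x and y witnessing incomparability, x / y or y / x is a fraction a / s with
    s outside M. Clearing denominators puts the product of s and one of x, y into a prime that
    contains neither factor.\<close>
  have "N \<inter> R \<subseteq> N' \<inter> R \<or> N' \<inter> R \<subseteq> N \<inter> R"
  proof (rule ccontr)
    assume "\<not> ?thesis"
    then obtain x y where xy: "x \<in> N \<inter> R" "x \<notin> N'" "y \<in> N' \<inter> R" "y \<notin> N" by blast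
    have aux: False
      if xy: "x \<in> N \<inter> R" "x \<notin> N'" "y \<in> N' \<inter> R" "y \<notin> N" and N': "t_maximal T N'" "N \<inter> R \<subseteq> M"
        "N' \<inter> R \<subseteq> M" and v: "x / y \<in> localize R M" and "t_maximal T N" for x y N N'
    proof -
      have T': "submodule_of T N'" using N' T.t_maximalD by blast
      have "y \<noteq> 0" using submodule_ofD(1)[OF T.t_maximalD(2)[OF \<open>t_maximal T N\<close>]] xy by blast
      obtain a s where s: "a \<in> R" "s \<in> R - M" "x / y = a / s" using v by (auto simp: localize_def)
      then have "s \<noteq> 0" using R.compl_nonzero[OF R.prime_t_maximal[OF M(1)]] by blast
      then have "s * x = a * y" using s \<open>y \<noteq> 0\<close> by (simp add: field_simps)
      moreover have "a * y \<in> N'" using submodule_ofD(3)[OF T'] s xy R_subset_T by blast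
      ultimately have "s \<in> N'"
        using prime_inD(4)[OF T.prime_t_maximal[OF N'(1)], of s x] s xy R_subset_T by auto
      then show False using s N'(3) by blast
    qed
    show False
    proof (cases "x / y \<in> localize R M")
      case True
      then show False using aux[OF xy] N M by blast
    next
      case False
      then have "inverse (x / y) \<in> localize R M"
        using R.valuation_localize[OF M(1)] unfolding valuation_domain_def by blast
      then have "y / x \<in> localize R M" by simp
      then show False using aux[where x=y and y=x and N=N' and N'=N] xy N M by blast
    qed
  qed
  then show ?thesis using less[of N N'] less[of N' N] N M by blast
qed

lemma krull_type_T: "krull_type T"
  unfolding krull_type_def pvmd_def finite_t_character_def
proof (intro conjI allI impI)
  fix A assume A: "t_ideal T A \<and> A \<subset> T"
  obtain x where x: "x \<in> A" "x \<noteq> 0" using A T.t_ideal_nz submodule_ofD(1) by blast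
  obtain d where d: "d \<in> R" "d \<noteq> 0" "d * x \<in> R" using R.denominator by blast
  \<comment> \<open>\<open>?g\<close> chooses a t-maximal ideal of R above each contraction. It is
    injective by \<open>t_maximal_eq_of_contraction\<close>, and its values on the ideals containing
    A all contain the nonzero element d x of R, so finite character descends from R.\<close>
  let ?g = "\<lambda>N. SOME M. t_maximal R M \<and> N \<inter> R \<subseteq> M"
  have g: "t_maximal R (?g N) \<and> N \<inter> R \<subseteq> ?g N" if "t_maximal T N" for N
    using R.exists_t_maximal[OF contraction[OF that]] by (rule someI_ex)
  have "d * x \<in> N" if "t_maximal T N" "A \<subseteq> N" for N
    using submodule_ofD(3)[OF T.t_maximalD(2)[OF that(1)]] d x that(2) R_subset_T by blast
  then have "?g ` {N. t_maximal T N \<and> A \<subseteq> N} \<subseteq> {M. t_maximal R M \<and> d * x \<in> M}"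
    using g d by blast
  moreover have "finite {M. t_maximal R M \<and> d * x \<in> M}"
    using d x by (intro R.finite_t_maximal_containing) auto
  ultimately have fin: "finite (?g ` {N. t_maximal T N \<and> A \<subseteq> N})" by (rule finite_subset)
  have "inj_on ?g {N. t_maximal T N \<and> A \<subseteq> N}"
  proof (rule inj_onI)
    fix N N' assume *: "N \<in> {N. t_maximal T N \<and> A \<subseteq> N}" "N' \<in> {N. t_maximal T N \<and> A \<subseteq> N}"
      and eq: "?g N = ?g N'"
    show "N = N'"
    proof (rule t_maximal_eq_of_contraction)
      show "t_maximal T N" "t_maximal T N'" using * by simp_all
      then show "t_maximal R (?g N)" "N \<inter> R \<subseteq> ?g N" "N' \<inter> R \<subseteq> ?g N"
        using g[of N] g[of N'] eq by simp_all
    qed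
  qed
  then show "finite {N. t_maximal T N \<and> A \<subseteq> N}" using finite_imageD[OF fin] by blast
qed (use domain_T valuation_localize_T in auto)

sublocale T: krull_domain T
  by unfold_locales (rule krull_type_T)

end

section \<open>Idempotent t-ideals\<close>

context domain_subring
begin

lemma local_part_trivial:
  assumes P: "prime_in R P" and A: "submodule_of R A" "A \<subseteq> R" "\<not> A \<subseteq> P"
  shows "local_part R P A = localize R P"
proof
  show "local_part R P A \<subseteq> localize R P"
    unfolding localize_eq[OF P] by (rule local_part_mono[OF A(2)])
  obtain a where a: "a \<in> A" "a \<notin> P" using A(3) by blast
  show "localize R P \<subseteq> local_part R P A"
  proof
    fix x assume "x \<in> localize R P"
    then obtain u where u: "u \<in> R - P" "u * x \<in> R"
      unfolding localize_eq[OF P] by (auto simp: local_part_def)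
    have "(u * x) * a \<in> A" using submodule_ofD(3)[OF A(1) u(2) a(1)] .
    moreover have "a * u \<in> R - P" using compl_mult[OF P _ u(1), of a] a A(2) by blast
    ultimately show "x \<in> local_part R P A" by (intro local_partI[of "a * u"]) (auto simp: ac_simps)
  qed
qed

text \<open>Choose in each A i an element of R outside P. Their product lies in every A i, and
  outside P because the complement of a prime is multiplicatively closed. It supplies the common
  denominators in the gluing arguments.\<close>

lemma exists_common_avoiding:
  assumes P: "prime_in R P" and F: "finite F"
    and A: "\<And>i. i \<in> F \<Longrightarrow> submodule_of R (A i)" "\<And>i. i \<in> F \<Longrightarrow> \<exists>d\<in>A i. d \<in> R - P"
  shows "\<exists>d\<in>R - P. \<forall>i\<in>F. d \<in> A i"
proof -
  have "\<exists>f. \<forall>i\<in>F. f i \<in> A i \<and> f i \<in> R - P"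
    using A(2) by (intro bchoice) blast
  then obtain f where f: "\<And>i. i \<in> F \<Longrightarrow> f i \<in> A i \<and> f i \<in> R - P" by blast
  have "prod f F \<in> A i" if i: "i \<in> F" for i
  proof -
    have "prod f (F - {i}) \<in> R" using f by (intro prod_mem) blast
    then have "prod f (F - {i}) * f i \<in> A i" using submodule_ofD(3)[OF A(1)[OF i]] f[OF i] by blast
    then show ?thesis using prod.remove[OF F i, of f] by (simp add: mult.commute)
  qed
  moreover have "prod f F \<in> R - P" using f by (intro compl_prod[OF P]) blast
  ultimately show ?thesis by blast
qed

lemma t_maximal_not_subset:
  assumes "t_maximal R M" "t_maximal R N" "M \<noteq> N"
  shows "\<exists>d\<in>M. d \<in> R - N"
proof -
  have "N \<subset> R" using assms(2) by (simp add: t_maximal_def)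
  then show ?thesis
    using t_maximalD(6)[OF assms(1) t_maximalD(1)[OF assms(2)]] t_maximalD(3)[OF assms(1)] assms(3)
    by blast
qed

lemma module_prod_not_subset:
  assumes "prime_in R P" "A \<subseteq> R" "B \<subseteq> R" "\<not> A \<subseteq> P" "\<not> B \<subseteq> P"
  shows "\<not> module_prod A B \<subseteq> P"
proof -
  obtain a b where "a \<in> A" "b \<in> B" "a \<in> R - P" "b \<in> R - P" using assms by blast
  then show ?thesis using compl_mult[OF assms(1)] module_prodI[of a A b B] by blast
qed

lemma submodule_Inter: "(\<And>A. A \<in> \<A> \<Longrightarrow> submodule_of R A) \<Longrightarrow> submodule_of R (\<Inter>\<A>)"
  unfolding submodule_of_def by blast

text \<open>An element d that lies in all the other members but not in Q becomes a unit at Q, so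
  multiplying by d makes the conditions at the other members hold for free.\<close>

lemma local_part_Inter_mem:
  assumes Qs: "finite \<Q>" "\<And>Q. Q \<in> \<Q> \<Longrightarrow> t_maximal R Q" and Q: "Q \<in> \<Q>"
  shows "local_part R Q (\<Inter>\<Q>) = local_part R Q Q"
proof
  show "local_part R Q (\<Inter>\<Q>) \<subseteq> local_part R Q Q" using Q by (intro local_part_mono) blast
  have P: "prime_in R Q" using prime_t_maximal Qs(2) Q by blast
  have "\<exists>d\<in>R - Q. \<forall>N\<in>\<Q> - {Q}. d \<in> N"
    using Qs Q t_maximal_not_subset t_maximalD(2) by (intro exists_common_avoiding[OF P]) auto
  then obtain d where d: "d \<in> R - Q" "\<forall>N\<in>\<Q> - {Q}. d \<in> N" by blast
  show "local_part R Q Q \<subseteq> local_part R Q (\<Inter>\<Q>)"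
  proof
    fix x assume "x \<in> local_part R Q Q"
    then obtain u where u: "u \<in> R - Q" "u * x \<in> Q" by (auto simp: local_part_def)
    have "d * u * x \<in> N" if N: "N \<in> \<Q>" for N
    proof (cases "N = Q")
      case True
      then show ?thesis
        using submodule_ofD(3)[OF t_maximalD(2)[OF Qs(2)[OF Q]], of d "u * x"] d u
        by (simp add: mult.assoc)
    next
      case False
      have "u * x \<in> R" using u(2) t_maximalD(3)[OF Qs(2)[OF Q]] by blast
      then have "(u * x) * d \<in> N"
        using submodule_ofD(3)[OF t_maximalD(2)[OF Qs(2)[OF N]]] d(2) N False by blast
      then show ?thesis by (simp add: ac_simps)
    qed
    then show "x \<in> local_part R Q (\<Inter>\<Q>)"
      using compl_mult[OF P d(1) u(1)] by (intro local_partI[of "d * u"]) auto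
  qed
qed

lemma Inter_not_subset:
  assumes Qs: "finite \<Q>" "\<And>Q. Q \<in> \<Q> \<Longrightarrow> t_maximal R Q" and N: "t_maximal R N" "N \<notin> \<Q>"
  shows "\<not> \<Inter>\<Q> \<subseteq> N"
proof -
  have "\<exists>d\<in>R - N. \<forall>Q\<in>\<Q>. d \<in> Q"
    using Qs N t_maximal_not_subset t_maximalD(2)
    by (intro exists_common_avoiding[OF prime_t_maximal[OF N(1)]]) blast+
  then show ?thesis by blast
qed

lemma t_ideal_Inter:
  assumes Qs: "finite \<Q>" "\<Q> \<noteq> {}" "\<And>Q. Q \<in> \<Q> \<Longrightarrow> t_maximal R Q"
  shows "t_ideal R (\<Inter>\<Q>)"
proof (rule t_idealI)
  have sub: "submodule_of R (\<Inter>\<Q>)" using Qs t_maximalD(2) by (intro submodule_Inter) blast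
  have "\<Inter>\<Q> \<noteq> {0}"
  proof -
    \<comment> \<open>A product of nonzero elements, one from each Q, is a nonzero element of the
      intersection.\<close>
    have "\<exists>f. \<forall>Q\<in>\<Q>. f Q \<in> Q \<and> f Q \<noteq> 0"
    proof (intro bchoice ballI)
      fix Q assume "Q \<in> \<Q>"
      then show "\<exists>y. y \<in> Q \<and> y \<noteq> 0"
        using t_ideal_nz[OF t_maximalD(1)[OF Qs(3)]] submodule_ofD(1)[of R Q] by blast
    qed
    then obtain f where f: "\<And>Q. Q \<in> \<Q> \<Longrightarrow> f Q \<in> Q" "\<And>Q. Q \<in> \<Q> \<Longrightarrow> f Q \<noteq> 0" by blast
    have "prod f \<Q> \<in> Q" if Q: "Q \<in> \<Q>" for Q
    proof -
      have "f N \<in> R" if "N \<in> \<Q>" for N using f(1)[OF that] t_maximalD(3)[OF Qs(3)[OF that]] by blast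
      then have "prod f (\<Q> - {Q}) \<in> R" by (intro prod_mem) blast
      then have "prod f (\<Q> - {Q}) * f Q \<in> Q"
        using submodule_ofD(3)[OF t_maximalD(2)[OF Qs(3)[OF Q]]] f(1)[OF Q] by blast
      then show ?thesis using prod.remove[OF Qs(1) Q, of f] by (simp add: mult.commute)
    qed
    moreover have "prod f \<Q> \<noteq> 0" using f(2) Qs(1) by (simp add: prod_zero_iff)
    ultimately show ?thesis by blast
  qed
  moreover have "\<Inter>\<Q> \<subseteq> R" using Qs(2) Qs(3) t_maximalD(3) by blast
  ultimately show "fractional_ideal R (\<Inter>\<Q>)"
    using sub by (intro fractional_subset[OF fractional_self]) auto
  fix S x assume S: "finite S" "S \<subseteq> \<Inter>\<Q>" "x \<in> v_closure R S"
  have "x \<in> Q" if "Q \<in> \<Q>" for Q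
    using t_idealD[OF t_maximalD(1)[OF Qs(3)[OF that]] S(1) _ S(3)] S(2) that by blast
  then show "x \<in> \<Inter>\<Q>" by blast
qed

lemma local_stable:
  assumes P: "prime_in R P" and A: "submodule_of R A" and "v \<in> localize R P" "x \<in> local_part R P A"
  shows "v * x \<in> local_part R P A"
  using submodule_ofD(3)[OF submodule_local_part[OF P A]] assms(3,4) .

end

section \<open>Local structure of t-idempotent t-ideals\<close>

context krull_domain
begin

lemma valuation_cases:
  assumes "t_maximal R M" "x \<notin> localize R M"
  shows "inverse x \<in> localize R M" "x \<noteq> 0"
proof -
  show "inverse x \<in> localize R M"
    using valuation_localize assms unfolding valuation_domain_def by blast
  show "x \<noteq> 0"
    using assms(2) localize_superset[OF prime_t_maximal[OF assms(1)]] zero_mem by blast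
qed

text \<open>If division by \<open>s\<close> stabilizes the localization of \<open>J\<close> at \<open>M\<close>, then for each of the finitely many
  \<open>N\<close> containing \<open>s\<close> there is \<open>b \<notin> M\<close> with \<open>b J \<subseteq> s J R\<^sub>N\<close>: given \<open>a \<in> J\<close> outside \<open>s J R\<^sub>N\<close>, take the
  denominator of \<open>a / s\<^sup>2 \<in> J R\<^sub>M\<close>. The product of these \<open>b\<close>, divided by \<open>s\<close>, multiplies \<open>J\<close> into itself.\<close>

lemma local_multiplier:
  assumes J: "t_ideal R J" "colon J J = R" and M: "t_maximal R M" and s: "s \<in> M" "s \<noteq> 0"
  shows "\<exists>x\<in>local_part R M J. x / s \<notin> local_part R M J"
proof (rule ccontr)
  assume "\<not> ?thesis"
  then have stable: "x / s \<in> local_part R M J" if "x \<in> local_part R M J" for x using that by blast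
  have Js: "submodule_of R J" using t_ideal_nz[OF J(1)] by blast
  note pM = prime_t_maximal[OF M]
  let ?F = "{N. t_maximal R N \<and> s \<in> N}"
  have F: "finite ?F" using finite_t_maximal_containing s t_maximalD(3)[OF M] by blast
  have "\<exists>b\<in>R - M. \<forall>j\<in>J. b * (j / s) \<in> local_part R N J" if N: "N \<in> ?F" for N
  proof (cases "\<forall>j\<in>J. j / s \<in> local_part R N J")
    case True
    then show ?thesis using one_mem t_maximalD(4)[OF M] by (intro bexI[of _ 1]) auto
  next
    case False
    then obtain a where a: "a \<in> J" "a / s \<notin> local_part R N J" by blast
    have N': "t_maximal R N" using N by blast
    note pN = prime_t_maximal[OF N']
    \<comment> \<open>This is s J \<subseteq> a R_N. If it failed at j, then a / (j s) would lie in
      R_N by comparability, and multiplying by j would put a / s into J R_N.\<close>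
    have quot: "j * s / a \<in> localize R N" if j: "j \<in> J" for j
    proof (rule ccontr)
      assume no: "j * s / a \<notin> localize R N"
      have "inverse (j * s / a) * j \<in> local_part R N J"
        using valuation_cases(1)[OF N' no] j subset_local_part[OF pN]
        by (intro local_stable[OF pN Js]) auto
      then show False using a(2) valuation_cases(2)[OF N' no] by auto
    qed
    have "a / s / s \<in> local_part R M J"
      using stable a(1) subset_local_part[OF pM] by blast
    then obtain u where u: "u \<in> R - M" "u * (a / s / s) \<in> J" by (auto simp: local_part_def)
    have "a \<noteq> 0" using a(2) submodule_ofD(1)[OF submodule_local_part[OF pN Js]] by auto
    \<comment> \<open>\<open>quot\<close> is applied to the element u a / (s s) of J; the quotient
      collapses to u / s.\<close>
    then have us: "u / s \<in> localize R N" using quot[OF u(2)] s by simp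
    have "u * (j / s) \<in> local_part R N J" if "j \<in> J" for j
      using local_stable[OF pN Js us, of j] subset_local_part[OF pN, of J] that by auto
    then show ?thesis using u(1) by blast
  qed
  then have "\<exists>b\<in>R - M. \<forall>N\<in>?F. b \<in> {b. \<forall>j\<in>J. b * (j / s) \<in> local_part R N J}"
  proof (intro exists_common_avoiding[OF pM F])
    fix N assume "N \<in> ?F"
    then have pN: "prime_in R N" using prime_t_maximal by blast
    have sub: "submodule_of R (local_part R N J)"
      using submodule_of_subring[OF submodule_local_part[OF pN Js] localize_superset[OF pN]] .
    have "submodule_of R (\<Inter>j\<in>J. {b. b * (j / s) \<in> local_part R N J})"
      by (rule submodule_Inter) (use submodule_of_preimage[OF sub] in blast)
    moreover have "(\<Inter>j\<in>J. {b. b * (j / s) \<in> local_part R N J})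
        = {b. \<forall>j\<in>J. b * (j / s) \<in> local_part R N J}" by blast
    ultimately show "submodule_of R {b. \<forall>j\<in>J. b * (j / s) \<in> local_part R N J}" by simp
  qed blast
  then obtain b where b: "b \<in> R - M" "\<And>N j. N \<in> ?F \<Longrightarrow> j \<in> J \<Longrightarrow> b * (j / s) \<in> local_part R N J"
    by blast
  have "b / s * j \<in> J" if j: "j \<in> J" for j
  proof (rule t_ideal_mem_local[OF J(1)])
    fix N assume N: "t_maximal R N"
    show "b / s * j \<in> local_part R N J"
    proof (cases "s \<in> N")
      case True
      then show ?thesis using b(2)[of N j] N j by simp
    next
      case False
      have "b * j \<in> J" using submodule_ofD(3)[OF Js] b(1) j by blast
      then show ?thesis
        using False s t_maximalD(3)[OF M] by (intro local_partI[of s]) auto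
    qed
  qed
  \<comment> \<open>The multiplier b / s of J lies in R, so b = (b / s) s lies in M, although b was
    chosen outside M.\<close>
  then have "b / s \<in> R" using J(2) by (auto simp: colon_def)
  then have "b / s * s \<in> M" using submodule_ofD(3)[OF t_maximalD(2)[OF M]] s(1) by blast
  then show False using b(1) s(2) by simp
qed

text \<open>Let A = J R_M, so A A = A. If some s in M were missing from A, comparability would give
  A \<subseteq> s R_M, hence A = A A \<subseteq> s A. Division by s would then stabilize A, which
  \<open>local_multiplier\<close> forbids.\<close>

lemma local_part_idempotent:
  assumes J: "t_ideal R J" "colon J J = R" "t_closure R (module_prod J J) = J"
    and M: "t_maximal R M" "J \<subseteq> M"
  shows "local_part R M J = local_part R M M"
proof
  let ?A = "local_part R M J"
  note pM = prime_t_maximal[OF M(1)]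
  have Js: "nz_submodule R J" using t_ideal_nz[OF J(1)] by blast
  have AA: "module_prod ?A ?A = ?A"
    using local_part_t_closure[OF nz_submodule_module_prod[OF Js Js] M(1)] J(3)
      local_part_module_prod[OF pM] Js by simp
  show "?A \<subseteq> local_part R M M" by (rule local_part_mono[OF M(2)])
  have sA: "submodule_of (localize R M) ?A" using submodule_local_part[OF pM] Js by blast
  have "M \<subseteq> ?A"
  proof
    fix s assume s: "s \<in> M"
    show "s \<in> ?A"
    proof (rule ccontr)
      assume no: "s \<notin> ?A"
      then have "s \<noteq> 0" using submodule_ofD(1)[OF sA] by blast
      have V: "x / s \<in> localize R M" if x: "x \<in> ?A" for x
      proof (rule ccontr)
        assume *: "x / s \<notin> localize R M"
        then have "inverse (x / s) * x \<in> ?A"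
          using valuation_cases(1)[OF M(1) *] submodule_ofD(3)[OF sA] x by blast
        then show False using no valuation_cases(2)[OF M(1) *] by auto
      qed
      have "module_prod ?A ?A \<subseteq> {z. z * inverse s \<in> ?A}"
      proof (rule module_prod_subset[OF submodule_of_preimage[OF sA]])
        fix x y assume "x \<in> ?A" "y \<in> ?A"
        then have "x / s * y \<in> ?A" using V submodule_ofD(3)[OF sA] by blast
        then show "x * y \<in> {z. z * inverse s \<in> ?A}" by (simp add: field_simps)
      qed
      then have "\<forall>x\<in>?A. x / s \<in> ?A" unfolding AA by (auto simp: divide_inverse)
      then show False using local_multiplier[OF J(1,2) M(1) s \<open>s \<noteq> 0\<close>] by blast
    qed
  qed
  then have "local_part R M M \<subseteq> local_part R M ?A" by (rule local_part_mono)
  then show "local_part R M M \<subseteq> ?A" by (simp add: local_part_idem[OF pM])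
qed

text \<open>Checked at each t-maximal N: for N = Q this is the assumption, and for any other N
  neither Q nor its square lies in N, so the square localizes to the whole ring.\<close>

lemma t_idempotentI:
  assumes Q: "t_maximal R Q"
    and loc: "module_prod (local_part R Q Q) (local_part R Q Q) = local_part R Q Q"
  shows "t_idempotent R Q"
  unfolding t_idempotent_def
proof (intro conjI subset_antisym)
  have Qs: "nz_submodule R Q" using t_ideal_nz[OF t_maximalD(1)[OF Q]] .
  show t: "t_ideal R Q" by (rule t_maximalD(1)[OF Q])
  have "module_prod Q Q \<subseteq> Q"
    using Qs submodule_ofD(3)[of R Q] t_maximalD(3)[OF Q] by (intro module_prod_subset[of R]) auto
  then show "t_closure R (module_prod Q Q) \<subseteq> Q" by (rule t_closure_least[OF t])
  show "Q \<subseteq> t_closure R (module_prod Q Q)"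
  proof
    fix x assume x: "x \<in> Q"
    show "x \<in> t_closure R (module_prod Q Q)"
    proof (rule mem_t_closure_local[OF nz_submodule_module_prod[OF Qs Qs]])
      fix N assume N: "t_maximal R N"
      note pN = prime_t_maximal[OF N]
      show "x \<in> local_part R N (module_prod Q Q)"
      proof (cases "N = Q")
        case True
        then show ?thesis
          using local_part_module_prod[OF pN] Qs loc x subset_local_part[OF pN, of Q] by auto
      next
        case False
        have QR: "Q \<subseteq> R" "\<not> Q \<subseteq> N" using t_maximalD(3)[OF Q] t_maximal_not_subset[OF Q N] False by blast+
        have "module_prod Q Q \<subseteq> R" using \<open>module_prod Q Q \<subseteq> Q\<close> QR by blast
        then have "local_part R N (module_prod Q Q) = localize R N"
          using local_part_trivial[OF pN submodule_of_module_prod] Qs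
            module_prod_not_subset[OF pN QR(1,1,2,2)] by blast
        then show ?thesis using x QR(1) localize_superset[OF pN] by blast
      qed
    qed
  qed
qed

text \<open>J is determined by the t-maximal ideals above it: its localization is M R_M at each M
  containing J and the full ring elsewhere. These M inherit t-idempotence because J and M have the
  same localization at M.\<close>

lemma idempotent_cases:
  assumes J: "t_ideal R J" "colon J J = R" "t_closure R (module_prod J J) = J"
  shows "J = R \<or> (\<exists>\<Q>. finite \<Q> \<and> \<Q> \<noteq> {} \<and> (\<forall>Q\<in>\<Q>. t_maximal R Q \<and> t_idempotent R Q) \<and> J = \<Inter>\<Q>)"
proof (cases "J = R")
  case False
  have Js: "nz_submodule R J" using t_ideal_nz[OF J(1)] by blast
  have "module_prod J J \<subseteq> J"
    using t_closure_extensive[OF nz_submodule_module_prod[OF Js Js]] J(3) by simp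
  \<comment> \<open>An idempotent J multiplies itself into itself, so the assumption on
    \<open>colon J J\<close> makes J an integral ideal.\<close>
  then have "J \<subseteq> colon J J" unfolding colon_def using module_prodI[of _ J _ J] by blast
  then have JR: "J \<subseteq> R" using J(2) by simp
  let ?Q = "{M. t_maximal R M \<and> J \<subseteq> M}"
  have fin: "finite ?Q"
    using J(1) JR False krull_type unfolding krull_type_def finite_t_character_def by blast
  have ne: "?Q \<noteq> {}" using exists_t_maximal[OF J(1)] JR False by blast
  have "t_idempotent R Q" if "Q \<in> ?Q" for Q
  proof -
    have Q: "t_maximal R Q" "J \<subseteq> Q" using that by auto
    have eq: "local_part R Q J = local_part R Q Q" by (rule local_part_idempotent[OF J Q])
    have "module_prod (local_part R Q J) (local_part R Q J) = local_part R Q J"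
      using local_part_t_closure[OF nz_submodule_module_prod[OF Js Js] Q(1)] J(3)
        local_part_module_prod[OF prime_t_maximal[OF Q(1)]] Js by simp
    then show ?thesis using t_idempotentI[OF Q(1)] eq by simp
  qed
  moreover have "J = \<Inter>?Q"
  proof
    show "\<Inter>?Q \<subseteq> J"
    proof
      fix x assume x: "x \<in> \<Inter>?Q"
      show "x \<in> J"
      proof (rule t_ideal_mem_local[OF J(1)])
        fix N assume N: "t_maximal R N"
        note pN = prime_t_maximal[OF N]
        show "x \<in> local_part R N J"
        proof (cases "J \<subseteq> N")
          case True
          then have "x \<in> N" using x N by blast
          then show ?thesis
            using local_part_idempotent[OF J N True] subset_local_part[OF pN] by blast
        next
          case no: False
          have "x \<in> R" using x ne t_maximalD(3) by blast
          then show ?thesis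
            using local_part_trivial[OF pN _ JR no] Js localize_superset[OF pN] by blast
        qed
      qed
    qed
  qed blast
  ultimately show ?thesis using fin ne by blast
qed auto

lemma idempotent_local:
  assumes Q: "t_maximal R Q" "t_idempotent R Q"
  shows "module_prod (local_part R Q Q) (local_part R Q Q) = local_part R Q Q"
proof -
  have Qs: "nz_submodule R Q" using t_ideal_nz[OF t_maximalD(1)[OF Q(1)]] .
  show ?thesis
    using local_part_t_closure[OF nz_submodule_module_prod[OF Qs Qs] Q(1)] Q(2)
      local_part_module_prod[OF prime_t_maximal[OF Q(1)]] Qs unfolding t_idempotent_def by simp
qed

text \<open>Tested locally: at a member N the intersection becomes N R_N, which is idempotent; at
  every other t-maximal ideal the intersection and its square become the full ring.\<close>

lemma Inter_idempotent:
  assumes Qs: "finite \<Q>" "\<Q> \<noteq> {}" "\<And>Q. Q \<in> \<Q> \<Longrightarrow> t_maximal R Q \<and> t_idempotent R Q"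
  shows "t_closure R (module_prod (\<Inter>\<Q>) (\<Inter>\<Q>)) = \<Inter>\<Q>"
proof
  let ?J = "\<Inter>\<Q>"
  have J: "t_ideal R ?J" using Qs by (intro t_ideal_Inter) blast+
  have Js: "nz_submodule R ?J" using t_ideal_nz[OF J] .
  have JR: "?J \<subseteq> R" using Qs(2,3) t_maximalD(3) by blast
  have JJ: "module_prod ?J ?J \<subseteq> ?J"
  proof (rule module_prod_subset[of R])
    show "submodule_of R ?J" using Js by blast
    fix a b assume "a \<in> ?J" "b \<in> ?J"
    then show "a * b \<in> ?J" using submodule_ofD(3)[of R ?J a b] Js JR by blast
  qed
  then show "t_closure R (module_prod ?J ?J) \<subseteq> ?J" by (rule t_closure_least[OF J])
  show "?J \<subseteq> t_closure R (module_prod ?J ?J)"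
  proof
    fix x assume x: "x \<in> ?J"
    show "x \<in> t_closure R (module_prod ?J ?J)"
    proof (rule mem_t_closure_local[OF nz_submodule_module_prod[OF Js Js]])
      fix N assume N: "t_maximal R N"
      note pN = prime_t_maximal[OF N]
      have loc: "local_part R N (module_prod ?J ?J) = module_prod (local_part R N ?J) (local_part R N ?J)"
        using local_part_module_prod[OF pN] Js by blast
      show "x \<in> local_part R N (module_prod ?J ?J)"
      proof (cases "N \<in> \<Q>")
        case True
        have "local_part R N ?J = local_part R N N"
          using Qs True by (intro local_part_Inter_mem) blast+
        moreover have "module_prod (local_part R N N) (local_part R N N) = local_part R N N"
          using idempotent_local Qs(3)[OF True] by blast
        moreover have "x \<in> local_part R N N" using x True subset_local_part[OF pN] by blast
        ultimately show ?thesis using loc by simp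
      next
        case False
        have "\<not> ?J \<subseteq> N" using Qs N False by (intro Inter_not_subset) blast+
        then have "\<not> module_prod ?J ?J \<subseteq> N" using module_prod_not_subset[OF pN JR JR] by blast
        moreover have "module_prod ?J ?J \<subseteq> R" using JJ JR by blast
        ultimately have "local_part R N (module_prod ?J ?J) = localize R N"
          using local_part_trivial[OF pN submodule_of_module_prod] Js by blast
        then show ?thesis using x JR localize_superset[OF pN] by blast
      qed
    qed
  qed
qed

end

section \<open>Class semigroups\<close>

text \<open>The coset of A modulo principal ideals, free of the ring. By \<open>t_cls_eq\<close>,
  \<open>frac_cls_eq\<close> and \<open>inv_cls_eq\<close> all three kinds of class have this form,
  so the classes of one ideal over different rings are equal as sets.\<close>

definition scale_class :: "'k::field set \<Rightarrow> 'k set set" where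
  "scale_class A = {(*) x ` A | x. x \<noteq> 0}"

lemma scale_classI: "x \<noteq> 0 \<Longrightarrow> (*) x ` A \<in> scale_class A"
  by (auto simp: scale_class_def)

lemma scale_class_self: "A \<in> scale_class A"
  using scale_classI[of 1 A] by simp

lemma scale_scale: "(*) x ` (*) y ` A = (*) (x * y) ` (A :: 'k::field set)"
  by (auto simp: image_image mult.assoc)

lemma scale_class_scale:
  fixes x :: "'k::field"
  assumes "x \<noteq> 0"
  shows "scale_class ((*) x ` A) = scale_class A"
proof -
  have sub: "scale_class ((*) x ` A) \<subseteq> scale_class A" if "x \<noteq> 0" for x :: 'k and A
    using that unfolding scale_class_def scale_scale by fastforce
  have "A = (*) (inverse x) ` (*) x ` A" using assms by (simp add: scale_scale)
  then have "scale_class A \<subseteq> scale_class ((*) x ` A)"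
    using sub[of "inverse x" "(*) x ` A"] assms by simp
  then show ?thesis using sub[OF assms] by blast
qed

lemma scale_class_eq_iff: "scale_class A = scale_class B \<longleftrightarrow> (\<exists>x. x \<noteq> 0 \<and> A = (*) x ` B)"
proof
  assume "scale_class A = scale_class B"
  then have "A \<in> scale_class B" using scale_class_self[of A] by simp
  then show "\<exists>x. x \<noteq> 0 \<and> A = (*) x ` B" by (auto simp: scale_class_def)
qed (auto simp: scale_class_scale)

text \<open>Replacing a and b by their products with e turns the condition a b e = e into an honest
  inverse: elements fixed by e having an inverse fixed by e. The group laws are checked in this
  form.\<close>

lemma constituent_carrier:
  assumes S: "comm_monoid S" and e: "e \<in> carrier S" "e \<otimes>\<^bsub>S\<^esub> e = e"
  shows "carrier (constituent_group S e) =
    {a \<in> carrier S. a \<otimes>\<^bsub>S\<^esub> e = a \<and> (\<exists>b\<in>carrier S. b \<otimes>\<^bsub>S\<^esub> e = b \<and> a \<otimes>\<^bsub>S\<^esub> b = e)}"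
    (is "?L = ?R")
proof -
  interpret S: comm_monoid S by (rule S)
  show ?thesis
  proof
    show "?R \<subseteq> ?L"
    proof
      fix a assume "a \<in> ?R"
      then obtain b where "a \<in> carrier S" "a = a \<otimes>\<^bsub>S\<^esub> e" "b \<in> carrier S" "a \<otimes>\<^bsub>S\<^esub> b = e" by auto
      then have "a \<otimes>\<^bsub>S\<^esub> b \<otimes>\<^bsub>S\<^esub> e = e" using e by simp
      then show "a \<in> ?L"
        using \<open>a \<in> carrier S\<close> \<open>a = _\<close> \<open>b \<in> carrier S\<close> unfolding constituent_group_def by auto
    qed
    show "?L \<subseteq> ?R"
    proof
      fix x assume "x \<in> ?L"
      then obtain a b where ab: "a \<in> carrier S" "b \<in> carrier S" "x = a \<otimes>\<^bsub>S\<^esub> e"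
        "a \<otimes>\<^bsub>S\<^esub> b \<otimes>\<^bsub>S\<^esub> e = e" by (auto simp: constituent_group_def)
      have ee: "y \<otimes>\<^bsub>S\<^esub> e \<otimes>\<^bsub>S\<^esub> e = y \<otimes>\<^bsub>S\<^esub> e" if "y \<in> carrier S" for y
        using that e by (simp add: S.m_assoc)
      have "a \<otimes>\<^bsub>S\<^esub> e \<otimes>\<^bsub>S\<^esub> (b \<otimes>\<^bsub>S\<^esub> e) = a \<otimes>\<^bsub>S\<^esub> b \<otimes>\<^bsub>S\<^esub> (e \<otimes>\<^bsub>S\<^esub> e)"
        using ab(1,2) e(1) by (simp add: S.m_ac)
      also have "\<dots> = e" using ab(4) e(2) by simp
      finally show "x \<in> ?R" using ab ee e(1) by (auto intro!: bexI[of _ "b \<otimes>\<^bsub>S\<^esub> e"])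
    qed
  qed
qed

lemma comm_group_constituent:
  assumes S: "comm_monoid S" and e: "e \<in> carrier S" "e \<otimes>\<^bsub>S\<^esub> e = e"
  shows "comm_group (constituent_group S e)"
proof -
  interpret S: comm_monoid S by (rule S)
  let ?G = "constituent_group S e"
  have ops: "mult ?G = mult S" "one ?G = e" by (simp_all add: constituent_group_def)
  note C = constituent_carrier[OF S e]
  show ?thesis
  proof (rule comm_groupI)
    fix x y assume x: "x \<in> carrier ?G" and y: "y \<in> carrier ?G"
    obtain a where a: "a \<in> carrier S" "a \<otimes>\<^bsub>S\<^esub> e = a" "x \<otimes>\<^bsub>S\<^esub> a = e" "x \<in> carrier S" "x \<otimes>\<^bsub>S\<^esub> e = x"
      using x unfolding C by blast
    obtain b where b: "b \<in> carrier S" "b \<otimes>\<^bsub>S\<^esub> e = b" "y \<otimes>\<^bsub>S\<^esub> b = e" "y \<in> carrier S" "y \<otimes>\<^bsub>S\<^esub> e = y"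
      using y unfolding C by blast
    have "x \<otimes>\<^bsub>S\<^esub> y \<otimes>\<^bsub>S\<^esub> (a \<otimes>\<^bsub>S\<^esub> b) = (x \<otimes>\<^bsub>S\<^esub> a) \<otimes>\<^bsub>S\<^esub> (y \<otimes>\<^bsub>S\<^esub> b)"
      using a(1,4) b(1,4) by (simp add: S.m_ac)
    then have "x \<otimes>\<^bsub>S\<^esub> y \<otimes>\<^bsub>S\<^esub> (a \<otimes>\<^bsub>S\<^esub> b) = e" using a(3) b(3) e(2) by simp
    moreover have "x \<otimes>\<^bsub>S\<^esub> y \<otimes>\<^bsub>S\<^esub> e = x \<otimes>\<^bsub>S\<^esub> y" "a \<otimes>\<^bsub>S\<^esub> b \<otimes>\<^bsub>S\<^esub> e = a \<otimes>\<^bsub>S\<^esub> b"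
      using a b e(1) by (simp_all add: S.m_assoc)
    ultimately show "x \<otimes>\<^bsub>?G\<^esub> y \<in> carrier ?G" unfolding C ops using a b by blast
    show "x \<otimes>\<^bsub>?G\<^esub> y = y \<otimes>\<^bsub>?G\<^esub> x" using a(4) b(4) by (simp add: ops S.m_comm)
    show "\<one>\<^bsub>?G\<^esub> \<otimes>\<^bsub>?G\<^esub> x = x" using a(4,5) e(1) by (simp add: ops S.m_comm)
    have "a \<in> carrier ?G"
      unfolding C using a S.m_comm[of x a] by auto
    moreover have "a \<otimes>\<^bsub>?G\<^esub> x = \<one>\<^bsub>?G\<^esub>" using a by (simp add: ops S.m_comm)
    ultimately show "\<exists>y\<in>carrier ?G. y \<otimes>\<^bsub>?G\<^esub> x = \<one>\<^bsub>?G\<^esub>" by blast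
  next
    fix x y z assume "x \<in> carrier ?G" "y \<in> carrier ?G" "z \<in> carrier ?G"
    then show "x \<otimes>\<^bsub>?G\<^esub> y \<otimes>\<^bsub>?G\<^esub> z = x \<otimes>\<^bsub>?G\<^esub> (y \<otimes>\<^bsub>?G\<^esub> z)"
      unfolding C ops by (simp add: S.m_assoc)
  next
    show "\<one>\<^bsub>?G\<^esub> \<in> carrier ?G" unfolding C ops using e by blast
  qed
qed

text \<open>Common interface for the t-class semigroup, the class semigroup and the class group: M
  is a monoid of ideals and S its quotient by scaling. It lets computations with classes be done on
  ideals.\<close>

locale ideal_classes = comm_monoid M for M :: "'k::field set monoid" and S :: "'k set set monoid" +
  assumes scale_closed: "A \<in> carrier M \<Longrightarrow> c \<noteq> 0 \<Longrightarrow> (*) c ` A \<in> carrier M"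
    and scale_mult: "A \<in> carrier M \<Longrightarrow> B \<in> carrier M \<Longrightarrow> c \<noteq> 0 \<Longrightarrow>
      (*) c ` A \<otimes>\<^bsub>M\<^esub> B = (*) c ` (A \<otimes>\<^bsub>M\<^esub> B)"
    and class_carrier: "carrier S = scale_class ` carrier M"
    and class_mult: "A \<in> carrier M \<Longrightarrow> B \<in> carrier M \<Longrightarrow>
      scale_class A \<otimes>\<^bsub>S\<^esub> scale_class B = scale_class (A \<otimes>\<^bsub>M\<^esub> B)"
    and class_one: "\<one>\<^bsub>S\<^esub> = scale_class \<one>\<^bsub>M\<^esub>"
begin

lemma class_comm_monoid: "comm_monoid S"
proof (rule comm_monoidI)
  fix x y assume "x \<in> carrier S" "y \<in> carrier S"
  then obtain A B where "A \<in> carrier M" "B \<in> carrier M" "x = scale_class A" "y = scale_class B"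
    unfolding class_carrier by blast
  then show "x \<otimes>\<^bsub>S\<^esub> y \<in> carrier S" "x \<otimes>\<^bsub>S\<^esub> y = y \<otimes>\<^bsub>S\<^esub> x" "\<one>\<^bsub>S\<^esub> \<otimes>\<^bsub>S\<^esub> x = x"
    unfolding class_carrier by (auto simp: class_mult class_one m_comm)
next
  show "\<one>\<^bsub>S\<^esub> \<in> carrier S" unfolding class_carrier class_one by blast
next
  fix x y z assume "x \<in> carrier S" "y \<in> carrier S" "z \<in> carrier S"
  then obtain A B C where "A \<in> carrier M" "B \<in> carrier M" "C \<in> carrier M"
    "x = scale_class A" "y = scale_class B" "z = scale_class C"
    unfolding class_carrier by blast
  then show "x \<otimes>\<^bsub>S\<^esub> y \<otimes>\<^bsub>S\<^esub> z = x \<otimes>\<^bsub>S\<^esub> (y \<otimes>\<^bsub>S\<^esub> z)"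
    by (simp add: class_mult m_assoc)
qed

lemma scale_mult_right:
  "A \<in> carrier M \<Longrightarrow> B \<in> carrier M \<Longrightarrow> c \<noteq> 0 \<Longrightarrow> A \<otimes>\<^bsub>M\<^esub> (*) c ` B = (*) c ` (A \<otimes>\<^bsub>M\<^esub> B)"
  using scale_mult[of B A c] scale_closed[of B c] by (simp add: m_comm)

text \<open>An inverse class yields E = c A B only up to a scalar c. Multiplying A and B by E and
  moving c into the second factor gives the product E exactly.\<close>

lemma class_constituent:
  assumes E: "E \<in> carrier M" "E \<otimes>\<^bsub>M\<^esub> E = E"
  shows "carrier (constituent_group S (scale_class E)) =
    scale_class ` {A \<in> carrier M. A \<otimes>\<^bsub>M\<^esub> E = A \<and> (\<exists>B\<in>carrier M. B \<otimes>\<^bsub>M\<^esub> E = B \<and> A \<otimes>\<^bsub>M\<^esub> B = E)}"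
    (is "?L = scale_class ` ?R")
proof -
  have e: "scale_class E \<in> carrier S" "scale_class E \<otimes>\<^bsub>S\<^esub> scale_class E = scale_class E"
    using E class_mult class_carrier by auto
  note C = constituent_carrier[OF class_comm_monoid e]
  show ?thesis
  proof
    show "scale_class ` ?R \<subseteq> ?L"
    proof
      fix X assume "X \<in> scale_class ` ?R"
      then obtain A B where AB: "X = scale_class A" "A \<in> carrier M" "A \<otimes>\<^bsub>M\<^esub> E = A"
        "B \<in> carrier M" "B \<otimes>\<^bsub>M\<^esub> E = B" "A \<otimes>\<^bsub>M\<^esub> B = E" by blast
      then have "X \<otimes>\<^bsub>S\<^esub> scale_class E = X" "scale_class B \<otimes>\<^bsub>S\<^esub> scale_class E = scale_class B"
        "X \<otimes>\<^bsub>S\<^esub> scale_class B = scale_class E"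
        using E(1) by (simp_all add: class_mult)
      then show "X \<in> ?L" unfolding C class_carrier using AB(1,2,4) by blast
    qed
    show "?L \<subseteq> scale_class ` ?R"
    proof
      fix x assume "x \<in> ?L"
      then obtain A B where AB: "A \<in> carrier M" "B \<in> carrier M" "x = scale_class A"
        "x \<otimes>\<^bsub>S\<^esub> scale_class E = x" "x \<otimes>\<^bsub>S\<^esub> scale_class B = scale_class E"
        unfolding C class_carrier by blast
      then have x: "x = scale_class (A \<otimes>\<^bsub>M\<^esub> E)" using E by (simp add: class_mult)
      have "scale_class (A \<otimes>\<^bsub>M\<^esub> B) = scale_class E" using AB by (simp add: class_mult)
      then obtain c where c: "c \<noteq> 0" "E = (*) c ` (A \<otimes>\<^bsub>M\<^esub> B)"
        using scale_class_eq_iff by metis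
      let ?B = "(*) c ` (B \<otimes>\<^bsub>M\<^esub> E)"
      have EE: "Y \<otimes>\<^bsub>M\<^esub> E \<otimes>\<^bsub>M\<^esub> E = Y \<otimes>\<^bsub>M\<^esub> E" if "Y \<in> carrier M" for Y
        using that E by (simp add: m_assoc)
      have "?B \<in> carrier M" "?B \<otimes>\<^bsub>M\<^esub> E = ?B"
        using AB E c EE by (simp_all add: scale_closed scale_mult)
      moreover have "A \<otimes>\<^bsub>M\<^esub> E \<otimes>\<^bsub>M\<^esub> ?B = E"
      proof -
        have "A \<otimes>\<^bsub>M\<^esub> E \<otimes>\<^bsub>M\<^esub> (B \<otimes>\<^bsub>M\<^esub> E) = A \<otimes>\<^bsub>M\<^esub> B \<otimes>\<^bsub>M\<^esub> (E \<otimes>\<^bsub>M\<^esub> E)"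
          using AB E(1) by (simp add: m_ac)
        then have "A \<otimes>\<^bsub>M\<^esub> E \<otimes>\<^bsub>M\<^esub> ?B = (*) c ` (A \<otimes>\<^bsub>M\<^esub> B \<otimes>\<^bsub>M\<^esub> E)"
          using AB(1,2) E c(1) by (simp add: scale_mult_right)
        also have "\<dots> = (*) c ` (A \<otimes>\<^bsub>M\<^esub> B) \<otimes>\<^bsub>M\<^esub> E"
          using AB(1,2) E(1) c(1) by (simp add: scale_mult)
        also have "\<dots> = E" using c(2) E(2) by simp
        finally show ?thesis .
      qed
      ultimately have "A \<otimes>\<^bsub>M\<^esub> E \<in> ?R" using AB E EE by blast
      then show "x \<in> scale_class ` ?R" using x by blast
    qed
  qed
qed

text \<open>Not only some but every representative has an exact partner: if L = c A and B is the
  partner of A, then \<open>inverse c\<close> times B is the partner of L.\<close>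

lemma class_constituentD:
  assumes E: "E \<in> carrier M" "E \<otimes>\<^bsub>M\<^esub> E = E"
    and L: "L \<in> carrier M" "scale_class L \<in> carrier (constituent_group S (scale_class E))"
  shows "L \<otimes>\<^bsub>M\<^esub> E = L" "\<exists>B\<in>carrier M. B \<otimes>\<^bsub>M\<^esub> E = B \<and> L \<otimes>\<^bsub>M\<^esub> B = E"
proof -
  obtain A B where A: "A \<in> carrier M" "A \<otimes>\<^bsub>M\<^esub> E = A" "B \<in> carrier M" "B \<otimes>\<^bsub>M\<^esub> E = B" "A \<otimes>\<^bsub>M\<^esub> B = E"
    and "scale_class L = scale_class A"
    using L(2) unfolding class_constituent[OF E] by blast
  then obtain c where c: "c \<noteq> 0" "L = (*) c ` A" unfolding scale_class_eq_iff by blast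
  then show "L \<otimes>\<^bsub>M\<^esub> E = L" using A E by (simp add: scale_mult)
  let ?B = "(*) (inverse c) ` B"
  have "?B \<in> carrier M" "?B \<otimes>\<^bsub>M\<^esub> E = ?B" using A E c(1) by (simp_all add: scale_closed scale_mult)
  moreover have "L \<otimes>\<^bsub>M\<^esub> ?B = E"
  proof -
    have "A \<otimes>\<^bsub>M\<^esub> ?B = (*) (inverse c) ` E"
      using A(1,3,5) c(1) scale_mult_right[of A B "inverse c"] by simp
    then have "L \<otimes>\<^bsub>M\<^esub> ?B = (*) c ` (*) (inverse c) ` E"
      using scale_mult[OF A(1) \<open>?B \<in> carrier M\<close> c(1)] c(2) by simp
    then show ?thesis using c(1) by (simp add: scale_scale)
  qed
  ultimately show "\<exists>B\<in>carrier M. B \<otimes>\<^bsub>M\<^esub> E = B \<and> L \<otimes>\<^bsub>M\<^esub> B = E" by blast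
qed

end

text \<open>\<open>Mod\<close> multiplies cosets elementwise, so the product must be known for all
  multiples of the two representatives. For the reverse inclusion the scalar on B is 1.\<close>

lemma set_mult_scale_class:
  assumes "\<And>x y. x \<noteq> 0 \<Longrightarrow> y \<noteq> 0 \<Longrightarrow> (*) x ` A \<otimes>\<^bsub>G\<^esub> (*) y ` B = (*) (x * y) ` C"
  shows "scale_class A <#>\<^bsub>G\<^esub> scale_class B = scale_class C"
proof
  show "scale_class A <#>\<^bsub>G\<^esub> scale_class B \<subseteq> scale_class C"
  proof
    fix X assume "X \<in> scale_class A <#>\<^bsub>G\<^esub> scale_class B"
    then obtain x y where "x \<noteq> 0" "y \<noteq> 0" "X = (*) x ` A \<otimes>\<^bsub>G\<^esub> (*) y ` B"
      by (auto simp: set_mult_def scale_class_def)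
    then show "X \<in> scale_class C" using assms by (simp add: scale_classI)
  qed
  show "scale_class C \<subseteq> scale_class A <#>\<^bsub>G\<^esub> scale_class B"
  proof
    fix X assume "X \<in> scale_class C"
    then obtain x where x: "x \<noteq> 0" "X = (*) x ` C" by (auto simp: scale_class_def)
    then have "X = (*) x ` A \<otimes>\<^bsub>G\<^esub> (*) 1 ` B" using assms[of x 1] by simp
    then show "X \<in> scale_class A <#>\<^bsub>G\<^esub> scale_class B"
      using scale_classI[of x A] scale_classI[of 1 B] x(1) unfolding set_mult_def by auto
  qed
qed

lemma Prin_eq: "Prin R = scale_class R"
  by (auto simp: Prin_def scale_class_def)

lemma r_coset_Prin:
  assumes "\<And>x. x \<noteq> 0 \<Longrightarrow> (*) x ` R \<otimes>\<^bsub>G\<^esub> A = (*) x ` C"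
  shows "Prin R #>\<^bsub>G\<^esub> A = scale_class C"
  using assms unfolding Prin_eq r_coset_def scale_class_def by auto

section \<open>The t-class semigroup, the class semigroup and the class group of a domain\<close>

context domain_subring
begin

lemma F_t_simps:
  "carrier (F_t R) = {A. t_ideal R A}" "\<one>\<^bsub>F_t R\<^esub> = R"
  "A \<otimes>\<^bsub>F_t R\<^esub> B = t_closure R (module_prod A B)"
  by (simp_all add: F_t_def)

lemma F_frac_simps:
  "carrier (F_frac R) = {A. fractional_ideal R A}" "\<one>\<^bsub>F_frac R\<^esub> = R"
  "A \<otimes>\<^bsub>F_frac R\<^esub> B = module_prod A B"
  by (simp_all add: F_frac_def)

lemma t_ideal_prod: "t_ideal R A \<Longrightarrow> t_ideal R B \<Longrightarrow> t_ideal R (t_closure R (module_prod A B))"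
  using t_ideal_t_closure fractional_module_prod unfolding t_ideal_def by blast

lemma comm_monoid_F_t: "comm_monoid (F_t R)"
proof (rule comm_monoidI, unfold F_t_simps mem_Collect_eq)
  fix A B C assume A: "t_ideal R A" and B: "t_ideal R B" and C: "t_ideal R C"
  show "t_ideal R (t_closure R (module_prod A B))" by (rule t_ideal_prod[OF A B])
  show "t_closure R (module_prod A B) = t_closure R (module_prod B A)"
    by (simp add: module_prod_commute)
  show "t_closure R (module_prod R A) = A"
    using module_prod_unit[OF _ one_mem] t_ideal_nz[OF A] A by (simp add: t_ideal_def)
  show "t_closure R (module_prod (t_closure R (module_prod A B)) C)
      = t_closure R (module_prod A (t_closure R (module_prod B C)))"
  proof -
    note nz = t_ideal_nz[OF A] t_ideal_nz[OF B] t_ideal_nz[OF C]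
    show ?thesis
      using t_closure_prod_left[OF nz_submodule_module_prod[OF nz(1,2)] nz(3)]
        t_closure_prod_right[OF nz(1) nz_submodule_module_prod[OF nz(2,3)]]
      by (simp add: module_prod_assoc)
  qed
qed (rule t_ideal_self)

lemma comm_monoid_F_frac: "comm_monoid (F_frac R)"
  by (rule comm_monoidI, unfold F_frac_simps mem_Collect_eq)
    (simp_all add: fractional_module_prod fractional_self module_prod_ac fractional_ideal_nz
      module_prod_unit_right[OF _ one_mem])

lemma scale_self: "submodule_of R A \<Longrightarrow> module_prod ((*) x ` R) A = (*) x ` A"
  using module_prod_unit[OF _ one_mem] by (simp add: module_prod_scale)

lemma scale_prod: "module_prod ((*) x ` A) ((*) y ` B) = (*) (x * y) ` module_prod A B"
  unfolding module_prod_scale[of x A] module_prod_scale_right[of A y] scale_scale ..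

lemma t_cls_closure: "nz_submodule R A \<Longrightarrow> t_cls R A = scale_class (t_closure R A)"
  unfolding t_cls_def
  by (rule r_coset_Prin) (simp add: F_t_simps scale_self t_closure_scale)

lemma t_cls_eq: "t_ideal R A \<Longrightarrow> t_cls R A = scale_class A"
  using t_cls_closure[OF t_ideal_nz] by (simp add: t_ideal_def)

lemma frac_cls_eq: "submodule_of R A \<Longrightarrow> frac_cls R A = scale_class A"
  unfolding frac_cls_def
  by (rule r_coset_Prin) (simp add: F_frac_simps scale_self)

lemma inv_cls_eq: "t_ideal R A \<Longrightarrow> inv_cls R A = scale_class A"
  using t_cls_eq[of A] unfolding inv_cls_def t_cls_def r_coset_def
  by (simp add: Inv_t_def units_of_mult)

lemma t_ideal_classes: "ideal_classes (F_t R) (t_class_semigroup R)"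
proof (rule ideal_classes.intro[OF comm_monoid_F_t], unfold_locales, unfold F_t_simps mem_Collect_eq)
  fix A B :: "'k set" and c :: 'k assume A: "t_ideal R A"
  show "t_ideal R ((*) c ` A)" if "c \<noteq> 0" using t_ideal_scale[OF A that] .
  assume B: "t_ideal R B"
  have AB: "nz_submodule R (module_prod A B)" using nz_submodule_module_prod t_ideal_nz A B by blast
  show "t_closure R (module_prod ((*) c ` A) B) = (*) c ` t_closure R (module_prod A B)" if "c \<noteq> 0"
    using t_closure_scale[OF AB that] by (simp add: module_prod_scale)
  show "scale_class A \<otimes>\<^bsub>t_class_semigroup R\<^esub> scale_class B = scale_class (t_closure R (module_prod A B))"
    unfolding t_class_semigroup_def mult_FactGroup
    by (rule set_mult_scale_class) (simp add: F_t_simps scale_prod t_closure_scale[OF AB])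
next
  show "carrier (t_class_semigroup R) = scale_class ` {A. t_ideal R A}"
    unfolding t_class_semigroup_def carrier_FactGroup F_t_simps using t_cls_eq
    by (intro image_cong) (auto simp: t_cls_def)
  show "\<one>\<^bsub>t_class_semigroup R\<^esub> = scale_class R"
    by (simp add: t_class_semigroup_def Prin_eq)
qed

lemma frac_ideal_classes: "ideal_classes (F_frac R) (class_semigroup R)"
proof (rule ideal_classes.intro[OF comm_monoid_F_frac], unfold_locales, unfold F_frac_simps mem_Collect_eq)
  fix A B :: "'k set" and c :: 'k assume A: "fractional_ideal R A"
  show "fractional_ideal R ((*) c ` A)" if "c \<noteq> 0" using fractional_scale[OF A that] .
  show "module_prod ((*) c ` A) B = (*) c ` module_prod A B"
    by (rule module_prod_scale)
  show "scale_class A \<otimes>\<^bsub>class_semigroup R\<^esub> scale_class B = scale_class (module_prod A B)"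
    unfolding class_semigroup_def mult_FactGroup
    by (rule set_mult_scale_class) (simp add: F_frac_simps scale_prod)
next
  show "carrier (class_semigroup R) = scale_class ` {A. fractional_ideal R A}"
    unfolding class_semigroup_def carrier_FactGroup F_frac_simps using frac_cls_eq fractional_ideal_nz
    by (intro image_cong) (auto simp: frac_cls_def)
  show "\<one>\<^bsub>class_semigroup R\<^esub> = scale_class R"
    by (simp add: class_semigroup_def Prin_eq)
qed

lemma carrier_Inv_t:
  "carrier (Inv_t R) = {A. t_ideal R A \<and> (\<exists>B. t_ideal R B \<and> t_closure R (module_prod A B) = R)}"
  by (auto simp: Inv_t_def units_of_carrier Units_def F_t_simps module_prod_commute)

lemma inv_ideal_classes: "ideal_classes (Inv_t R) (class_group R)"
proof -
  interpret F: ideal_classes "F_t R" "t_class_semigroup R" by (rule t_ideal_classes)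
  have cm: "comm_monoid (Inv_t R)"
    using F.units_comm_group by (simp add: Inv_t_def comm_group_def)
  have ops: "mult (Inv_t R) = mult (F_t R)" "one (Inv_t R) = R"
    by (simp_all add: Inv_t_def units_of_mult units_of_one F_t_simps)
  have sub: "A \<in> carrier (F_t R)" if "A \<in> carrier (Inv_t R)" for A
    using that by (simp add: carrier_Inv_t F_t_simps)
  show ?thesis
  proof (rule ideal_classes.intro[OF cm], unfold_locales)
    fix A B :: "'k set" and c :: 'k assume A: "A \<in> carrier (Inv_t R)"
    show "(*) c ` A \<in> carrier (Inv_t R)" if c: "c \<noteq> 0"
    proof -
      obtain B where B: "t_ideal R A" "t_ideal R B" "t_closure R (module_prod A B) = R"
        using A by (auto simp: carrier_Inv_t)
      then have "module_prod ((*) c ` A) ((*) (inverse c) ` B) = module_prod A B"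
        using c by (simp add: scale_prod)
      then show ?thesis
        using B t_ideal_scale[OF B(1) c] t_ideal_scale[OF B(2), of "inverse c"] c
        unfolding carrier_Inv_t by (auto intro!: exI[of _ "(*) (inverse c) ` B"])
    qed
    assume B: "B \<in> carrier (Inv_t R)"
    show "(*) c ` A \<otimes>\<^bsub>Inv_t R\<^esub> B = (*) c ` (A \<otimes>\<^bsub>Inv_t R\<^esub> B)" if "c \<noteq> 0"
      using F.scale_mult[OF sub[OF A] sub[OF B] that] by (simp add: ops)
    show "scale_class A \<otimes>\<^bsub>class_group R\<^esub> scale_class B = scale_class (A \<otimes>\<^bsub>Inv_t R\<^esub> B)"
      using F.class_mult[OF sub[OF A] sub[OF B]]
      by (simp add: class_group_def t_class_semigroup_def set_mult_def ops)
  next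
    show "carrier (class_group R) = scale_class ` carrier (Inv_t R)"
      unfolding class_group_def carrier_FactGroup
      by (intro image_cong) (auto simp: carrier_Inv_t inv_cls_def[symmetric] inv_cls_eq)
    show "\<one>\<^bsub>class_group R\<^esub> = scale_class \<one>\<^bsub>Inv_t R\<^esub>"
      by (simp add: class_group_def Prin_eq ops)
  qed
qed

lemma group_class_group: "group (class_group R)"
proof -
  interpret I: ideal_classes "Inv_t R" "class_group R" by (rule inv_ideal_classes)
  interpret S: comm_monoid "class_group R" by (rule I.class_comm_monoid)
  show ?thesis
  proof (rule S.group_l_invI)
    fix X assume "X \<in> carrier (class_group R)"
    then obtain A B where AB: "X = scale_class A" "t_ideal R A" "t_ideal R B"
      "t_closure R (module_prod A B) = R"
      by (auto simp: I.class_carrier carrier_Inv_t)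
    then have car: "A \<in> carrier (Inv_t R)" "B \<in> carrier (Inv_t R)"
      unfolding carrier_Inv_t by (auto simp: module_prod_commute)
    have "B \<otimes>\<^bsub>Inv_t R\<^esub> A = \<one>\<^bsub>Inv_t R\<^esub>"
      using AB by (simp add: Inv_t_def units_of_mult units_of_one F_t_simps module_prod_commute)
    then have "scale_class B \<otimes>\<^bsub>class_group R\<^esub> X = \<one>\<^bsub>class_group R\<^esub>"
      using I.class_mult[OF car(2,1)] AB(1) I.class_one by simp
    then show "\<exists>Y\<in>carrier (class_group R). Y \<otimes>\<^bsub>class_group R\<^esub> X = \<one>\<^bsub>class_group R\<^esub>"
      using car(2) I.class_carrier by blast
  qed
qed

end

section \<open>The groups of an idempotent intersection\<close>

text \<open>Every element of the constituent group of the class of \<open>J\<close> is represented by an ideal \<open>A\<close> whose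
  partner \<open>B\<close> gives \<open>J\<close> itself and not only a multiple of \<open>J\<close>.\<close>

definition constituent_ideals :: "'k::field set \<Rightarrow> 'k set \<Rightarrow> 'k set set" where
  "constituent_ideals R J = {A. t_ideal R A \<and> t_closure R (module_prod A J) = A \<and>
     (\<exists>B. t_ideal R B \<and> t_closure R (module_prod B J) = B \<and> t_closure R (module_prod A B) = J)}"

text \<open>A sum of two products is a single product: of the first factors one divides the other,
  and it can be pulled out.\<close>

lemma valuation_prod_mem:
  assumes V: "valuation_domain V" and A: "submodule_of V A" and B: "submodule_of V B"
    and x: "x \<in> module_prod A B"
  shows "\<exists>a\<in>A. \<exists>b\<in>B. x = a * b"
proof -
  have sum: "\<exists>a\<in>A. \<exists>b\<in>B. a1 * b1 + a2 * b2 = a * b"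
    if ab: "a1 \<in> A" "a2 \<in> A" "b1 \<in> B" "b2 \<in> B" for a1 a2 b1 b2
  proof (cases "a1 = 0")
    case True
    then show ?thesis using ab by auto
  next
    case False
    have *: "a2 / a1 \<in> V \<or> a1 / a2 \<in> V"
      using V unfolding valuation_domain_def by (metis inverse_divide)
    show ?thesis
    proof (cases "a2 / a1 \<in> V")
      case True
      have "a1 * b1 + a2 * b2 = a1 * (b1 + a2 / a1 * b2)" using False by (simp add: field_simps)
      moreover have "b1 + a2 / a1 * b2 \<in> B" using submodule_ofD(2,3)[OF B] True ab by blast
      ultimately show ?thesis using ab by blast
    next
      case no: False
      show ?thesis
      proof (cases "a2 = 0")
        case True
        then show ?thesis using ab by auto
      next
        case False
        have "a1 / a2 \<in> V" using * no by blast
        then have "a1 / a2 * b1 + b2 \<in> B" using submodule_ofD(2,3)[OF B] ab by blast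
        moreover have "a1 * b1 + a2 * b2 = a2 * (a1 / a2 * b1 + b2)" using False by (simp add: field_simps)
        ultimately show ?thesis using ab by blast
      qed
    qed
  qed
  have "module_prod A B \<subseteq> {x. \<exists>a\<in>A. \<exists>b\<in>B. x = a * b}"
  proof (rule module_prod_least)
    show "0 \<in> {x. \<exists>a\<in>A. \<exists>b\<in>B. x = a * b}"
      using submodule_ofD(1)[OF A] submodule_ofD(1)[OF B] by force
  qed (use sum in auto)
  then show ?thesis using x by blast
qed

context domain_subring
begin

text \<open>The partner of (L J)_t is (L' J)_t, because (L J)(L' J) = (L L')(J J) in the monoid of
  t-ideals.\<close>

lemma Inv_t_mult_left:
  assumes L: "t_ideal R L" "t_ideal R L'" "t_closure R (module_prod L L') = R"
    and J: "t_ideal R J" "t_closure R (module_prod J J) = J"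
  shows "t_closure R (module_prod L J) \<in> constituent_ideals R J"
proof -
  interpret F: comm_monoid "F_t R" by (rule comm_monoid_F_t)
  have car: "L \<in> carrier (F_t R)" "L' \<in> carrier (F_t R)" "J \<in> carrier (F_t R)"
    using L J by (simp_all add: F_t_simps)
  have JJ: "J \<otimes>\<^bsub>F_t R\<^esub> J = J" and LL: "L \<otimes>\<^bsub>F_t R\<^esub> L' = \<one>\<^bsub>F_t R\<^esub>"
    using L J by (simp_all add: F_t_simps)
  have 1: "X \<otimes>\<^bsub>F_t R\<^esub> J \<otimes>\<^bsub>F_t R\<^esub> J = X \<otimes>\<^bsub>F_t R\<^esub> J" if "X \<in> carrier (F_t R)" for X
    using that car JJ by (simp add: F.m_assoc)
  have "L \<otimes>\<^bsub>F_t R\<^esub> J \<otimes>\<^bsub>F_t R\<^esub> (L' \<otimes>\<^bsub>F_t R\<^esub> J)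
      = L \<otimes>\<^bsub>F_t R\<^esub> L' \<otimes>\<^bsub>F_t R\<^esub> (J \<otimes>\<^bsub>F_t R\<^esub> J)"
    using car by (simp add: F.m_ac)
  then have "L \<otimes>\<^bsub>F_t R\<^esub> J \<otimes>\<^bsub>F_t R\<^esub> (L' \<otimes>\<^bsub>F_t R\<^esub> J) = J" using car JJ LL by simp
  then show ?thesis
    using 1[OF car(1)] 1[OF car(2)] F.m_closed[OF car(1,3)] F.m_closed[OF car(2,3)]
    unfolding constituent_ideals_def F_t_simps by blast
qed

text \<open>Injectivity of \<phi>. From L J \<subseteq> x J and (J : J) = R follows L \<subseteq> x
  R. Multiplying the equation by L' gives x L' J \<subseteq> J, so x L' \<subseteq> R; then x R, the
  t-closure of x L L', lies in L.\<close>

lemma principal_of_Inv_t_mult: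
  assumes L: "t_ideal R L" "t_ideal R L'" "t_closure R (module_prod L L') = R"
    and J: "t_ideal R J" "colon J J = R" and x: "x \<noteq> 0"
    and eq: "t_closure R (module_prod L J) = (*) x ` J"
  shows "L = (*) x ` R"
proof
  note nz = t_ideal_nz[OF L(1)] t_ideal_nz[OF L(2)] t_ideal_nz[OF J(1)]
  have LJ: "l * j \<in> (*) x ` J" if "l \<in> L" "j \<in> J" for l j
    using t_closure_extensive[OF nz_submodule_module_prod[OF nz(1,3)]] module_prodI[OF that] eq by blast
  show "L \<subseteq> (*) x ` R"
  proof
    fix l assume l: "l \<in> L"
    have "l / x * j \<in> J" if "j \<in> J" for j
      using LJ[OF l that] x by auto
    then have "l / x \<in> R" using J(2) by (auto simp: colon_def)
    then show "l \<in> (*) x ` R" using x by (intro image_eqI[of _ _ "l / x"]) auto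
  qed
  have "(*) x ` module_prod J L' = module_prod (t_closure R (module_prod L J)) L'"
    unfolding eq module_prod_scale ..
  also have "\<dots> \<subseteq> t_closure R (module_prod (module_prod L J) L')"
    by (rule module_prod_t_closure_subset[OF nz_submodule_module_prod[OF nz(1,3)] nz(2)])
  also have "module_prod (module_prod L J) L' = module_prod (module_prod L L') J"
    by (simp add: module_prod_ac)
  also have "t_closure R (module_prod (module_prod L L') J) = t_closure R (module_prod R J)"
    using t_closure_prod_left[OF nz_submodule_module_prod[OF nz(1,2)] nz(3)] L(3) by simp
  also have "\<dots> = J" using module_prod_unit[OF _ one_mem] nz(3) J(1) by (simp add: t_ideal_def)
  finally have sub: "(*) x ` module_prod J L' \<subseteq> J" .
  have xL': "(*) x ` L' \<subseteq> R"
  proof safe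
    fix l assume l: "l \<in> L'"
    have "x * l * j \<in> J" if "j \<in> J" for j
      using sub module_prodI[OF that l] by (auto simp: ac_simps)
    then show "x * l \<in> R" using J(2) by (auto simp: colon_def)
  qed
  have "module_prod L ((*) x ` L') \<subseteq> L"
  proof (rule module_prod_subset[of R])
    fix a b assume "a \<in> L" "b \<in> (*) x ` L'"
    then show "a * b \<in> L" using xL' submodule_ofD(3)[of R L b a] nz(1) by (auto simp: mult.commute)
  qed (use nz in blast)
  then have "t_closure R ((*) x ` module_prod L L') \<subseteq> L"
    using t_closure_least[OF L(1)] by (simp add: module_prod_scale_right)
  then show "(*) x ` R \<subseteq> L"
    using t_closure_scale[OF nz_submodule_module_prod[OF nz(1,2)] x] L(3) by simp
qed

end

text \<open>Applied with T in the place of R. There J is a multiple of I, so its multiplier ring is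
  T.\<close>

locale idempotent_intersection = krull_domain R for R :: "'k::field set" +
  fixes \<Q> :: "'k set set" and J :: "'k set"
  assumes finite_\<Q>: "finite \<Q>" and nonempty_\<Q>: "\<Q> \<noteq> {}"
    and max_\<Q>: "Q \<in> \<Q> \<Longrightarrow> t_maximal R Q" and idem_\<Q>: "Q \<in> \<Q> \<Longrightarrow> t_idempotent R Q"
    and J_eq: "J = \<Inter>\<Q>" and colon_J: "colon J J = R"
begin

lemma t_ideal_J: "t_ideal R J"
  unfolding J_eq using finite_\<Q> nonempty_\<Q> max_\<Q> by (rule t_ideal_Inter)

lemma J_idem: "t_closure R (module_prod J J) = J"
  unfolding J_eq using finite_\<Q> nonempty_\<Q> max_\<Q> idem_\<Q> by (intro Inter_idempotent) auto

lemma nz_J: "nz_submodule R J"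
  by (rule t_ideal_nz[OF t_ideal_J])

lemma J_subset: "J \<subseteq> R"
  unfolding J_eq using nonempty_\<Q> max_\<Q> t_maximalD(3) by blast

lemma local_J: "Q \<in> \<Q> \<Longrightarrow> local_part R Q J = local_part R Q Q"
  unfolding J_eq using finite_\<Q> max_\<Q> by (rule local_part_Inter_mem)

lemma J_not_subset: "t_maximal R N \<Longrightarrow> N \<notin> \<Q> \<Longrightarrow> \<not> J \<subseteq> N"
  unfolding J_eq using finite_\<Q> max_\<Q> by (rule Inter_not_subset)

lemma prime_\<Q>: "Q \<in> \<Q> \<Longrightarrow> prime_in R Q"
  by (rule prime_t_maximal[OF max_\<Q>])

lemma local_idem: "Q \<in> \<Q> \<Longrightarrow> module_prod (local_part R Q Q) (local_part R Q Q) = local_part R Q Q"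
  by (rule idempotent_local[OF max_\<Q> idem_\<Q>])

lemma local_t_closure_prod:
  assumes Q: "Q \<in> \<Q>" and A: "nz_submodule R A" and B: "nz_submodule R B"
  shows "local_part R Q (t_closure R (module_prod A B)) = module_prod (local_part R Q A) (local_part R Q B)"
  using local_part_t_closure[OF nz_submodule_module_prod[OF A B] max_\<Q>[OF Q]]
    local_part_module_prod[OF prime_\<Q>[OF Q]] A B by simp

text \<open>The conditions on A and on its partner pass to R_Q, where J becomes Q R_Q. This is why
  \<psi> takes values in the constituent groups of the localizations.\<close>

lemma constituent_local:
  assumes A: "A \<in> constituent_ideals R J" and Q: "Q \<in> \<Q>"
  shows "module_prod (local_part R Q A) (local_part R Q Q) = local_part R Q A"
    and "\<exists>B. fractional_ideal (localize R Q) B \<and> module_prod B (local_part R Q Q) = B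
      \<and> module_prod (local_part R Q A) B = local_part R Q Q"
proof -
  obtain B where B: "t_ideal R A" "t_closure R (module_prod A J) = A" "t_ideal R B"
    "t_closure R (module_prod B J) = B" "t_closure R (module_prod A B) = J"
    using A by (auto simp: constituent_ideals_def)
  note nz = t_ideal_nz[OF B(1)] t_ideal_nz[OF B(3)]
  show "module_prod (local_part R Q A) (local_part R Q Q) = local_part R Q A"
    using local_t_closure_prod[OF Q nz(1) nz_J] B(2) local_J[OF Q] by simp
  moreover have "module_prod (local_part R Q B) (local_part R Q Q) = local_part R Q B"
    using local_t_closure_prod[OF Q nz(2) nz_J] B(4) local_J[OF Q] by simp
  moreover have "module_prod (local_part R Q A) (local_part R Q B) = local_part R Q Q"
    using local_t_closure_prod[OF Q nz] B(5) local_J[OF Q] by simp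
  moreover have "fractional_ideal (localize R Q) (local_part R Q B)"
    using fractional_local_part[OF prime_\<Q>[OF Q]] B(3) by (simp add: t_ideal_def)
  ultimately show "\<exists>B. fractional_ideal (localize R Q) B \<and> module_prod B (local_part R Q Q) = B
      \<and> module_prod (local_part R Q A) B = local_part R Q Q" by blast
qed

text \<open>The composite of \<phi> and \<psi> is trivial: L is invertible over the valuation ring,
  so 1 = a b is a single product and L R_Q is generated by a.\<close>

lemma local_Inv_t_mult:
  assumes L: "t_ideal R L" "t_ideal R L'" "t_closure R (module_prod L L') = R" and Q: "Q \<in> \<Q>"
  shows "\<exists>x. x \<noteq> 0 \<and> local_part R Q (t_closure R (module_prod L J)) = (*) x ` local_part R Q Q"
proof -
  let ?V = "localize R Q"
  note pQ = prime_\<Q>[OF Q]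
  have V: "domain_subring ?V" using domain_localize[OF pQ] by (simp add: domain_subring_def)
  note nz = t_ideal_nz[OF L(1)] t_ideal_nz[OF L(2)]
  have sub: "submodule_of ?V (local_part R Q L)" "submodule_of ?V (local_part R Q L')"
    using submodule_local_part[OF pQ] nz by blast+
  have prod: "module_prod (local_part R Q L) (local_part R Q L') = ?V"
    using local_t_closure_prod[OF Q nz] L(3) localize_eq[OF pQ] by simp
  then have "1 \<in> module_prod (local_part R Q L) (local_part R Q L')"
    using domain_subring.one_mem[OF V] by simp
  then obtain a b where ab: "a \<in> local_part R Q L" "b \<in> local_part R Q L'" "1 = a * b"
    using valuation_prod_mem[OF valuation_localize[OF max_\<Q>[OF Q]] sub] by blast
  have "local_part R Q L = (*) a ` ?V"
  proof
    show "(*) a ` ?V \<subseteq> local_part R Q L"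
      by (rule domain_subring.scale_self_subset[OF V sub(1) ab(1)])
    show "local_part R Q L \<subseteq> (*) a ` ?V"
    proof
      fix x assume "x \<in> local_part R Q L"
      then have "x * b \<in> ?V" using module_prodI[OF _ ab(2)] prod by blast
      moreover have "x = a * (x * b)" using ab(3) by (metis mult.left_commute mult.right_neutral)
      ultimately show "x \<in> (*) a ` ?V" by blast
    qed
  qed
  moreover have "submodule_of ?V (local_part R Q Q)"
    using submodule_local_part[OF pQ t_maximalD(2)[OF max_\<Q>[OF Q]]] .
  ultimately have "module_prod (local_part R Q L) (local_part R Q Q) = (*) a ` local_part R Q Q"
    using domain_subring.scale_self[OF V] by simp
  moreover have "a \<noteq> 0" using ab(3) by auto
  ultimately show ?thesis using local_t_closure_prod[OF Q nz(1) nz_J] local_J[OF Q] by auto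
qed

text \<open>A separating set for \<open>Q\<close> trivializes the conditions at all other \<open>t\<close>-maximal ideals.\<close>

lemma principal_local_colon:
  assumes A: "t_ideal R A" and Q: "Q \<in> \<Q>" and eq: "local_part R Q A = (*) x ` local_part R Q Q"
  shows "\<exists>u\<in>R - Q. u * x \<in> colon A J"
proof -
  note pQ = prime_\<Q>[OF Q] and nzA = t_ideal_nz[OF A]
  obtain C where C: "finite C" "C \<subseteq> Q" "\<And>N. t_maximal R N \<Longrightarrow> N \<noteq> Q \<Longrightarrow> \<not> C \<subseteq> N"
    using separating_set[OF max_\<Q>[OF Q]] by blast
  have "(*) x ` C \<subseteq> local_part R Q A"
    unfolding eq using C(2) subset_local_part[OF pQ] by blast
  then have "\<exists>u\<in>R - Q. \<forall>s\<in>(*) x ` C. u * s \<in> A"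
    using C(1) nzA by (intro finite_local_part[OF pQ]) auto
  then obtain u where u: "u \<in> R - Q" "\<And>c. c \<in> C \<Longrightarrow> u * (x * c) \<in> A" by blast
  have "u * x * j \<in> A" if j: "j \<in> J" for j
  proof (rule t_ideal_mem_local[OF A])
    fix N assume N: "t_maximal R N"
    show "u * x * j \<in> local_part R N A"
    proof (cases "N = Q")
      case True
      have "j \<in> local_part R Q Q" using j Q J_eq subset_local_part[OF pQ] by blast
      then have "x * j \<in> local_part R Q A" unfolding eq by blast
      moreover have "u \<in> localize R Q" using u(1) localize_superset[OF pQ] by blast
      ultimately have "u * (x * j) \<in> local_part R Q A"
        using local_stable[OF pQ] nzA by blast
      then show ?thesis using True by (simp add: mult.assoc)
    next
      case False
      \<comment> \<open>Since u x c lies in A and j in R, the element c outside N is itself a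
        denominator of u x j.\<close>
      obtain c where c: "c \<in> C" "c \<notin> N" using C(3)[OF N False] by blast
      have "j * (u * (x * c)) \<in> A"
        using submodule_ofD(3)[of R A j] nzA u(2)[OF c(1)] j J_subset by blast
      moreover have "c \<in> R - N" using c C(2) t_maximalD(3)[OF max_\<Q>[OF Q]] by blast
      ultimately show ?thesis by (intro local_partI[of c]) (auto simp: ac_simps)
    qed
  qed
  then show ?thesis using u(1) by (auto simp: colon_def)
qed

text \<open>Exactness in the middle. The product of (A : J) and (B : J) carries J J into A B, hence
  J into J, and so lies in R. At Q it contains a product of multiples of x and
  \<open>inverse x\<close> by elements outside Q, hence an element outside Q. At any other t-maximal
  N it contains A B, whose t-closure J is not inside N.\<close>

lemma locally_principal_imp_Inv_t_mult:
  assumes A: "A \<in> constituent_ideals R J"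
    and loc: "\<And>Q. Q \<in> \<Q> \<Longrightarrow> \<exists>x. x \<noteq> 0 \<and> local_part R Q A = (*) x ` local_part R Q Q"
  shows "\<exists>L L'. t_ideal R L \<and> t_ideal R L' \<and> t_closure R (module_prod L L') = R
    \<and> t_closure R (module_prod L J) = A"
proof -
  obtain B where B: "t_ideal R A" "t_closure R (module_prod A J) = A" "t_ideal R B"
    "t_closure R (module_prod B J) = B" "t_closure R (module_prod A B) = J"
    using A by (auto simp: constituent_ideals_def)
  let ?L = "colon A J" and ?L' = "colon B J"
  have fJ: "fractional_ideal R J" using t_ideal_J by (simp add: t_ideal_def)
  have L: "t_ideal R ?L" "t_ideal R ?L'" using t_ideal_colon[OF _ fJ] B by blast+
  note nz = t_ideal_nz[OF B(1)] t_ideal_nz[OF B(3)] t_ideal_nz[OF L(1)] t_ideal_nz[OF L(2)]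
  have AB: "module_prod A B \<subseteq> J"
    using t_closure_extensive[OF nz_submodule_module_prod[OF nz(1,2)]] B(5) by simp
  have AL: "A \<subseteq> ?L"
    using t_closure_extensive[OF nz_submodule_module_prod[OF nz(1) nz_J]] B(2) module_prodI[of _ A _ J]
    unfolding colon_def by blast
  have BL: "B \<subseteq> ?L'"
    using t_closure_extensive[OF nz_submodule_module_prod[OF nz(2) nz_J]] B(4) module_prodI[of _ B _ J]
    unfolding colon_def by blast
  have sub: "module_prod ?L ?L' \<subseteq> R"
  proof (rule module_prod_subset[OF submodule_self])
    fix l l' assume l: "l \<in> ?L" "l' \<in> ?L'"
    have "l * l' * z \<in> J" if z: "z \<in> J" for z
    proof (cases "l * l' = 0")
      case True
      then show ?thesis using submodule_ofD(1) nz_J by auto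
    next
      case False
      have "(*) (l * l') ` module_prod J J \<subseteq> J"
      proof -
        have "module_prod J J \<subseteq> {z. z * (l * l') \<in> J}"
        proof (rule module_prod_subset[OF submodule_of_preimage])
          show "submodule_of R J" using nz_J by blast
          fix a b assume "a \<in> J" "b \<in> J"
          then have "(l * a) * (l' * b) \<in> module_prod A B"
            using l by (intro module_prodI) (auto simp: colon_def)
          then show "a * b \<in> {z. z * (l * l') \<in> J}" using AB by (auto simp: ac_simps)
        qed
        then show ?thesis by (auto simp: mult.commute[of _ "l * l'"])
      qed
      then have "t_closure R ((*) (l * l') ` module_prod J J) \<subseteq> J"
        by (rule t_closure_least[OF t_ideal_J])
      then have "(*) (l * l') ` J \<subseteq> J"
        using t_closure_scale[OF nz_submodule_module_prod[OF nz_J nz_J] False] J_idem by simp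
      then show ?thesis using z by blast
    qed
    then show "l * l' \<in> R" using colon_J by (auto simp: colon_def)
  qed
  have nzLL: "nz_submodule R (module_prod ?L ?L')" by (rule nz_submodule_module_prod[OF nz(3,4)])
  have not_sub: "\<not> module_prod ?L ?L' \<subseteq> N" if N: "t_maximal R N" for N
  proof (cases "N \<in> \<Q>")
    case True
    note Q = True
    note pQ = prime_\<Q>[OF Q]
    have sQ: "submodule_of (localize R N) (local_part R N N)"
      using submodule_local_part[OF pQ t_maximalD(2)[OF N]] .
    obtain x where x: "x \<noteq> 0" "local_part R N A = (*) x ` local_part R N N" using loc[OF Q] by blast
    \<comment> \<open>With E the localization of N, E = A B = x E B = x B locally, since B absorbs
      E. So B is locally \<open>inverse x\<close> times E.\<close>
    have "local_part R N N = module_prod (local_part R N A) (local_part R N B)"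
      using local_t_closure_prod[OF Q nz(1,2)] B(5) local_J[OF Q] by simp
    also have "\<dots> = (*) x ` module_prod (local_part R N N) (local_part R N B)"
      unfolding x(2) module_prod_scale ..
    also have "module_prod (local_part R N N) (local_part R N B) = local_part R N B"
      using local_t_closure_prod[OF Q nz(2) nz_J] B(4) local_J[OF Q] by (simp add: module_prod_commute)
    finally have "local_part R N B = (*) (inverse x) ` local_part R N N"
      using x(1) by (simp add: scale_scale)
    then obtain u' where u': "u' \<in> R - N" "u' * inverse x \<in> ?L'"
      using principal_local_colon[OF B(3) Q] by blast
    obtain u where u: "u \<in> R - N" "u * x \<in> ?L"
      using principal_local_colon[OF B(1) Q x(2)] by blast
    have "u * x * (u' * inverse x) \<in> module_prod ?L ?L'" using u u' by (intro module_prodI)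
    moreover have "u * x * (u' * inverse x) = u * u'" using x(1) by (simp add: field_simps)
    moreover have "u * u' \<in> R - N" using compl_mult[OF pQ] u u' by blast
    ultimately show ?thesis by auto
  next
    case False
    show ?thesis
    proof
      assume "module_prod ?L ?L' \<subseteq> N"
      then have "module_prod A B \<subseteq> N" using module_prod_mono[OF AL BL] by blast
      then have "J \<subseteq> N" using t_closure_least[OF t_maximalD(1)[OF N]] B(5) by metis
      then show False using J_not_subset[OF N False] by blast
    qed
  qed
  have tLL: "t_closure R (module_prod ?L ?L') = R"
  proof
    show sub': "t_closure R (module_prod ?L ?L') \<subseteq> R" by (rule t_closure_least[OF t_ideal_self sub])
    have "1 \<in> t_closure R (module_prod ?L ?L')"
      using not_sub by (intro one_mem_t_closure[OF nzLL sub])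
    then show "R \<subseteq> t_closure R (module_prod ?L ?L')"
      using submodule_ofD(3)[of R "t_closure R (module_prod ?L ?L')" _ 1] nz_submodule_t_closure[OF nzLL]
      by auto
  qed
  have "t_closure R (module_prod ?L J) = A"
  proof
    have sA: "submodule_of R A" using nz by blast
    have "module_prod ?L J \<subseteq> A"
      by (rule module_prod_subset[OF sA]) (auto simp: colon_def)
    then show "t_closure R (module_prod ?L J) \<subseteq> A" by (rule t_closure_least[OF B(1)])
    have sJ: "submodule_of R J" using nz_J by blast
    \<comment> \<open>A L' lies in J, because A is the t-closure of A J and J L' lies in B.
      Multiplying by L and using (L L')_t = R places A in (L J)_t.\<close>
    have "module_prod A ?L' = module_prod (t_closure R (module_prod A J)) ?L'" using B(2) by simp
    also have "\<dots> \<subseteq> t_closure R (module_prod (module_prod A J) ?L')"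
      by (rule module_prod_t_closure_subset[OF nz_submodule_module_prod[OF nz(1) nz_J] nz(4)])
    also have "\<dots> \<subseteq> J"
    proof (rule t_closure_least[OF t_ideal_J])
      have "module_prod J ?L' \<subseteq> B"
        using nz(2) by (intro module_prod_subset[of R B]) (auto simp: colon_def mult.commute)
      then show "module_prod (module_prod A J) ?L' \<subseteq> J"
        using module_prod_mono[of A A "module_prod J ?L'" B] AB by (auto simp: module_prod_assoc)
    qed
    finally have "module_prod ?L (module_prod A ?L') \<subseteq> module_prod ?L J"
      by (intro module_prod_mono) auto
    then have "t_closure R (module_prod A (module_prod ?L ?L')) \<subseteq> t_closure R (module_prod ?L J)"
      by (intro t_closure_mono) (simp add: module_prod_left_commute)
    moreover have "t_closure R (module_prod A (module_prod ?L ?L')) = A"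
      using t_closure_prod_right[OF nz(1) nzLL] tLL module_prod_unit_right[OF sA one_mem] B(1)
      by (simp add: t_ideal_def)
    ultimately show "A \<subseteq> t_closure R (module_prod ?L J)" by simp
  qed
  then show ?thesis using L tLL by blast
qed

end

section \<open>Gluing local modules to a constituent ideal\<close>

context idempotent_intersection
begin

lemma local_Q_Int: "Q \<in> \<Q> \<Longrightarrow> local_part R Q Q \<inter> R \<subseteq> Q"
  using prime_inD(4)[OF prime_\<Q>] by (auto simp: local_part_def)

text \<open>Take c in C dividing all of C over R_Q and factor it as c = a b with a in A and b in B.
  Then b A contains c, hence C, and it lies in A B, the localization of Q.\<close>

lemma normalize_local:
  assumes Q: "Q \<in> \<Q>" and A: "fractional_ideal (localize R Q) A" "fractional_ideal (localize R Q) B"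
    and AB: "module_prod A B = local_part R Q Q"
    and C: "finite C" "C \<subseteq> Q" "\<not> C \<subseteq> {0}"
  shows "\<exists>b. b \<noteq> 0 \<and> C \<subseteq> (*) b ` A \<and> (*) b ` A \<subseteq> local_part R Q Q"
proof -
  let ?V = "localize R Q"
  note pQ = prime_\<Q>[OF Q] and val = valuation_localize[OF max_\<Q>[OF Q]]
  have sub: "submodule_of ?V A" "submodule_of ?V B" using A by (simp_all add: fractional_ideal_def)
  obtain c where c: "c \<in> C" "c \<noteq> 0" "\<forall>s\<in>C. s / c \<in> ?V"
    using finite_generator[OF pQ val C(1,3)] by blast
  have "c \<in> module_prod A B" using c(1) C(2) subset_local_part[OF pQ] AB by blast
  then obtain a b where ab: "a \<in> A" "b \<in> B" "c = a * b"
    using valuation_prod_mem[OF val sub] by blast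
  have "s \<in> (*) b ` A" if s: "s \<in> C" for s
  proof -
    have "s / c * a \<in> A" using submodule_ofD(3)[OF sub(1)] c(3) s ab(1) by blast
    moreover have "s = b * (s / c * a)" using ab(3) c(2) by (auto simp: field_simps)
    ultimately show ?thesis by blast
  qed
  moreover have "(*) b ` A \<subseteq> local_part R Q Q"
    using module_prodI[OF _ ab(2), of _ A] AB by (auto simp: mult.commute)
  ultimately show ?thesis using ab(3) c(2) by (intro exI[of _ b]) auto
qed

text \<open>The ideal is the intersection of \<open>R\<close> with the given local modules. The sets \<open>C Q\<close> keep the
  conditions at different \<open>Q\<close> independent, even when the valuation rings have common overrings, and
  make the intersection trivial at all other \<open>t\<close>-maximal ideals.\<close>

lemma constituent_ideal_of_local:
  assumes A: "\<And>Q. Q \<in> \<Q> \<Longrightarrow> submodule_of (localize R Q) (A Q)"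
    and AQ: "\<And>Q. Q \<in> \<Q> \<Longrightarrow> module_prod (A Q) (local_part R Q Q) = A Q"
    and AB: "\<And>Q. Q \<in> \<Q> \<Longrightarrow> module_prod (A Q) (B Q) = local_part R Q Q"
    and sub: "\<And>Q. Q \<in> \<Q> \<Longrightarrow> A Q \<subseteq> local_part R Q Q"
    and C: "\<And>Q. Q \<in> \<Q> \<Longrightarrow> finite (C Q) \<and> C Q \<subseteq> Q \<and> \<not> C Q \<subseteq> {0} \<and> C Q \<subseteq> A Q"
    and sep: "\<And>Q N. Q \<in> \<Q> \<Longrightarrow> t_maximal R N \<Longrightarrow> N \<noteq> Q \<Longrightarrow> \<not> C Q \<subseteq> N"
  shows "\<exists>L\<in>constituent_ideals R J. \<forall>Q\<in>\<Q>. local_part R Q L = A Q"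
proof -
  define L where "L = R \<inter> (\<Inter>Q\<in>\<Q>. A Q)"
  have AR: "submodule_of R (A Q)" if "Q \<in> \<Q>" for Q
    using submodule_of_subring[OF A[OF that] localize_superset[OF prime_\<Q>[OF that]]] .
  have Ls: "submodule_of R L"
    unfolding L_def using AR by (intro submodule_of_Int submodule_self submodule_Inter) blast
  have LJ: "L \<subseteq> J"
    unfolding L_def J_eq using sub local_Q_Int by blast
  have LR: "L \<subseteq> R" unfolding L_def by blast
  \<comment> \<open>For Q \<noteq> N the set C Q puts into A Q an element outside N. The product of
    these elements lies in all A Q with Q \<noteq> N and becomes a unit at N.\<close>
  have avoid: "\<exists>d\<in>R - N. \<forall>Q\<in>\<Q> - {N}. d \<in> A Q" if N: "t_maximal R N" for N
  proof (rule exists_common_avoiding[OF prime_t_maximal[OF N]])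
    show "finite (\<Q> - {N})" using finite_\<Q> by simp
    fix Q assume Q: "Q \<in> \<Q> - {N}"
    then show "submodule_of R (A Q)" using AR by blast
    obtain c where "c \<in> C Q" "c \<notin> N" using sep[of Q N] N Q by blast
    moreover have "C Q \<subseteq> R" using C[of Q] Q t_maximalD(3)[OF max_\<Q>] by blast
    ultimately show "\<exists>d\<in>A Q. d \<in> R - N" using C[of Q] Q by blast
  qed
  have L_not: "\<exists>d\<in>L. d \<in> R - N" if N: "t_maximal R N" "N \<notin> \<Q>" for N
    using avoid[OF N(1)] N(2) unfolding L_def by blast
  have locL: "local_part R Q L = A Q" if Q: "Q \<in> \<Q>" for Q
  proof
    note pQ = prime_\<Q>[OF Q]
    show "local_part R Q L \<subseteq> A Q"
    proof
      fix x assume "x \<in> local_part R Q L"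
      then obtain u where u: "u \<in> R - Q" "u * x \<in> L" by (auto simp: local_part_def)
      have "inverse u \<in> localize R Q"
        using u(1) one_mem by (auto simp: localize_def inverse_eq_divide)
      moreover have "u * x \<in> A Q" using u(2) Q unfolding L_def by blast
      ultimately have "inverse u * (u * x) \<in> A Q" using submodule_ofD(3)[OF A[OF Q]] by blast
      then show "x \<in> A Q" using compl_nonzero[OF pQ u(1)] by (simp add: mult.assoc[symmetric])
    qed
    show "A Q \<subseteq> local_part R Q L"
    proof
      fix a assume a: "a \<in> A Q"
      then obtain u where u: "u \<in> R - Q" "u * a \<in> Q" using sub[OF Q] by (auto simp: local_part_def)
      have uaR: "u * a \<in> R" using u(2) t_maximalD(3)[OF max_\<Q>[OF Q]] by blast
      obtain d where d: "d \<in> R - Q" "\<And>N. N \<in> \<Q> - {Q} \<Longrightarrow> d \<in> A N" using avoid[OF max_\<Q>[OF Q]] by blast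
      have du: "d * u \<in> R - Q" by (rule compl_mult[OF pQ d(1) u(1)])
      have "d * u * a \<in> A N" if N: "N \<in> \<Q>" for N
      proof (cases "N = Q")
        case True
        then show ?thesis using submodule_ofD(3)[OF AR[OF Q] _ a, of "d * u"] du by blast
      next
        case False
        then have "(u * a) * d \<in> A N" using submodule_ofD(3)[OF AR[OF N] uaR] d(2) N by blast
        then show ?thesis by (simp add: ac_simps)
      qed
      moreover have "d * u * a \<in> R" using mult_mem[OF _ uaR, of d] d(1) by (simp add: mult.assoc)
      ultimately show "a \<in> local_part R Q L"
        unfolding L_def by (intro local_partI[OF du]) blast
    qed
  qed
  have "L \<noteq> {0}"
  proof
    assume L0: "L = {0}"
    obtain Q where Q: "Q \<in> \<Q>" using nonempty_\<Q> by blast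
    have "local_part R Q L \<subseteq> {0}"
      unfolding L0 using compl_nonzero[OF prime_\<Q>[OF Q]] by (auto simp: local_part_def)
    then show False using locL[OF Q] C[OF Q] by blast
  qed
  then have nzL: "nz_submodule R L" using Ls by blast
  have fL: "fractional_ideal R L" by (rule fractional_subset[OF fractional_self nzL LR])
  have "t_closure R L \<subseteq> L"
  proof
    fix x assume x: "x \<in> t_closure R L"
    have "x \<in> A Q" if "Q \<in> \<Q>" for Q
      using t_closure_local[OF nzL x max_\<Q>[OF that]] locL[OF that] by simp
    moreover have "x \<in> R" using t_closure_least[OF t_ideal_self LR] x by blast
    ultimately show "x \<in> L" unfolding L_def by blast
  qed
  then have tL: "t_ideal R L"
    using fL t_closure_extensive[OF nzL] by (auto simp: t_ideal_def)
  \<comment> \<open>The prospective inverse of L. Its localizations are not determined exactly; that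
    they contain the modules B N is enough to recover J.\<close>
  define K where "K = colon J L"
  have tK: "t_ideal R K" unfolding K_def by (rule t_ideal_colon[OF t_ideal_J fL])
  note nzK = t_ideal_nz[OF tK]
  have nzLK: "nz_submodule R (module_prod L K)" by (rule nz_submodule_module_prod[OF nzL nzK])
  have Js: "submodule_of R J" using nz_J by blast
  have LK: "t_closure R (module_prod L K) = J"
  proof
    show "t_closure R (module_prod L K) \<subseteq> J"
      by (rule t_closure_least[OF t_ideal_J], rule module_prod_subset[OF Js])
        (auto simp: K_def colon_def mult.commute)
    show "J \<subseteq> t_closure R (module_prod L K)"
    proof
      fix j assume j: "j \<in> J"
      show "j \<in> t_closure R (module_prod L K)"
      proof (rule mem_t_closure_local[OF nzLK])
        fix N assume N: "t_maximal R N"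
        note pN = prime_t_maximal[OF N]
        show "j \<in> local_part R N (module_prod L K)"
        proof (cases "N \<in> \<Q>")
          case False
          then obtain d where d: "d \<in> L" "d \<in> R - N" using L_not N by blast
          have "j * l \<in> J" if "l \<in> L" for l
            using submodule_ofD(3)[OF Js, of l j] LR that j by (auto simp: mult.commute)
          then have "j \<in> K" by (simp add: K_def colon_def)
          then show ?thesis using d by (intro local_partI[OF d(2)] module_prodI)
        next
          case True
          \<comment> \<open>The finite set C N gives one u outside N with u \<beta> C N \<subseteq>
            N. Then u \<beta> L \<subseteq> J: at N because \<beta> carries A N into the
            localization of N, and at any other M because some c in C N outside M satisfies u
            \<beta> c \<in> R and so serves as a denominator.\<close>
          have BK: "B N \<subseteq> local_part R N K"
          proof
            fix \<beta> assume \<beta>: "\<beta> \<in> B N"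
            have prod: "a * \<beta> \<in> local_part R N N" if "a \<in> A N" for a
              using module_prodI[OF that \<beta>] AB[OF True] by simp
            have "(*) \<beta> ` C N \<subseteq> local_part R N N"
              using prod C[OF True] by (auto simp: mult.commute)
            then have "\<exists>u\<in>R - N. \<forall>s\<in>(*) \<beta> ` C N. u * s \<in> N"
              using C[OF True] by (intro finite_local_part[OF pN t_maximalD(2)[OF N]]) auto
            then obtain u where u: "u \<in> R - N" "\<And>c. c \<in> C N \<Longrightarrow> u * (\<beta> * c) \<in> N" by blast
            have "u * \<beta> * l \<in> J" if l: "l \<in> L" for l
            proof (rule t_ideal_mem_local[OF t_ideal_J])
              fix M assume M: "t_maximal R M"
              show "u * \<beta> * l \<in> local_part R M J"
              proof (cases "M = N")
                case eq: True
                have "l \<in> A N" using l True unfolding L_def by blast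
                then have "u * (l * \<beta>) \<in> local_part R N N"
                  using u(1) localize_superset[OF pN] prod
                    local_stable[OF pN t_maximalD(2)[OF N], of u "l * \<beta>"] by blast
                then show ?thesis using local_J[OF True] eq by (simp add: ac_simps)
              next
                case False
                then obtain c where c: "c \<in> C N" "c \<notin> M" using sep[OF True M] by blast
                have cR: "c \<in> R" using c(1) C[OF True] t_maximalD(3)[OF N] by blast
                have "u * (\<beta> * c) \<in> R" using u(2)[OF c(1)] t_maximalD(3)[OF N] by blast
                then have "u * (\<beta> * c) * l \<in> J" using submodule_ofD(3)[OF Js] l LJ by blast
                then show ?thesis using c(2) cR by (intro local_partI[of c]) (auto simp: ac_simps)
              qed
            qed
            then have "u * \<beta> \<in> K" by (simp add: K_def colon_def)
            then show "\<beta> \<in> local_part R N K" by (rule local_partI[OF u(1)])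
          qed
          have "j \<in> local_part R N N" using j True J_eq subset_local_part[OF pN] by blast
          then have "j \<in> module_prod (local_part R N L) (local_part R N K)"
            using AB[OF True] locL[OF True] module_prod_mono[OF subset_refl BK, of "A N"] by auto
          then show ?thesis using local_part_module_prod[OF pN Ls] nzK by simp
        qed
      qed
    qed
  qed
  \<comment> \<open>L and K are multiplied by J so that both absorb it. The localization of L at Q
    is unchanged, since A Q already absorbs Q R_Q.\<close>
  let ?L = "t_closure R (module_prod L J)"
  have "?L \<in> constituent_ideals R J"
  proof -
    interpret F: comm_monoid "F_t R" by (rule comm_monoid_F_t)
    have car: "L \<in> carrier (F_t R)" "K \<in> carrier (F_t R)" "J \<in> carrier (F_t R)"
      using tL tK t_ideal_J by (simp_all add: F_t_simps)
    have JJ: "J \<otimes>\<^bsub>F_t R\<^esub> J = J" and LK': "L \<otimes>\<^bsub>F_t R\<^esub> K = J"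
      using LK J_idem by (simp_all add: F_t_simps)
    have 1: "X \<otimes>\<^bsub>F_t R\<^esub> J \<otimes>\<^bsub>F_t R\<^esub> J = X \<otimes>\<^bsub>F_t R\<^esub> J" if "X \<in> carrier (F_t R)" for X
      using that car JJ by (simp add: F.m_assoc)
    have "L \<otimes>\<^bsub>F_t R\<^esub> J \<otimes>\<^bsub>F_t R\<^esub> (K \<otimes>\<^bsub>F_t R\<^esub> J)
        = L \<otimes>\<^bsub>F_t R\<^esub> K \<otimes>\<^bsub>F_t R\<^esub> (J \<otimes>\<^bsub>F_t R\<^esub> J)"
      using car by (simp add: F.m_ac)
    then have "L \<otimes>\<^bsub>F_t R\<^esub> J \<otimes>\<^bsub>F_t R\<^esub> (K \<otimes>\<^bsub>F_t R\<^esub> J) = J" using JJ LK' by simp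
    then show ?thesis
      using 1[OF car(1)] 1[OF car(2)] F.m_closed[OF car(1,3)] F.m_closed[OF car(2,3)]
      unfolding constituent_ideals_def F_t_simps by blast
  qed
  moreover have "local_part R Q ?L = A Q" if "Q \<in> \<Q>" for Q
    using local_t_closure_prod[OF that nzL nz_J] locL[OF that] local_J[OF that] AQ[OF that] by simp
  ultimately show ?thesis by blast
qed

text \<open>Only the classes are prescribed, so each A Q may first be scaled to contain C Q and to
  lie inside the localization of Q; its partner is scaled inversely.\<close>

lemma constituent_ideal_surj:
  assumes A: "\<And>Q. Q \<in> \<Q> \<Longrightarrow> fractional_ideal (localize R Q) (A Q)"
    and AQ: "\<And>Q. Q \<in> \<Q> \<Longrightarrow> module_prod (A Q) (local_part R Q Q) = A Q"
    and inv: "\<And>Q. Q \<in> \<Q> \<Longrightarrow>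
      \<exists>B. fractional_ideal (localize R Q) B \<and> module_prod (A Q) B = local_part R Q Q"
  shows "\<exists>L\<in>constituent_ideals R J. \<forall>Q\<in>\<Q>. scale_class (local_part R Q L) = scale_class (A Q)"
proof -
  have "\<forall>Q\<in>\<Q>. \<exists>B. fractional_ideal (localize R Q) B \<and> module_prod (A Q) B = local_part R Q Q"
    using inv by blast
  then obtain B where B: "\<And>Q. Q \<in> \<Q> \<Longrightarrow> fractional_ideal (localize R Q) (B Q)"
    "\<And>Q. Q \<in> \<Q> \<Longrightarrow> module_prod (A Q) (B Q) = local_part R Q Q" by metis
  have "\<forall>Q\<in>\<Q>. \<exists>C. finite C \<and> C \<subseteq> Q \<and> \<not> C \<subseteq> {0} \<and> (\<forall>N. t_maximal R N \<longrightarrow> N \<noteq> Q \<longrightarrow> \<not> C \<subseteq> N)"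
    using separating_set[OF max_\<Q>] by blast
  then obtain C where C: "\<And>Q. Q \<in> \<Q> \<Longrightarrow> finite (C Q)" "\<And>Q. Q \<in> \<Q> \<Longrightarrow> C Q \<subseteq> Q"
    "\<And>Q. Q \<in> \<Q> \<Longrightarrow> \<not> C Q \<subseteq> {0}" "\<And>Q N. Q \<in> \<Q> \<Longrightarrow> t_maximal R N \<Longrightarrow> N \<noteq> Q \<Longrightarrow> \<not> C Q \<subseteq> N"
    by metis
  have "\<forall>Q\<in>\<Q>. \<exists>b. b \<noteq> 0 \<and> C Q \<subseteq> (*) b ` A Q \<and> (*) b ` A Q \<subseteq> local_part R Q Q"
  proof
    fix Q assume Q: "Q \<in> \<Q>"
    show "\<exists>b. b \<noteq> 0 \<and> C Q \<subseteq> (*) b ` A Q \<and> (*) b ` A Q \<subseteq> local_part R Q Q"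
      by (rule normalize_local[OF Q A[OF Q] B[OF Q] C(1-3)[OF Q]])
  qed
  then obtain b where b: "\<And>Q. Q \<in> \<Q> \<Longrightarrow> b Q \<noteq> 0" "\<And>Q. Q \<in> \<Q> \<Longrightarrow> C Q \<subseteq> (*) (b Q) ` A Q"
    "\<And>Q. Q \<in> \<Q> \<Longrightarrow> (*) (b Q) ` A Q \<subseteq> local_part R Q Q" by metis
  have "\<exists>L\<in>constituent_ideals R J. \<forall>Q\<in>\<Q>. local_part R Q L = (*) (b Q) ` A Q"
  proof (rule constituent_ideal_of_local[where C = C and B = "\<lambda>Q. (*) (inverse (b Q)) ` B Q"])
    fix Q assume Q: "Q \<in> \<Q>"
    show "submodule_of (localize R Q) ((*) (b Q) ` A Q)"
      using A[OF Q] by (intro submodule_of_scale) (simp add: fractional_ideal_def)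
    show "module_prod ((*) (b Q) ` A Q) (local_part R Q Q) = (*) (b Q) ` A Q"
      using AQ[OF Q] by (simp add: module_prod_scale)
    show "module_prod ((*) (b Q) ` A Q) ((*) (inverse (b Q)) ` B Q) = local_part R Q Q"
      using B(2)[OF Q] b(1)[OF Q] by (simp add: scale_prod)
    show "(*) (b Q) ` A Q \<subseteq> local_part R Q Q" by (rule b(3)[OF Q])
    show "finite (C Q) \<and> C Q \<subseteq> Q \<and> \<not> C Q \<subseteq> {0} \<and> C Q \<subseteq> (*) (b Q) ` A Q"
      using C(1-3)[OF Q] b(2)[OF Q] by blast
  qed (rule C(4))
  then obtain L where "L \<in> constituent_ideals R J" "\<And>Q. Q \<in> \<Q> \<Longrightarrow> local_part R Q L = (*) (b Q) ` A Q"
    by blast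
  then show ?thesis using b(1) by (intro bexI[of _ L]) (simp_all add: scale_class_scale)
qed

end

section \<open>The exact sequence\<close>

text \<open>The multiplier ring is thus constant on a class, so a multiple J of I still has
  \<open>colon J J\<close> equal to T.\<close>

lemma colon_scale:
  fixes c :: "'k::field"
  assumes "c \<noteq> 0"
  shows "colon ((*) c ` A) ((*) c ` B) = colon A B"
proof -
  have "c * z \<in> (*) c ` A \<longleftrightarrow> z \<in> A" for z using assms by (auto simp: image_iff)
  then have "x * (c * b) \<in> (*) c ` A \<longleftrightarrow> x * b \<in> A" for x b
    by (metis mult.left_commute)
  then show ?thesis by (simp add: colon_def)
qed

lemma constituent_mult [simp]: "mult (constituent_group S e) = mult S"
  and constituent_one [simp]: "one (constituent_group S e) = e"
  by (simp_all add: constituent_group_def)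

context krull_domain
begin

lemma domain_colon:
  assumes I: "t_ideal R I"
  shows "domain_in (colon I I)"
proof -
  have Is: "submodule_of R I" using t_ideal_nz[OF I] by blast
  have RT: "R \<subseteq> colon I I" using submodule_ofD(3)[OF Is] by (auto simp: colon_def)
  have "x - y \<in> colon I I" if "x \<in> colon I I" "y \<in> colon I I" for x y
    using that submodule_diff[OF Is] by (auto simp: colon_def left_diff_distrib)
  moreover have "x * y \<in> colon I I" if "x \<in> colon I I" "y \<in> colon I I" for x y
    using that by (auto simp: colon_def mult.assoc)
  moreover have "\<exists>a\<in>colon I I. \<exists>b\<in>colon I I. b \<noteq> 0 \<and> z = a / b" for z
  proof -
    obtain d where "d \<in> R" "d \<noteq> 0" "d * z \<in> R" using denominator by blast
    moreover from this have "z = d * z / d" by simp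
    ultimately show ?thesis using RT by blast
  qed
  ultimately show ?thesis using one_mem RT unfolding domain_in_def by blast
qed

end

section \<open>Comparison of the groups over R and over T\<close>

context krull_overring
begin

lemma t_ideal_R: "t_ideal T A \<Longrightarrow> t_ideal R A"
  using t_ideal_iff by blast

lemma t_closure_prod_eq:
  assumes "nz_submodule T A" "nz_submodule S B"
  shows "t_closure R (module_prod A B) = t_closure T (module_prod A B)"
  using t_closure_eq[OF nz_submodule_module_prod[OF assms]] by simp

text \<open>A t-ideal A of R with (A J)_t = A is a T-module, because A J is one and its closures
  over R and T agree. Hence the constituent group of the t-class semigroup of R can be computed over
  T.\<close>

lemma constituent_ideals_eq:
  assumes J: "t_ideal T J"
  shows "constituent_ideals R J = constituent_ideals T J"
proof -
  note nzJ = T.t_ideal_nz[OF J]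
  have absorb: "t_closure R (module_prod A J) = t_closure T (module_prod A J)" if "t_ideal R A" for A
    using t_closure_prod_eq[OF nzJ R.t_ideal_nz[OF that]] by (simp add: module_prod_commute)
  have up: "t_ideal T A" if A: "t_ideal R A" "t_closure R (module_prod A J) = A" for A
  proof -
    have "nz_submodule T (module_prod A J)"
      using nz_submodule_module_prod[OF nzJ R.t_ideal_nz[OF A(1)]] by (simp add: module_prod_commute)
    then have "submodule_of T A"
      using T.nz_submodule_t_closure absorb[OF A(1)] A(2) by metis
    then show ?thesis using t_ideal_iff A(1) by blast
  qed
  show ?thesis
  proof
    show "constituent_ideals R J \<subseteq> constituent_ideals T J"
    proof
      fix A assume "A \<in> constituent_ideals R J"
      then obtain B where A: "t_ideal R A" "t_closure R (module_prod A J) = A"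
        and B: "t_ideal R B" "t_closure R (module_prod B J) = B" and AB: "t_closure R (module_prod A B) = J"
        by (auto simp: constituent_ideals_def)
      have "t_closure T (module_prod A B) = J"
        using AB t_closure_prod_eq[OF T.t_ideal_nz[OF up[OF A]] T.t_ideal_nz[OF up[OF B]]] by simp
      then show "A \<in> constituent_ideals T J"
        using up[OF A] up[OF B] absorb[OF A(1)] absorb[OF B(1)] A(2) B(2)
        unfolding constituent_ideals_def by auto
    qed
    show "constituent_ideals T J \<subseteq> constituent_ideals R J"
    proof
      fix A assume "A \<in> constituent_ideals T J"
      then obtain B where A: "t_ideal T A" "t_closure T (module_prod A J) = A"
        and B: "t_ideal T B" "t_closure T (module_prod B J) = B" and AB: "t_closure T (module_prod A B) = J"
        by (auto simp: constituent_ideals_def)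
      have "t_closure R (module_prod A B) = J"
        using AB t_closure_prod_eq[OF T.t_ideal_nz[OF A(1)] T.t_ideal_nz[OF B(1)]] by simp
      then show "A \<in> constituent_ideals R J"
        using t_ideal_R[OF A(1)] t_ideal_R[OF B(1)] absorb A(2) B(2)
        unfolding constituent_ideals_def by auto
    qed
  qed
qed

lemma J_idem_R:
  "t_ideal T J \<Longrightarrow> t_closure T (module_prod J J) = J \<Longrightarrow> t_closure R (module_prod J J) = J"
  using t_closure_prod_eq[OF T.t_ideal_nz T.t_ideal_nz] by simp

lemma constituent_class_carrier:
  assumes J: "t_ideal T J" "t_closure T (module_prod J J) = J"
  shows "carrier (constituent_group (t_class_semigroup R) (scale_class J))
    = scale_class ` constituent_ideals T J"
proof -
  interpret F: ideal_classes "F_t R" "t_class_semigroup R" by (rule R.t_ideal_classes)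
  have "carrier (constituent_group (t_class_semigroup R) (scale_class J))
    = scale_class ` constituent_ideals R J"
    using F.class_constituent[of J] t_ideal_R[OF J(1)] J_idem_R[OF J]
    unfolding R.F_t_simps constituent_ideals_def by simp
  then show ?thesis using constituent_ideals_eq[OF J(1)] by simp
qed

lemma constituent_classD:
  assumes J: "t_ideal T J" "t_closure T (module_prod J J) = J"
    and L: "t_ideal R L" "scale_class L \<in> carrier (constituent_group (t_class_semigroup R) (scale_class J))"
  shows "L \<in> constituent_ideals T J"
proof -
  interpret F: ideal_classes "F_t R" "t_class_semigroup R" by (rule R.t_ideal_classes)
  have "L \<in> constituent_ideals R J"
    using F.class_constituentD[of J L] t_ideal_R[OF J(1)] J_idem_R[OF J] L
    unfolding R.F_t_simps constituent_ideals_def by simp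
  then show ?thesis using constituent_ideals_eq[OF J(1)] by simp
qed

lemma comm_group_constituent_class:
  assumes J: "t_ideal T J" "t_closure T (module_prod J J) = J"
  shows "comm_group (constituent_group (t_class_semigroup R) (scale_class J))"
proof -
  interpret F: ideal_classes "F_t R" "t_class_semigroup R" by (rule R.t_ideal_classes)
  have "scale_class J \<in> carrier (t_class_semigroup R)"
    using t_ideal_R[OF J(1)] F.class_carrier by (simp add: R.F_t_simps)
  moreover have "scale_class J \<otimes>\<^bsub>t_class_semigroup R\<^esub> scale_class J = scale_class J"
    using F.class_mult[of J J] t_ideal_R[OF J(1)] J_idem_R[OF J] by (simp add: R.F_t_simps)
  ultimately show ?thesis using comm_group_constituent[OF F.class_comm_monoid] by blast
qed

lemma class_mult_T:
  assumes "t_ideal T A" "t_ideal T B"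
  shows "scale_class A \<otimes>\<^bsub>t_class_semigroup R\<^esub> scale_class B = scale_class (t_closure T (module_prod A B))"
proof -
  interpret F: ideal_classes "F_t R" "t_class_semigroup R" by (rule R.t_ideal_classes)
  show ?thesis
    using F.class_mult[of A B] t_ideal_R assms t_closure_prod_eq[OF T.t_ideal_nz T.t_ideal_nz]
    by (simp add: R.F_t_simps)
qed

lemma class_group_mult:
  assumes "A \<in> carrier (Inv_t T)" "B \<in> carrier (Inv_t T)"
  shows "scale_class A \<otimes>\<^bsub>class_group T\<^esub> scale_class B = scale_class (t_closure T (module_prod A B))"
proof -
  interpret I: ideal_classes "Inv_t T" "class_group T" by (rule T.inv_ideal_classes)
  show ?thesis using I.class_mult[OF assms] by (simp add: Inv_t_def units_of_mult T.F_t_simps)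
qed

lemma class_group_carrier: "carrier (class_group T) = scale_class ` carrier (Inv_t T)"
  using ideal_classes.class_carrier[OF T.inv_ideal_classes] .

lemma class_group_one: "\<one>\<^bsub>class_group T\<^esub> = scale_class T"
  using ideal_classes.class_one[OF T.inv_ideal_classes] by (simp add: Inv_t_def units_of_one T.F_t_simps)

text \<open>For J = T the constituent ideals are the t-invertible t-ideals of T. Carriers and
  products of the two groups agree, so the identity map is an isomorphism.\<close>

lemma constituent_iso_class_group:
  "constituent_group (t_class_semigroup R) (scale_class T) \<cong> class_group T"
proof -
  let ?G = "constituent_group (t_class_semigroup R) (scale_class T)"
  have unit: "t_closure T (module_prod A T) = A" if "t_ideal T A" for A
    using module_prod_unit_right[OF _ T.one_mem] T.t_ideal_nz[OF that] that by (simp add: t_ideal_def)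
  have "constituent_ideals T T = carrier (Inv_t T)"
    unfolding constituent_ideals_def T.carrier_Inv_t using unit by blast
  then have car: "carrier ?G = scale_class ` carrier (Inv_t T)"
    using constituent_class_carrier[OF T.t_ideal_self unit[OF T.t_ideal_self]] by simp
  have "id \<in> hom ?G (class_group T)"
  proof (rule homI)
    fix X Y assume "X \<in> carrier ?G" "Y \<in> carrier ?G"
    then obtain A B where AB: "A \<in> carrier (Inv_t T)" "B \<in> carrier (Inv_t T)" "X = scale_class A"
      "Y = scale_class B" unfolding car by blast
    then have "t_ideal T A" "t_ideal T B" by (simp_all add: T.carrier_Inv_t)
    then show "id (X \<otimes>\<^bsub>?G\<^esub> Y) = id X \<otimes>\<^bsub>class_group T\<^esub> id Y"
      using class_mult_T class_group_mult[OF AB(1,2)] AB(3,4) by simp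
  qed (simp add: car class_group_carrier)
  then have "id \<in> iso ?G (class_group T)" by (simp add: iso_def car class_group_carrier)
  then show ?thesis unfolding is_iso_def by blast
qed

text \<open>Both maps take the image of a class under a map of ideals that commutes with scaling.
  The image of a class is then again a class, and no representatives have to be chosen.\<close>

lemma exact_sequence:
  fixes Q :: "nat \<Rightarrow> 'k set"
  assumes r: "1 \<le> r" and inj: "inj_on Q {1..r}"
    and Q: "\<And>i. i \<in> {1..r} \<Longrightarrow> t_maximal T (Q i) \<and> t_idempotent T (Q i)"
    and J: "J = (\<Inter>i\<in>{1..r}. Q i)" "colon J J = T"
  defines "G \<equiv> constituent_group (t_class_semigroup R) (t_cls R J)"
    and "\<phi> \<equiv> \<lambda>X. (\<lambda>L. t_closure R (module_prod L J)) ` X"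
    and "\<psi> \<equiv> \<lambda>X. \<lambda>i\<in>{1..r}. (\<lambda>L. module_prod L (localize T (Q i))) ` X"
  shows "\<forall>L\<in>carrier (Inv_t T). \<phi> (inv_cls T L) = t_cls R (t_closure R (module_prod L J))"
    and "\<forall>L. t_ideal R L \<and> t_cls R L \<in> carrier G \<longrightarrow>
      \<psi> (t_cls R L) = (\<lambda>i\<in>{1..r}. frac_cls (localize T (Q i)) (module_prod L (localize T (Q i))))"
    and "short_exact (class_group T) G
      (product_group {1..r} (\<lambda>i. constituent_group (class_semigroup (localize T (Q i)))
        (frac_cls (localize T (Q i)) (module_prod (Q i) (localize T (Q i)))))) \<phi> \<psi>"
proof -
  interpret X: idempotent_intersection T "Q ` {1..r}" J
    using Q r J by unfold_locales auto
  note tJ = X.t_ideal_J and JJ = X.J_idem and nzJ = X.nz_J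
  have G: "G = constituent_group (t_class_semigroup R) (scale_class J)"
    using R.t_cls_eq[OF t_ideal_R[OF tJ]] by (simp add: G_def)
  have carG: "carrier G = scale_class ` constituent_ideals T J"
    unfolding G by (rule constituent_class_carrier[OF tJ JJ])
  define E where "E i = local_part T (Q i) (Q i)" for i
  let ?V = "\<lambda>i. localize T (Q i)"
  define K where "K i = constituent_group (class_semigroup (?V i)) (frac_cls (?V i) (module_prod (Q i) (?V i)))" for i
  have pQ: "prime_in T (Q i)" if "i \<in> {1..r}" for i using X.prime_\<Q> that by blast
  have V: "domain_subring (?V i)" if "i \<in> {1..r}" for i
    using T.domain_localize[OF pQ[OF that]] by (simp add: domain_subring_def)
  have ext: "module_prod L (?V i) = local_part T (Q i) L" if "i \<in> {1..r}" "t_ideal T L" for i L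
    using T.module_prod_localize[OF pQ[OF that(1)]] T.t_ideal_nz[OF that(2)] by blast
  have fracE: "fractional_ideal (?V i) (local_part T (Q i) L)" if "i \<in> {1..r}" "t_ideal T L" for i L
    using T.fractional_local_part[OF pQ[OF that(1)]] that(2) by (simp add: t_ideal_def)
  have tQ: "t_ideal T (Q i)" if "i \<in> {1..r}" for i using Q[OF that] by (simp add: t_maximal_def)
  have EE: "module_prod (E i) (E i) = E i" if "i \<in> {1..r}" for i
    unfolding E_def using X.local_idem that by blast
  have fE: "fractional_ideal (?V i) (E i)" if "i \<in> {1..r}" for i
    unfolding E_def by (rule fracE[OF that tQ[OF that]])
  have K: "K i = constituent_group (class_semigroup (?V i)) (scale_class (E i))" if i: "i \<in> {1..r}" for i
    using domain_subring.frac_cls_eq[OF V[OF i], of "E i"] fE[OF i] ext[OF i tQ[OF i]]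
    by (simp add: K_def E_def fractional_ideal_def)
  have fc: "ideal_classes (F_frac (?V i)) (class_semigroup (?V i))" if "i \<in> {1..r}" for i
    by (rule domain_subring.frac_ideal_classes[OF V[OF that]])
  have Fs: "carrier (F_frac (?V i)) = {A. fractional_ideal (?V i) A}" "\<And>A B. A \<otimes>\<^bsub>F_frac (?V i)\<^esub> B = module_prod A B"
    if "i \<in> {1..r}" for i
    using domain_subring.F_frac_simps[OF V[OF that]] by simp_all
  have Kcar: "carrier (K i) = scale_class ` {A. fractional_ideal (?V i) A \<and> module_prod A (E i) = A \<and>
      (\<exists>B. fractional_ideal (?V i) B \<and> module_prod B (E i) = B \<and> module_prod A B = E i)}"
    if i: "i \<in> {1..r}" for i
    using ideal_classes.class_constituent[OF fc[OF i], of "E i"] fE[OF i] EE[OF i]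
    unfolding K[OF i] Fs[OF i] by simp
  have Kgroup: "group (K i)" if i: "i \<in> {1..r}" for i
  proof -
    have "scale_class (E i) \<in> carrier (class_semigroup (?V i))"
      using ideal_classes.class_carrier[OF fc[OF i]] Fs[OF i] fE[OF i] by simp
    moreover have "scale_class (E i) \<otimes>\<^bsub>class_semigroup (?V i)\<^esub> scale_class (E i) = scale_class (E i)"
      using ideal_classes.class_mult[OF fc[OF i], of "E i" "E i"] Fs[OF i] fE[OF i] EE[OF i] by simp
    ultimately show ?thesis
      unfolding K[OF i]
      using comm_group_constituent[OF ideal_classes.class_comm_monoid[OF fc[OF i]]]
      by (simp add: comm_group_def)
  qed
  have Kmult: "scale_class A \<otimes>\<^bsub>K i\<^esub> scale_class B = scale_class (module_prod A B)"
    if i: "i \<in> {1..r}" and "fractional_ideal (?V i) A" "fractional_ideal (?V i) B" for i A B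
    using ideal_classes.class_mult[OF fc[OF i], of A B] that Fs[OF i] by (simp add: K[OF i])
  have Kone: "\<one>\<^bsub>K i\<^esub> = scale_class (E i)" if "i \<in> {1..r}" for i
    by (simp add: K[OF that])
  have phi: "\<phi> (scale_class L) = scale_class (t_closure T (module_prod L J))" if L: "t_ideal T L" for L
  proof -
    note nzL = T.t_ideal_nz[OF L]
    have "nz_submodule R (module_prod L J)"
      using nz_submodule_module_prod[OF R.t_ideal_nz[OF t_ideal_R[OF L]] nzJ] .
    then have "t_closure R (module_prod ((*) x ` L) J) = (*) x ` t_closure T (module_prod L J)" if "x \<noteq> 0" for x
      using R.t_closure_scale[OF _ that] t_closure_prod_eq[OF nzL nzJ] by (simp add: module_prod_scale)
    then show ?thesis unfolding \<phi>_def scale_class_def by (auto simp: image_iff)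
  qed
  have psi: "\<psi> (scale_class L) = (\<lambda>i\<in>{1..r}. scale_class (local_part T (Q i) L))" if L: "t_ideal T L" for L
  proof -
    have "(\<lambda>L. module_prod L (?V i)) ` scale_class L = scale_class (local_part T (Q i) L)" if i: "i \<in> {1..r}" for i
      unfolding scale_class_def ext[OF i L, symmetric] module_prod_scale[symmetric] by blast
    then show ?thesis unfolding \<psi>_def by (intro restrict_ext)
  qed
  have LJ: "t_closure T (module_prod L J) \<in> constituent_ideals T J" if "L \<in> carrier (Inv_t T)" for L
    using that T.Inv_t_mult_left[OF _ _ _ tJ JJ] by (auto simp: T.carrier_Inv_t)
  have Inv_t: "t_ideal T L" if "L \<in> carrier (Inv_t T)" for L
    using that by (simp add: T.carrier_Inv_t)
  have cons_t: "t_ideal T L" if "L \<in> constituent_ideals T J" for L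
    using that by (simp add: constituent_ideals_def)
  show "\<forall>L\<in>carrier (Inv_t T). \<phi> (inv_cls T L) = t_cls R (t_closure R (module_prod L J))"
  proof
    fix L assume L: "L \<in> carrier (Inv_t T)"
    have "t_closure R (module_prod L J) = t_closure T (module_prod L J)"
      by (rule t_closure_prod_eq[OF T.t_ideal_nz[OF Inv_t[OF L]] nzJ])
    then show "\<phi> (inv_cls T L) = t_cls R (t_closure R (module_prod L J))"
      using phi[OF Inv_t[OF L]] T.inv_cls_eq[OF Inv_t[OF L]] R.t_cls_eq[OF t_ideal_R[OF cons_t[OF LJ[OF L]]]]
      by simp
  qed
  show "\<forall>L. t_ideal R L \<and> t_cls R L \<in> carrier G \<longrightarrow>
      \<psi> (t_cls R L) = (\<lambda>i\<in>{1..r}. frac_cls (?V i) (module_prod L (?V i)))"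
  proof (intro allI impI)
    fix L assume L: "t_ideal R L \<and> t_cls R L \<in> carrier G"
    then have eq: "t_cls R L = scale_class L" using R.t_cls_eq by blast
    then have "L \<in> constituent_ideals T J"
      using L constituent_classD[OF tJ JJ] unfolding G by simp
    then have t: "t_ideal T L" by (rule cons_t)
    have "scale_class (local_part T (Q i) L) = frac_cls (?V i) (module_prod L (?V i))" if i: "i \<in> {1..r}" for i
      using domain_subring.frac_cls_eq[OF V[OF i]] fracE[OF i t] ext[OF i t] by (simp add: fractional_ideal_def)
    then show "\<psi> (t_cls R L) = (\<lambda>i\<in>{1..r}. frac_cls (?V i) (module_prod L (?V i)))"
      unfolding eq psi[OF t] by (intro restrict_ext)
  qed
  have gG: "group G" using comm_group_constituent_class[OF tJ JJ] unfolding G by (simp add: comm_group_def)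
  have gC: "group (class_group T)" by (rule T.group_class_group)
  let ?K = "product_group {1..r} K"
  have gK: "group ?K" by (rule product_group[OF Kgroup])
  have oneG: "\<one>\<^bsub>G\<^esub> = scale_class J" by (simp add: G)
  have multG: "scale_class A \<otimes>\<^bsub>G\<^esub> scale_class B = scale_class (t_closure T (module_prod A B))"
    if "t_ideal T A" "t_ideal T B" for A B
    unfolding G using class_mult_T[OF that] by simp
  have phi_hom: "\<phi> \<in> hom (class_group T) G"
  proof (rule homI)
    show "\<phi> X \<in> carrier G" if "X \<in> carrier (class_group T)" for X
      using that phi Inv_t LJ unfolding class_group_carrier carG by auto
    fix X Y assume "X \<in> carrier (class_group T)" "Y \<in> carrier (class_group T)"
    then obtain A B where A: "A \<in> carrier (Inv_t T)" "X = scale_class A"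
      and B: "B \<in> carrier (Inv_t T)" "Y = scale_class B" unfolding class_group_carrier by blast
    note tA = Inv_t[OF A(1)] and tB = Inv_t[OF B(1)]
    \<comment> \<open>In the monoid of t-ideals (A J)(B J) = (A B) J, since J J = J.\<close>
    interpret F: comm_monoid "F_t T" by (rule T.comm_monoid_F_t)
    have car: "A \<in> carrier (F_t T)" "B \<in> carrier (F_t T)" "J \<in> carrier (F_t T)"
      using tA tB tJ by (simp_all add: T.F_t_simps)
    have "A \<otimes>\<^bsub>F_t T\<^esub> J \<otimes>\<^bsub>F_t T\<^esub> (B \<otimes>\<^bsub>F_t T\<^esub> J)
        = A \<otimes>\<^bsub>F_t T\<^esub> B \<otimes>\<^bsub>F_t T\<^esub> (J \<otimes>\<^bsub>F_t T\<^esub> J)"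
      using car by (simp add: F.m_ac)
    then have "t_closure T (module_prod (t_closure T (module_prod A J)) (t_closure T (module_prod B J)))
      = t_closure T (module_prod (t_closure T (module_prod A B)) J)"
      using JJ by (simp add: T.F_t_simps)
    then show "\<phi> (X \<otimes>\<^bsub>class_group T\<^esub> Y) = \<phi> X \<otimes>\<^bsub>G\<^esub> \<phi> Y"
      unfolding A(2) B(2) class_group_mult[OF A(1) B(1)] phi[OF tA] phi[OF tB] phi[OF T.t_ideal_prod[OF tA tB]]
        multG[OF cons_t[OF LJ[OF A(1)]] cons_t[OF LJ[OF B(1)]]] by simp
  qed
  have phi_mon: "\<phi> \<in> mon (class_group T) G"
    unfolding mon_iff_hom_one[OF gC gG]
  proof (intro conjI allI impI phi_hom)
    fix X assume X: "X \<in> carrier (class_group T) \<and> \<phi> X = \<one>\<^bsub>G\<^esub>"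
    then obtain L where L: "L \<in> carrier (Inv_t T)" "X = scale_class L" unfolding class_group_carrier by blast
    then obtain L' where L': "t_ideal T L" "t_ideal T L'" "t_closure T (module_prod L L') = T"
      by (auto simp: T.carrier_Inv_t)
    have "scale_class (t_closure T (module_prod L J)) = scale_class J"
      using X phi[OF L'(1)] L(2) oneG by simp
    then obtain x where x: "x \<noteq> 0" "t_closure T (module_prod L J) = (*) x ` J"
      unfolding scale_class_eq_iff by blast
    have "L = (*) x ` T" by (rule T.principal_of_Inv_t_mult[OF L' tJ J(2) x])
    with x(1) show "X = \<one>\<^bsub>class_group T\<^esub>"
      unfolding L(2) class_group_one by (simp add: scale_class_scale)
  qed
  have loc_mem: "scale_class (local_part T (Q i) A) \<in> carrier (K i)"
    if A: "A \<in> constituent_ideals T J" and i: "i \<in> {1..r}" for A i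
  proof -
    have "module_prod (local_part T (Q i) A) (E i) = local_part T (Q i) A"
      "\<exists>B. fractional_ideal (?V i) B \<and> module_prod B (E i) = B \<and> module_prod (local_part T (Q i) A) B = E i"
      unfolding E_def using X.constituent_local[OF A] i by blast+
    then show ?thesis
      unfolding Kcar[OF i] using fracE[OF i cons_t[OF A]] by (intro imageI CollectI conjI)
  qed
  have psi_hom: "\<psi> \<in> hom G ?K"
  proof (rule homI)
    show "\<psi> X \<in> carrier ?K" if X: "X \<in> carrier G" for X
    proof -
      obtain A where A: "A \<in> constituent_ideals T J" "X = scale_class A" using X unfolding carG by blast
      then show ?thesis
        using psi[OF cons_t[OF A(1)]] loc_mem[OF A(1)] by simp
    qed
    fix X Y assume "X \<in> carrier G" "Y \<in> carrier G"
    then obtain A B where A: "A \<in> constituent_ideals T J" "X = scale_class A"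
      and B: "B \<in> constituent_ideals T J" "Y = scale_class B" unfolding carG by blast
    note tA = cons_t[OF A(1)] and tB = cons_t[OF B(1)]
    have "scale_class (local_part T (Q i) (t_closure T (module_prod A B)))
        = scale_class (local_part T (Q i) A) \<otimes>\<^bsub>K i\<^esub> scale_class (local_part T (Q i) B)"
      if i: "i \<in> {1..r}" for i
      using X.local_t_closure_prod[OF imageI[OF i] T.t_ideal_nz[OF tA] T.t_ideal_nz[OF tB]]
        Kmult[OF i fracE[OF i tA] fracE[OF i tB]] by simp
    then show "\<psi> (X \<otimes>\<^bsub>G\<^esub> Y) = \<psi> X \<otimes>\<^bsub>?K\<^esub> \<psi> Y"
      unfolding A(2) B(2) multG[OF tA tB] psi[OF tA] psi[OF tB] psi[OF T.t_ideal_prod[OF tA tB]]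
        mult_product_group
      by (intro restrict_ext) simp
  qed
  have psi_surj: "carrier ?K \<subseteq> \<psi> ` carrier G"
  proof
    fix f assume f: "f \<in> carrier ?K"
    let ?P = "\<lambda>i A. f i = scale_class A \<and> fractional_ideal (?V i) A \<and> module_prod A (E i) = A \<and>
      (\<exists>B. fractional_ideal (?V i) B \<and> module_prod A B = E i)"
    have "\<forall>i\<in>{1..r}. \<exists>A. ?P i A"
    proof
      fix i assume i: "i \<in> {1..r}"
      then have "f i \<in> carrier (K i)" using f by (auto simp: PiE_iff)
      then show "\<exists>A. ?P i A" unfolding Kcar[OF i] by blast
    qed
    then obtain A where A: "\<And>i. i \<in> {1..r} \<Longrightarrow> ?P i (A i)" by metis
    \<comment> \<open>The gluing lemma indexes modules by ideals and the product group by numbers; h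
      translates, which is where injectivity of Q is used.\<close>
    define h where "h = the_inv_into {1..r} Q"
    have h: "h (Q i) = i" if "i \<in> {1..r}" for i
      unfolding h_def using the_inv_into_f_f[OF inj that] .
    have "\<exists>L\<in>constituent_ideals T J. \<forall>P\<in>Q ` {1..r}. scale_class (local_part T P L) = scale_class (A (h P))"
    proof (rule X.constituent_ideal_surj)
      fix P assume "P \<in> Q ` {1..r}"
      then obtain i where i: "i \<in> {1..r}" "P = Q i" by blast
      show "fractional_ideal (localize T P) (A (h P))"
        "module_prod (A (h P)) (local_part T P P) = A (h P)"
        "\<exists>B. fractional_ideal (localize T P) B \<and> module_prod (A (h P)) B = local_part T P P"
        using A[OF i(1)] h[OF i(1)] i(2) by (simp_all add: E_def)
    qed
    then obtain L where L: "L \<in> constituent_ideals T J"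
      "\<And>i. i \<in> {1..r} \<Longrightarrow> scale_class (local_part T (Q i) L) = scale_class (A i)"
      using h by auto
    have "\<psi> (scale_class L) = f"
    proof
      fix i
      show "\<psi> (scale_class L) i = f i"
      proof (cases "i \<in> {1..r}")
        case True
        then show ?thesis using L(2)[OF True] A[OF True] psi[OF cons_t[OF L(1)]] by simp
      next
        case False
        \<comment> \<open>Elements of the product group are extensional, so outside the index set
          both functions take the default value.\<close>
        have "f i = undefined"
          using f False PiE_arb[of f "{1..r}" "\<lambda>i. carrier (K i)" i] by simp
        moreover have "\<psi> (scale_class L) i = undefined"
          unfolding psi[OF cons_t[OF L(1)]] restrict_apply using False by (simp only: if_False)
        ultimately show ?thesis by simp
      qed
    qed
    then show "f \<in> \<psi> ` carrier G" using L(1) carG by blast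
  qed
  have psi_epi: "\<psi> \<in> epi G ?K"
    using psi_surj psi_hom unfolding epi_def hom_def by blast
  have psi_one: "\<psi> (scale_class A) = \<one>\<^bsub>?K\<^esub> \<longleftrightarrow>
      (\<forall>i\<in>{1..r}. scale_class (local_part T (Q i) A) = scale_class (E i))" if A: "t_ideal T A" for A
  proof -
    have "\<psi> (scale_class A) = \<one>\<^bsub>?K\<^esub> \<longleftrightarrow> (\<forall>i\<in>{1..r}. scale_class (local_part T (Q i) A) = \<one>\<^bsub>K i\<^esub>)"
      unfolding psi[OF A] one_product_group by (auto simp: restrict_def fun_eq_iff)
    then show ?thesis using Kone by simp
  qed
  have exact: "\<phi> ` carrier (class_group T) = kernel G ?K \<psi>"
  proof
    show "\<phi> ` carrier (class_group T) \<subseteq> kernel G ?K \<psi>"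
    proof
      fix X assume "X \<in> \<phi> ` carrier (class_group T)"
      then obtain L where L: "L \<in> carrier (Inv_t T)" "X = \<phi> (scale_class L)"
        unfolding class_group_carrier by blast
      then obtain L' where L': "t_ideal T L" "t_ideal T L'" "t_closure T (module_prod L L') = T"
        by (auto simp: T.carrier_Inv_t)
      have X: "X = scale_class (t_closure T (module_prod L J))" using L(2) phi[OF L'(1)] by simp
      have "scale_class (local_part T (Q i) (t_closure T (module_prod L J))) = scale_class (E i)"
        if i: "i \<in> {1..r}" for i
        using X.local_Inv_t_mult[OF L' imageI[OF i]] unfolding scale_class_eq_iff E_def .
      then have "\<psi> X = \<one>\<^bsub>?K\<^esub>" unfolding X using psi_one[OF cons_t[OF LJ[OF L(1)]]] by blast
      then show "X \<in> kernel G ?K \<psi>" unfolding kernel_def X carG using LJ[OF L(1)] by blast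
    qed
    show "kernel G ?K \<psi> \<subseteq> \<phi> ` carrier (class_group T)"
    proof
      fix X assume "X \<in> kernel G ?K \<psi>"
      then obtain A where A: "A \<in> constituent_ideals T J" "X = scale_class A" "\<psi> (scale_class A) = \<one>\<^bsub>?K\<^esub>"
        unfolding kernel_def carG by blast
      \<comment> \<open>The identity of the i-th factor is the class of \<open>E i\<close>, so a
        trivial image means that A is locally a multiple of every Q i.\<close>
      have "\<exists>x. x \<noteq> 0 \<and> local_part T P A = (*) x ` local_part T P P" if "P \<in> Q ` {1..r}" for P
        using A(3) that unfolding psi_one[OF cons_t[OF A(1)]] scale_class_eq_iff E_def by blast
      then obtain L L' where L: "t_ideal T L" "t_ideal T L'" "t_closure T (module_prod L L') = T"
        "t_closure T (module_prod L J) = A"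
        using X.locally_principal_imp_Inv_t_mult[OF A(1)] by blast
      then have "L \<in> carrier (Inv_t T)" by (auto simp: T.carrier_Inv_t)
      moreover have "X = \<phi> (scale_class L)" using phi[OF L(1)] L(4) A(2) by simp
      ultimately show "X \<in> \<phi> ` carrier (class_group T)" unfolding class_group_carrier by blast
    qed
  qed
  show "short_exact (class_group T) G
      (product_group {1..r} (\<lambda>i. constituent_group (class_semigroup (?V i))
        (frac_cls (?V i) (module_prod (Q i) (?V i))))) \<phi> \<psi>"
    unfolding short_exact_def K_def[symmetric]
    using gC gG gK phi_mon psi_epi exact by blast
qed

end

section \<open>Existence and uniqueness of J, and the two descriptions of its group\<close>

theorem theorem2p1:
  fixes R I T :: "'k::field set"
  assumes "krull_type R"
    and "t_ideal R I"
    and "T = colon I I"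
  shows
    "(idempotent_in (t_class_semigroup R) (t_cls R I) \<longleftrightarrow>
        (\<exists>!J. J \<in> {T} \<union> Gamma_of I \<and> t_cls R I = t_cls R J)) \<and>
     (idempotent_in (t_class_semigroup R) (t_cls R I) \<longrightarrow>
        (\<forall>J. J \<in> {T} \<union> Gamma_of I \<and> t_cls R I = t_cls R J \<longrightarrow>
          (J = T \<longrightarrow>
             group (constituent_group (t_class_semigroup R) (t_cls R J)) \<and>
             group (class_group T) \<and>
             constituent_group (t_class_semigroup R) (t_cls R J) \<cong> class_group T) \<and>
          (\<forall>(r::nat) Q.
             1 \<le> r \<and> inj_on Q {1..r} \<and>
             (\<forall>i\<in>{1..r}. t_maximal T (Q i) \<and> t_idempotent T (Q i)) \<and>
             J = (\<Inter>i\<in>{1..r}. Q i) \<longrightarrow>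
             (\<exists>\<phi> \<psi>.
                (\<forall>L\<in>carrier (Inv_t T).
                   \<phi> (inv_cls T L) = t_cls R (t_closure R (module_prod L J))) \<and>
                (\<forall>L. t_ideal R L \<and>
                     t_cls R L \<in> carrier (constituent_group (t_class_semigroup R) (t_cls R J)) \<longrightarrow>
                   \<psi> (t_cls R L) =
                     (\<lambda>i\<in>{1..r}. frac_cls (localize T (Q i)) (module_prod L (localize T (Q i))))) \<and>
                short_exact
                  (class_group T)
                  (constituent_group (t_class_semigroup R) (t_cls R J))
                  (product_group {1..r}
                     (\<lambda>i. constituent_group (class_semigroup (localize T (Q i)))
                        (frac_cls (localize T (Q i)) (module_prod (Q i) (localize T (Q i))))))
                  \<phi> \<psi>))))"
proof -
  note I = assms(2)
  interpret R: krull_domain R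
    using assms(1) by unfold_locales (auto simp: krull_type_def pvmd_def)
  have fI: "fractional_ideal R I" using I by (simp add: t_ideal_def)
  interpret krull_overring R T
    using R.domain_colon[OF I] R.t_ideal_colon[OF I fI] assms(3) by unfold_locales simp_all
  interpret F: ideal_classes "F_t R" "t_class_semigroup R" by (rule R.t_ideal_classes)
  have "submodule_of T I"
    using R.t_ideal_nz[OF I] unfolding assms(3) submodule_of_def colon_def by blast
  then have IT: "t_ideal T I" using t_ideal_iff I by blast
  have cand: "t_ideal T J \<and> t_closure T (module_prod J J) = J" if "J \<in> {T} \<union> Gamma_of I" for J
  proof (cases "J = T")
    case True
    then show ?thesis
      using T.t_ideal_self module_prod_unit[OF T.submodule_self T.one_mem] by (simp add: t_ideal_def)
  next
    case False
    then obtain \<Q> where Q: "J = \<Inter>\<Q>" "finite \<Q>" "\<Q> \<noteq> {}" "\<forall>Q\<in>\<Q>. t_maximal T Q \<and> t_idempotent T Q"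
      using \<open>J \<in> _\<close> unfolding Gamma_of_def assms(3) by blast
    show ?thesis
      unfolding Q(1) using T.t_ideal_Inter[OF Q(2,3)] T.Inter_idempotent[OF Q(2,3)] Q(4) by blast
  qed
  have cls: "t_cls R J = scale_class J" if "t_ideal T J" for J
    using R.t_cls_eq[OF t_ideal_R[OF that]] .
  have unique: "J = J'"
    if J: "J \<in> {T} \<union> Gamma_of I" "J' \<in> {T} \<union> Gamma_of I" "t_cls R J = t_cls R J'" for J J'
  proof -
    note c = cand[OF J(1)] and c' = cand[OF J(2)]
    obtain x where x: "x \<noteq> 0" "J = (*) x ` J'"
    proof -
      have "scale_class J = scale_class J'" using J(3) cls[of J] cls[of J'] c c' by simp
      then show ?thesis using that unfolding scale_class_eq_iff by blast
    qed
    have nz': "nz_submodule T J'" using T.t_ideal_nz c' by blast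
    have "nz_submodule T (module_prod J' J')" by (rule nz_submodule_module_prod[OF nz' nz'])
    \<comment> \<open>The square of J = x J' has t-closure x x J', and t-idempotence makes it x J'.
      Cancelling one x gives x J' = J'.\<close>
    then have "t_closure T (module_prod J J) = (*) (x * x) ` J'"
      using T.t_closure_scale[of "module_prod J' J'" "x * x"] x c' by (simp add: T.scale_prod)
    then have "(*) x ` (*) x ` J' = (*) x ` J'" using c x(2) by (simp add: scale_scale)
    then have "(*) (inverse x) ` (*) x ` (*) x ` J' = (*) (inverse x) ` (*) x ` J'" by simp
    then show ?thesis unfolding x(2) T.scale_cancel[OF x(1)] .
  qed
  have idem_iff: "idempotent_in (t_class_semigroup R) (t_cls R I) \<longleftrightarrow>
      scale_class (t_closure T (module_prod I I)) = scale_class I"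
    using class_mult_T[OF IT IT] F.class_carrier I cls[OF IT]
    unfolding idempotent_in_def by (auto simp: R.F_t_simps)
  have exists: "\<exists>J. J \<in> {T} \<union> Gamma_of I \<and> t_cls R I = t_cls R J"
    if idm: "idempotent_in (t_class_semigroup R) (t_cls R I)"
  proof -
    obtain x where x: "x \<noteq> 0" "t_closure T (module_prod I I) = (*) x ` I"
      using idm unfolding idem_iff scale_class_eq_iff by blast
    \<comment> \<open>The square of I has t-closure x I. Dividing I by x gives the representative of
      its class that is t-idempotent on the nose.\<close>
    let ?J = "(*) (inverse x) ` I"
    have tJ: "t_ideal T ?J" using T.t_ideal_scale[OF IT] x(1) by simp
    have colJ: "colon ?J ?J = T" using colon_scale[of "inverse x" I I] x(1) assms(3) by simp
    have "nz_submodule T (module_prod I I)"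
      by (rule nz_submodule_module_prod[OF T.t_ideal_nz[OF IT] T.t_ideal_nz[OF IT]])
    then have "t_closure T (module_prod ?J ?J) = (*) (inverse x * inverse x) ` (*) x ` I"
      using T.t_closure_scale[of "module_prod I I" "inverse x * inverse x"] x by (simp add: T.scale_prod)
    also have "\<dots> = ?J"
    proof -
      have "inverse x * inverse x * x = inverse x" using x(1) by (simp add: mult.assoc)
      then show ?thesis unfolding scale_scale by (simp only:)
    qed
    finally have "?J = T \<or> ?J \<in> Gamma_of I"
      using T.idempotent_cases[OF tJ colJ] unfolding Gamma_of_def assms(3) by blast
    moreover have "t_cls R I = t_cls R ?J"
      using cls[OF IT] cls[OF tJ] scale_class_scale[of "inverse x" I] x(1) by simp
    ultimately show ?thesis by blast
  qed
  have idem: "idempotent_in (t_class_semigroup R) (t_cls R I)"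
    if J: "J \<in> {T} \<union> Gamma_of I" "t_cls R I = t_cls R J" for J
  proof -
    note c = cand[OF J(1)]
    have "scale_class I \<otimes>\<^bsub>t_class_semigroup R\<^esub> scale_class I = scale_class I"
      using class_mult_T[of J J] c J(2) cls[OF IT] cls[of J] by simp
    then show ?thesis using class_mult_T[OF IT IT] unfolding idem_iff by simp
  qed
  have part1: "(J = T \<longrightarrow>
             group (constituent_group (t_class_semigroup R) (t_cls R J)) \<and>
             group (class_group T) \<and>
             constituent_group (t_class_semigroup R) (t_cls R J) \<cong> class_group T)"
    if J: "J \<in> {T} \<union> Gamma_of I" for J
    using comm_group_constituent_class[of J] cand[OF J] cls[of J] T.group_class_group
      constituent_iso_class_group by (auto simp: comm_group_def)
  \<comment> \<open>Equality of classes makes J a multiple of I, which supplies the multiplier ring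
    hypothesis of \<open>exact_sequence\<close>.\<close>
  have colonJ: "colon J J = T" if J: "J \<in> {T} \<union> Gamma_of I" "t_cls R I = t_cls R J" for J
  proof -
    obtain x where "x \<noteq> 0" "J = (*) x ` I"
      using J(2) cls[OF IT] cls[of J] cand[OF J(1)] scale_class_eq_iff[of J I] by auto
    then show ?thesis using colon_scale[of x I I] assms(3) by simp
  qed
  have part2: "\<exists>\<phi> \<psi>.
                (\<forall>L\<in>carrier (Inv_t T).
                   \<phi> (inv_cls T L) = t_cls R (t_closure R (module_prod L J))) \<and>
                (\<forall>L. t_ideal R L \<and>
                     t_cls R L \<in> carrier (constituent_group (t_class_semigroup R) (t_cls R J)) \<longrightarrow>
                   \<psi> (t_cls R L) =
                     (\<lambda>i\<in>{1..r}. frac_cls (localize T (Q i)) (module_prod L (localize T (Q i))))) \<and>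
                short_exact
                  (class_group T)
                  (constituent_group (t_class_semigroup R) (t_cls R J))
                  (product_group {1..r}
                     (\<lambda>i. constituent_group (class_semigroup (localize T (Q i)))
                        (frac_cls (localize T (Q i)) (module_prod (Q i) (localize T (Q i))))))
                  \<phi> \<psi>"
    if J: "J \<in> {T} \<union> Gamma_of I" "t_cls R I = t_cls R J"
      and Q: "1 \<le> r \<and> inj_on Q {1..r} \<and> (\<forall>i\<in>{1..r}. t_maximal T (Q i) \<and> t_idempotent T (Q i)) \<and>
             J = (\<Inter>i\<in>{1..r}. Q i)" for J and r :: nat and Q
  proof -
    have Q': "1 \<le> r" "inj_on Q {1..r}" "\<And>i. i \<in> {1..r} \<Longrightarrow> t_maximal T (Q i) \<and> t_idempotent T (Q i)"
      "J = (\<Inter>i\<in>{1..r}. Q i)" using Q by blast+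
    note ex = exact_sequence[OF Q' colonJ[OF J]]
    show ?thesis
    proof (rule exI[of _ "\<lambda>X. (\<lambda>L. t_closure R (module_prod L J)) ` X"],
        rule exI[of _ "\<lambda>X. \<lambda>i\<in>{1..r}. (\<lambda>L. module_prod L (localize T (Q i))) ` X"], intro conjI, goal_cases)
      case 1
      show ?case by (rule ex(1))
    next
      case 2
      show ?case by (rule ex(2))
    next
      case 3
      show ?case by (rule ex(3))
    qed
  qed
  have iff: "idempotent_in (t_class_semigroup R) (t_cls R I) \<longleftrightarrow>
        (\<exists>!J. J \<in> {T} \<union> Gamma_of I \<and> t_cls R I = t_cls R J)"
  proof
    assume "idempotent_in (t_class_semigroup R) (t_cls R I)"
    then obtain J where J: "J \<in> {T} \<union> Gamma_of I" "t_cls R I = t_cls R J" using exists by blast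
    show "\<exists>!J. J \<in> {T} \<union> Gamma_of I \<and> t_cls R I = t_cls R J"
    proof (rule ex1I[of _ J])
      fix J' assume J': "J' \<in> {T} \<union> Gamma_of I \<and> t_cls R I = t_cls R J'"
      then have "t_cls R J' = t_cls R J" using J(2) by simp
      then show "J' = J" using unique[of J' J] J' J(1) by blast
    qed (use J in blast)
  next
    assume "\<exists>!J. J \<in> {T} \<union> Gamma_of I \<and> t_cls R I = t_cls R J"
    then show "idempotent_in (t_class_semigroup R) (t_cls R I)" using idem by blast
  qed
  show ?thesis
    by (rule conjI, rule iff, intro impI allI, elim conjE, rule conjI, rule part1, assumption,
      intro allI impI, rule part2, assumption+)
qed

end
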